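(* Let $d\ge1$ be an integer, $T>0$, let $b\in L^1([0,T];L^2(\mathbb{T}^d))$ be a divergence-free vector field and let $u_0\in L^2(\mathbb{T}^d)$. Then there exists at least one parabolic solution to the Cauchy problem $\partial_t u+\operatorname{div}(bu)=\Delta u$ in $(0,T)\times\mathbb{T}^d$, $u|_{t=0}=u_0$.
   Context: $\mathbb{T}^d=\mathbb{R}^d/\mathbb{Z}^d$ is the flat torus. A vector field $b:[0,T]\times\mathbb{T}^d\to\mathbb{R}^d$ is divergence-free if $\operatorname{div}_x b=0$ in the sense of distributions. Parabolic solution: for $b\in L^1([0,T];L^2(\mathbb{T}^d))$ divergence-free and $u_0\in L^2(\mathbb{T}^d)$, a function $u\in L^\infty([0,T];L^2(\mathbb{T}^d))$ is a parabolic solution if $u\in L^2([0,T];H^1(\mathbb{T}^d))$ and $u$ is a distributional solution, i.e. for every $\varphi\in C_c^\infty([0,T)\times\mathbb{T}^d)$ $$\int_0^T\int_{\mathbb{T}^d}u(\partial_t\varphi+b\cdot\nabla\varphi+\Delta\varphi)\,dx\,dt+\int_{\mathbb{T}^d}u_0\,\varphi(0,\cdot)\,dx=0.$$ *)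

theory Defs
  imports "HOL-Analysis.Analysis"
begin

text \<open>
  A function on the flat torus \<open>\<real>\<^sup>d / \<int>\<^sup>d\<close> is a \<open>\<int>\<^sup>d\<close>-periodic function on
  \<^typ>\<open>real ^ 'n\<close>, where \<open>d = CARD('n)\<close>; it is integrated over the fundamental domain
  \<open>[0,1]\<^sup>d\<close>. Elements of Lebesgue spaces are represented by functions, not by classes.
\<close>

definition periodic :: "(real ^ 'n \<Rightarrow> 'b) \<Rightarrow> bool" where
  "periodic f \<longleftrightarrow> (\<forall>k. (\<forall>i. k $ i \<in> \<int>) \<longrightarrow> (\<forall>x. f (x + k) = f x))"

definition torus :: "(real ^ 'n) measure" where
  "torus = lebesgue_on (cbox 0 1)"

primrec C_k :: "nat \<Rightarrow> ('a::euclidean_space \<Rightarrow> real) \<Rightarrow> bool" where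
  "C_k 0 f \<longleftrightarrow> continuous_on UNIV f"
| "C_k (Suc k) f \<longleftrightarrow>
     f differentiable_on UNIV \<and> (\<forall>v. C_k k (\<lambda>z. frechet_derivative f (at z) v))"

definition smooth :: "('a::euclidean_space \<Rightarrow> real) \<Rightarrow> bool" where
  "smooth f \<longleftrightarrow> (\<forall>k. C_k k f)"

definition dir_deriv ::
    "'a::euclidean_space \<Rightarrow> ('a \<Rightarrow> real) \<Rightarrow> 'a \<Rightarrow> real" where
  "dir_deriv v f z = frechet_derivative f (at z) v"

definition time_deriv :: "(real \<times> (real ^ 'n) \<Rightarrow> real) \<Rightarrow> real \<times> (real ^ 'n) \<Rightarrow> real" where
  "time_deriv \<phi> = dir_deriv (1, 0) \<phi>"

definition space_grad ::
    "(real \<times> (real ^ 'n) \<Rightarrow> real) \<Rightarrow> real \<times> (real ^ 'n) \<Rightarrow> real ^ 'n" where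
  "space_grad \<phi> z = (\<chi> i. dir_deriv (0, axis i 1) \<phi> z)"

definition space_laplacian ::
    "(real \<times> (real ^ 'n) \<Rightarrow> real) \<Rightarrow> real \<times> (real ^ 'n) \<Rightarrow> real" where
  "space_laplacian \<phi> z =
     (\<Sum>i\<in>UNIV. dir_deriv (0, axis i 1) (dir_deriv (0, axis i 1) \<phi>) z)"

text \<open>
  \<open>C\<^sub>c\<^sup>\<infinity>(I \<times> \<real>\<^sup>d/\<int>\<^sup>d)\<close> for an interval \<open>I\<close> of times. Only the values on \<open>I\<close> matter:
  smoothness up to an endpoint belonging to \<open>I\<close> means having a smooth extension across it,
  and the extension is part of the representation. Since the torus is compact, the support
  is compact as soon as its projection to \<open>I\<close> lies in a compact subset of \<open>I\<close>.
\<close>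

definition test_functions :: "real set \<Rightarrow> (real \<times> (real ^ 'n) \<Rightarrow> real) set" where
  "test_functions I =
     {\<phi>. smooth \<phi> \<and> (\<forall>t. periodic (\<lambda>x. \<phi> (t, x))) \<and>
         (\<exists>K. compact K \<and> K \<subseteq> I \<and> (\<forall>t \<in> I - K. \<forall>x. \<phi> (t, x) = 0))}"

definition torus_L2 :: "(real ^ 'n \<Rightarrow> 'b::euclidean_space) set" where
  "torus_L2 =
     {f. periodic f \<and> f \<in> borel_measurable torus \<and> integrable torus (\<lambda>x. (norm (f x))\<^sup>2)}"

definition L2_torus_norm :: "(real ^ 'n \<Rightarrow> 'b::euclidean_space) \<Rightarrow> real" where
  "L2_torus_norm f = sqrt (LINT x|torus. (norm (f x))\<^sup>2)"

definition has_weak_gradient ::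
    "(real ^ 'n \<Rightarrow> real) \<Rightarrow> (real ^ 'n \<Rightarrow> real ^ 'n) \<Rightarrow> bool" where
  "has_weak_gradient f g \<longleftrightarrow>
     g \<in> torus_L2 \<and>
     (\<forall>\<psi> i. smooth \<psi> \<and> periodic \<psi> \<longrightarrow>
        (LINT x|torus. f x * dir_deriv (axis i 1) \<psi> x) = - (LINT x|torus. g x $ i * \<psi> x))"

definition torus_H1 :: "(real ^ 'n \<Rightarrow> real) set" where
  "torus_H1 = {f \<in> torus_L2. \<exists>g. has_weak_gradient f g}"

text \<open>The choice is immaterial: weak gradients are unique almost everywhere.\<close>

definition weak_gradient :: "(real ^ 'n \<Rightarrow> real) \<Rightarrow> real ^ 'n \<Rightarrow> real ^ 'n" where
  "weak_gradient f = (SOME g. has_weak_gradient f g)"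

definition H1_torus_norm :: "(real ^ 'n \<Rightarrow> real) \<Rightarrow> real" where
  "H1_torus_norm f = sqrt ((L2_torus_norm f)\<^sup>2 + (L2_torus_norm (weak_gradient f))\<^sup>2)"

text \<open>
  The Bochner spaces \<open>L\<^sup>p([0,T];X)\<close> for \<open>X = L\<^sup>2\<close> or \<open>X = H\<^sup>1\<close>. As \<open>X\<close> is separable and embeds
  continuously into \<open>L\<^sup>2\<close>, an \<open>X\<close>-valued map is strongly measurable iff it has a jointly
  measurable representative \<open>u(t,x)\<close>.
\<close>

definition space_time_fun ::
    "real \<Rightarrow> (real \<Rightarrow> real ^ 'n \<Rightarrow> 'b::euclidean_space) \<Rightarrow> bool" where
  "space_time_fun T u \<longleftrightarrow>
     (\<forall>t \<in> {0..T}. periodic (u t)) \<and>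
     (\<lambda>(t, x). u t x) \<in> borel_measurable (lebesgue_on ({0..T} \<times> cbox 0 1))"

definition bochner_Lp ::
    "nat \<Rightarrow> real \<Rightarrow> (real ^ 'n \<Rightarrow> 'b::euclidean_space) set \<Rightarrow> ((real ^ 'n \<Rightarrow> 'b) \<Rightarrow> real) \<Rightarrow>
     (real \<Rightarrow> real ^ 'n \<Rightarrow> 'b) set" where
  "bochner_Lp p T X N =
     {u. space_time_fun T u \<and> (AE t in lebesgue_on {0..T}. u t \<in> X) \<and>
         integrable (lebesgue_on {0..T}) (\<lambda>t. N (u t) ^ p)}"

definition bochner_Linf ::
    "real \<Rightarrow> (real ^ 'n \<Rightarrow> 'b::euclidean_space) set \<Rightarrow> ((real ^ 'n \<Rightarrow> 'b) \<Rightarrow> real) \<Rightarrow>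
     (real \<Rightarrow> real ^ 'n \<Rightarrow> 'b) set" where
  "bochner_Linf T X N =
     {u. space_time_fun T u \<and> (AE t in lebesgue_on {0..T}. u t \<in> X) \<and>
         (\<exists>C. AE t in lebesgue_on {0..T}. N (u t) \<le> C)}"

definition divergence_free :: "real \<Rightarrow> (real \<Rightarrow> real ^ 'n \<Rightarrow> real ^ 'n) \<Rightarrow> bool" where
  "divergence_free T b \<longleftrightarrow>
     (\<forall>\<phi> \<in> test_functions {0<..<T}.
        (LINT t|lebesgue_on {0..T}. LINT x|torus. b t x \<bullet> space_grad \<phi> (t, x)) = 0)"

definition distributional_solution ::
    "real \<Rightarrow> (real \<Rightarrow> real ^ 'n \<Rightarrow> real ^ 'n) \<Rightarrow> (real ^ 'n \<Rightarrow> real) \<Rightarrow>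
     (real \<Rightarrow> real ^ 'n \<Rightarrow> real) \<Rightarrow> bool" where
  "distributional_solution T b u\<^sub>0 u \<longleftrightarrow>
     (\<forall>\<phi> \<in> test_functions {0..<T}.
        (LINT t|lebesgue_on {0..T}. LINT x|torus.
           u t x * (time_deriv \<phi> (t, x) + b t x \<bullet> space_grad \<phi> (t, x)
                    + space_laplacian \<phi> (t, x)))
        + (LINT x|torus. u\<^sub>0 x * \<phi> (0, x)) = 0)"

definition parabolic_solution ::
    "real \<Rightarrow> (real \<Rightarrow> real ^ 'n \<Rightarrow> real ^ 'n) \<Rightarrow> (real ^ 'n \<Rightarrow> real) \<Rightarrow>
     (real \<Rightarrow> real ^ 'n \<Rightarrow> real) \<Rightarrow> bool" where
  "parabolic_solution T b u\<^sub>0 u \<longleftrightarrow>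
     u \<in> bochner_Linf T torus_L2 L2_torus_norm \<and>
     u \<in> bochner_Lp 2 T torus_H1 H1_torus_norm \<and>
     distributional_solution T b u\<^sub>0 u"

end

theory Submission
  imports Defs "HOL-Complex_Analysis.Great_Picard"
begin

text \<open>
  The solution is a Galerkin limit in the Hartley basis
  \<open>cas\<^sub>k(x) = cos(2\<pi> k\<cdot>x) + sin(2\<pi> k\<cdot>x)\<close>, \<open>k \<in> \<int>\<^sup>d\<close>: it is real and orthonormal, and
  \<open>\<partial>\<^sub>i cas\<^sub>k = 2\<pi> k\<^sub>i cas\<^bsub>-k\<^esub>\<close>. As \<open>div b = 0\<close>, the transport part of the Galerkin system is
  antisymmetric. The drift is only integrable in time, but since its time averages are still
  antisymmetric, an explicit Euler scheme with a step that is small depending on the dimension of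
  the Galerkin space obeys the energy estimate up to a constant. Each coefficient is then
  equicontinuous in time, uniformly in the dimension, so Arzela-Ascoli gives a limit along a diagonal
  sequence. The equation is linear, hence weak convergence in \<open>L\<^sup>2\<close> of the torus at each time
  suffices to pass to the limit, and the bounds for \<open>u\<close> and \<open>\<nabla>u\<close> are read off from the
  coefficients. A general test function is reduced to the modes \<open>cas\<^sub>k\<close> by convolution with a
  positive trigonometric kernel, which commutes with all derivatives.
\<close>

section \<open>Explicit Euler scheme for an antisymmetric system with integrable coefficients\<close>

text \<open>Two obstacles shape the argument. The divergence condition is tested in space and time
  together, and \<open>b\<close> has no continuity in time. Antisymmetry is therefore available for
  integrals over time intervals, not at single times, and a scheme that evaluates coefficients at
  points would not see it. Freezing the unknown on a time cell and integrating the coefficients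
  exactly makes the transport part of every step matrix antisymmetric. The solution must be a
  jointly measurable function, periodic at every time, whereas its coefficients determine only a
  class at each time. It is therefore built as one limit of partial sums in L^2 of space-time and
  sliced afterwards. Being the sum of its own series, it can be paired with any L^2 function through
  coefficients, in particular with b . grad e_j, which is in L^2 at almost every time. Completeness
  of the basis serves the uniqueness of weak gradients, which matters because
  \<open>weak_gradient\<close> is a choice and the H^1 norm refers to it.\<close>

lemma integral_Ioc_const:
  fixes T :: real
  assumes "0 \<le> a" "a \<le> b" "b \<le> T"
  shows "(LINT s|lebesgue_on {0..T}. indicat_real {a<..b} s * c) = (b - a) * c"
proof -
  have "(LINT s|lebesgue_on {0..T}. indicat_real {a<..b} s) = measure (lebesgue_on {0..T}) {a<..b}"
  proof -
    have "{a<..b} \<inter> {0..T} = {a<..b}" using assms by auto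
    then show ?thesis by simp
  qed
  also have "\<dots> = b - a"
  proof -
    have "measure (lebesgue_on {0..T}) {a<..b} = measure lebesgue {a<..b}"
      using assms by (intro measure_restrict_space) auto
    also have "\<dots> = b - a" using assms by simp
    finally show ?thesis .
  qed
  finally show ?thesis by simp
qed

lemma integrable_Ioc:
  assumes "integrable (lebesgue_on {0..T::real}) (f :: real \<Rightarrow> real)"
  shows "integrable (lebesgue_on {0..T}) (\<lambda>s. indicat_real {a<..b} s * f s)"
proof -
  have "{a<..b} \<inter> {0..T} \<in> sets (lebesgue_on {0..T})"
    by (auto simp: sets_restrict_space)
  from integrable_mult_indicator[OF this assms]
  have "integrable (lebesgue_on {0..T}) (\<lambda>s. indicat_real ({a<..b} \<inter> {0..T}) s *\<^sub>R f s)" .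
  moreover have "(integrable (lebesgue_on {0..T}) (\<lambda>s. indicat_real ({a<..b} \<inter> {0..T}) s *\<^sub>R f s))
     = integrable (lebesgue_on {0..T}) (\<lambda>s. indicat_real {a<..b} s * f s)"
    by (intro Bochner_Integration.integrable_cong) (auto simp: indicator_def)
  ultimately show ?thesis by simp
qed

lemma integral_Ioc_add:
  assumes "integrable (lebesgue_on {0..T::real}) (f :: real \<Rightarrow> real)" "a \<le> b" "b \<le> c"
  shows "(LINT s|lebesgue_on {0..T}. indicat_real {a<..c} s * f s) =
    (LINT s|lebesgue_on {0..T}. indicat_real {a<..b} s * f s) + (LINT s|lebesgue_on {0..T}. indicat_real {b<..c} s * f s)"
proof -
  have "(LINT s|lebesgue_on {0..T}. indicat_real {a<..c} s * f s) =
    (LINT s|lebesgue_on {0..T}. indicat_real {a<..b} s * f s + indicat_real {b<..c} s * f s)"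
    using assms(2,3) by (intro Bochner_Integration.integral_cong) (auto simp: indicator_def)
  then show ?thesis using integrable_Ioc[OF assms(1)] by simp
qed

lemma continuous_on_integral_Ioc:
  assumes f: "integrable (lebesgue_on {0..T::real}) (f :: real \<Rightarrow> real)"
  shows "continuous_on {0..T} (\<lambda>t. LINT s|lebesgue_on {0..T}. indicat_real {0<..t} s * f s)"
proof -
  have f': "f integrable_on {0..T}"
    using f by (simp add: integrable_on_lebesgue_on)
  have "continuous_on {0..T} (\<lambda>t. integral {0..t} f)"
    by (rule indefinite_integral_continuous_1[OF f'])
  moreover have "(LINT s|lebesgue_on {0..T}. indicat_real {0<..t} s * f s) = integral {0..t} f" if "t \<in> {0..T}" for t
  proof -
    have "(LINT s|lebesgue_on {0..T}. indicat_real {0<..t} s * f s) = integral {0..T} (\<lambda>s. indicat_real {0<..t} s * f s)"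
      by (rule lebesgue_integral_eq_integral[OF integrable_Ioc[OF f]]) simp
    also have "\<dots> = integral {0..T} (\<lambda>s. if s \<in> {0..t} then f s else 0)"
      by (rule integral_spike[of "{0}"]) (auto simp: indicator_def)
    also have "\<dots> = integral ({0..T} \<inter> {0..t}) f"
      using Henstock_Kurzweil_Integration.integral_restrict_Int[of "{0..T}" "{0..t}" f] by (simp only: Int_commute)
    also have "{0..T} \<inter> {0..t} = {0..t}" using that by auto
    finally show ?thesis .
  qed
  ultimately show ?thesis by (subst continuous_on_cong[OF refl]) auto
qed

text \<open>Half-open intervals add up without overlap, and each positive time lies in exactly one
  cell of a uniform grid of \<open>{0..T}\<close>, so a piecewise constant iterate can be integrated
  cell by cell.\<close>

abbreviation intv :: "real \<Rightarrow> real \<Rightarrow> real \<Rightarrow> (real \<Rightarrow> real) \<Rightarrow> real" where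
  "intv T a b f \<equiv> (LINT s|lebesgue_on {0..T}. indicat_real {a<..b} s * f s)"

lemma intv_le:
  assumes "integrable (lebesgue_on {0..T}) f" "integrable (lebesgue_on {0..T}) g"
    and "\<And>s. s \<in> {0..T} \<Longrightarrow> f s \<le> g s"
  shows "intv T a b f \<le> intv T a b g"
  using assms by (intro integral_mono integrable_Ioc) (auto simp: indicator_def)

lemma intv_abs_le:
  assumes f: "integrable (lebesgue_on {0..T}) f" and g: "integrable (lebesgue_on {0..T}) g"
    and le: "\<And>s. s \<in> {0..T} \<Longrightarrow> \<bar>f s\<bar> \<le> g s"
  shows "\<bar>intv T a b f\<bar> \<le> intv T a b g"
proof -
  have "intv T a b f \<le> intv T a b g"
    using le by (intro intv_le f g) (auto simp: abs_le_iff)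
  moreover have "intv T a b (\<lambda>s. - f s) \<le> intv T a b g"
    using le f by (intro intv_le g) (auto simp: abs_le_iff)
  ultimately show ?thesis by (simp add: abs_le_iff)
qed

lemma intv_mult_left: "intv T a b (\<lambda>s. c * f s) = c * intv T a b f"
proof -
  have "intv T a b (\<lambda>s. c * f s) = (LINT s|lebesgue_on {0..T}. c * (indicat_real {a<..b} s * f s))"
    by (intro Bochner_Integration.integral_cong) auto
  then show ?thesis by simp
qed

lemma intv_sum:
  assumes "\<And>i. i \<in> I \<Longrightarrow> integrable (lebesgue_on {0..T}) (f i)"
  shows "intv T a b (\<lambda>s. \<Sum>i\<in>I. f i s) = (\<Sum>i\<in>I. intv T a b (f i))"
  using assms by (simp add: sum_distrib_left integrable_Ioc)

lemma intv_diff: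
  assumes "integrable (lebesgue_on {0..T}) f" "integrable (lebesgue_on {0..T}) g"
  shows "intv T a b (\<lambda>s. f s - g s) = intv T a b f - intv T a b g"
  using assms by (simp add: right_diff_distrib integrable_Ioc)

lemma intv_add:
  assumes "integrable (lebesgue_on {0..T}) f" "integrable (lebesgue_on {0..T}) g"
  shows "intv T a b (\<lambda>s. f s + g s) = intv T a b f + intv T a b g"
  using assms by (simp add: distrib_left integrable_Ioc)

lemma intv_cong:
  assumes "\<And>s. s \<in> {0..T} \<Longrightarrow> s \<in> {a<..b} \<Longrightarrow> f s = g s"
  shows "intv T a b f = intv T a b g"
  using assms by (intro Bochner_Integration.integral_cong) (auto simp: indicator_def)

lemma intv_full:
  assumes "integrable (lebesgue_on {0..T}) f"
  shows "intv T 0 T f = (LINT s|lebesgue_on {0..T}. f s)"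
proof (rule integral_cong_AE)
  show "(\<lambda>s. indicat_real {0<..T} s * f s) \<in> borel_measurable (lebesgue_on {0..T})"
    using integrable_Ioc[OF assms] by blast
  show "f \<in> borel_measurable (lebesgue_on {0..T})" using assms by blast
  have "AE s in lebesgue. s \<noteq> (0::real)"
    by (metis (mono_tags) AE_completion AE_lborel_singleton)
  then have "AE s in lebesgue_on {0..T}. s \<noteq> 0"
    by (subst AE_restrict_space_iff) auto
  then show "AE s in lebesgue_on {0..T}. indicat_real {0<..T} s * f s = f s"
    by (rule AE_mp) (auto intro!: AE_I2 simp: indicator_def)
qed

lemma integrable_const_on [simp]: "integrable (lebesgue_on {0..T::real}) (\<lambda>_. c::real)"
  by (intro finite_measure.integrable_const finite_measure_lebesgue_on) auto

lemma integrable_bounded_mult: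
  assumes f: "integrable M (f :: 'a \<Rightarrow> real)" and g: "g \<in> borel_measurable M"
    and b: "\<And>s. s \<in> space M \<Longrightarrow> \<bar>g s\<bar> \<le> (C::real)"
  shows "integrable M (\<lambda>s. f s * g s)"
proof (rule Bochner_Integration.integrable_bound)
  show "integrable M (\<lambda>s. C * f s)" using f by simp
  show "(\<lambda>s. f s * g s) \<in> borel_measurable M" using f g by simp
  show "AE s in M. norm (f s * g s) \<le> norm (C * f s)"
  proof (rule AE_I2)
    fix s assume "s \<in> space M"
    from b[OF this] have "\<bar>g s\<bar> \<le> \<bar>C\<bar>" by linarith
    then have "\<bar>f s\<bar> * \<bar>g s\<bar> \<le> \<bar>f s\<bar> * \<bar>C\<bar>" by (rule mult_left_mono) simp
    then show "norm (f s * g s) \<le> norm (C * f s)" by (simp add: abs_mult mult.commute)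
  qed
qed

text \<open>
  For an orthonormal basis \<open>e\<^sub>j\<close> of smooth functions, \<open>B j l\<close> stands for the pairing of \<open>e\<^sub>l\<close> with
  \<open>b \<cdot> \<nabla>e\<^sub>j\<close>, \<open>lam j\<close> for the eigenvalue of \<open>-\<Delta>\<close>, \<open>beta\<close> for the \<open>L\<^sup>2\<close> norm of \<open>b\<close> and
  \<open>kap j\<close> for the supremum of \<open>\<nabla>e\<^sub>j\<close>; antisymmetry is only required after integration in time.
\<close>

locale galerkin =
  fixes T :: real and B :: "nat \<Rightarrow> nat \<Rightarrow> real \<Rightarrow> real" and lam kap :: "nat \<Rightarrow> real"
    and beta :: "real \<Rightarrow> real" and a0 :: "nat \<Rightarrow> real" and S :: real
  assumes T: "T > 0"
    and B_int: "\<And>j l. integrable (lebesgue_on {0..T}) (B j l)"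
    and anti: "\<And>j l s t. 0 \<le> s \<Longrightarrow> s \<le> t \<Longrightarrow> t \<le> T \<Longrightarrow> intv T s t (B j l) = - intv T s t (B l j)"
    and bessel: "\<And>j s n. s \<in> {0..T} \<Longrightarrow> (\<Sum>l<n. (B j l s)\<^sup>2) \<le> (kap j * beta s)\<^sup>2"
    and kap: "\<And>j. kap j \<ge> 0"
    and beta: "\<And>s. beta s \<ge> 0" "integrable (lebesgue_on {0..T}) beta"
    and lam: "\<And>j. lam j \<ge> 0"
    and a0: "\<And>n. (\<Sum>j<n. (a0 j)\<^sup>2) \<le> S"
begin

text \<open>Matrix of the whole system: c_j' is the sum over l of \<open>coupling j l\<close> times
  c_l. Diffusion enters only the diagonal because the basis functions are eigenfunctions of the
  Laplacian.\<close>

definition coupling :: "nat \<Rightarrow> nat \<Rightarrow> real \<Rightarrow> real" where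
  "coupling j l s = B j l s - (if l = j then lam j else 0)"

text \<open>Up to a factor depending on the row, the increment of \<open>clock\<close> bounds the
  integral of every matrix entry. It is continuous although \<open>beta\<close> may be unbounded.
  The summand 1 covers the diffusion and gives \<open>clock T \<ge> T\<close>, so that one can
  divide by \<open>clock T\<close>.\<close>

definition clock :: "real \<Rightarrow> real" where
  "clock t = intv T 0 t (\<lambda>s. 1 + beta s)"

lemma beta_plus_1_integrable: "integrable (lebesgue_on {0..T}) (\<lambda>s. 1 + beta s)"
  using beta by simp

lemma coupling_integrable: "integrable (lebesgue_on {0..T}) (coupling j l)"
  unfolding coupling_def using B_int by simp

lemma S_nonneg: "S \<ge> 0"
  using a0[of 0] by simp

lemma clock_diff: "0 \<le> a \<Longrightarrow> a \<le> b \<Longrightarrow> clock b - clock a = intv T a b (\<lambda>s. 1 + beta s)"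
  unfolding clock_def by (subst integral_Ioc_add[OF beta_plus_1_integrable, of 0 a b]) auto

lemma clock_mono: "0 \<le> a \<Longrightarrow> a \<le> b \<Longrightarrow> clock a \<le> clock b"
proof -
  assume "0 \<le> a" "a \<le> b"
  moreover have "0 \<le> intv T a b (\<lambda>s. 1 + beta s)"
    using beta by (intro Bochner_Integration.integral_nonneg) (auto intro!: mult_nonneg_nonneg add_nonneg_nonneg)
  ultimately show ?thesis using clock_diff[of a b] by simp
qed

lemma clock_T: "clock T \<ge> T"
proof -
  have "intv T 0 T (\<lambda>s. 1) \<le> clock T"
    unfolding clock_def using beta by (intro intv_le beta_plus_1_integrable) auto
  then show ?thesis using integral_Ioc_const[of 0 T T 1] T by simp
qed

lemma clock_cont: "continuous_on {0..T} clock"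
  unfolding clock_def[abs_def] by (rule continuous_on_integral_Ioc[OF beta_plus_1_integrable])

lemma B_bound: "s \<in> {0..T} \<Longrightarrow> \<bar>B j l s\<bar> \<le> kap j * beta s"
proof -
  assume s: "s \<in> {0..T}"
  have "(B j l s)\<^sup>2 \<le> (\<Sum>l<Suc l. (B j l s)\<^sup>2)"
    by (rule member_le_sum) auto
  also have "\<dots> \<le> (kap j * beta s)\<^sup>2" by (rule bessel[OF s])
  finally show ?thesis using kap beta by (metis abs_le_square_iff abs_of_nonneg mult_nonneg_nonneg)
qed

lemma coupling_bound: "s \<in> {0..T} \<Longrightarrow> \<bar>coupling j l s\<bar> \<le> (kap j + lam j) * (1 + beta s)"
proof -
  assume s: "s \<in> {0..T}"
  have "\<bar>coupling j l s\<bar> \<le> \<bar>B j l s\<bar> + lam j" unfolding coupling_def using lam[of j] by auto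
  also have "\<dots> \<le> kap j * beta s + lam j" using B_bound[OF s] by simp
  also have "\<dots> \<le> (kap j + lam j) * (1 + beta s)"
    using kap[of j] lam[of j] beta(1)[of s] by (simp add: algebra_simps)
  finally show ?thesis .
qed

text \<open>
  The explicit step produces an error quadratic in the increment of \<open>clock\<close>; with a fine
  partition it is linear with a small constant, so that the energy grows at most by \<open>exp 1\<close>.
\<close>

lemma euler:
  assumes eps: "\<epsilon> > 0"
  shows "\<exists>v. (\<forall>j. v j \<in> borel_measurable (lebesgue_on {0..T})) \<and>
    (\<forall>t\<in>{0..T}. (\<Sum>j<N. (v j t)\<^sup>2) \<le> 3 * S) \<and>
    (LINT t|lebesgue_on {0..T}. (\<Sum>j<N. lam j * (v j t)\<^sup>2)) \<le> 3 * S \<and>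
    (\<forall>j<N. \<forall>t\<in>{0..T}. \<bar>v j t - (a0 j + intv T 0 t (\<lambda>s. \<Sum>l<N. coupling j l s * v l s))\<bar> \<le> \<epsilon>)"
proof -
  \<comment> \<open>One bound for all rows below N; the added 1 keeps it positive for N = 0.\<close>
  define K where "K = (\<Sum>j<N. kap j + lam j) + 1"
  have K1: "K > 0" unfolding K_def using kap lam by (auto intro!: add_nonneg_pos sum_nonneg)
  have K: "\<bar>coupling j l s\<bar> \<le> K * (1 + beta s)" if "j < N" "s \<in> {0..T}" for j l s
  proof -
    have "kap j + lam j \<le> (\<Sum>j<N. kap j + lam j)"
      using that kap lam by (intro member_le_sum) auto
    then have "kap j + lam j \<le> K" unfolding K_def by simp
    then have "(kap j + lam j) * (1 + beta s) \<le> K * (1 + beta s)"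
      using beta(1)[of s] by (intro mult_right_mono) auto
    then show ?thesis using coupling_bound[OF that(2), of j l] by linarith
  qed
  define R where "R = sqrt (3 * S)"
  have R0: "R \<ge> 0" unfolding R_def using S_nonneg by simp
  have GT: "clock T > 0" using clock_T T by simp
  \<comment> \<open>The first bound turns the relative quadratic error
    \<open>K\<^sup>2 * N\<^sup>2 * \<omega>\<^sup>2\<close> of one step into at most
    \<open>\<omega> / clock T\<close>, and these add up to at most 1 over the whole interval. The
    second keeps the change of the exact integral within one cell, at most \<open>K * N * R\<close>
    times the clock increment, below \<epsilon>. The added ones avoid division by zero.\<close>
  define \<delta> where "\<delta> = min (1 / (K\<^sup>2 * real N ^ 2 * clock T + 1)) (\<epsilon> / (K * real N * R + 1))"
  have den: "K\<^sup>2 * real N ^ 2 * clock T + 1 > 0" "K * real N * R + 1 > 0"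
    using K1 R0 GT by (auto intro!: add_nonneg_pos mult_nonneg_nonneg)
  have d0: "\<delta> > 0" unfolding \<delta>_def using eps den by auto
  have "uniformly_continuous_on {0..T} clock"
    by (rule compact_uniformly_continuous[OF clock_cont]) simp
  then obtain d where d: "d > 0" "\<And>s t. s \<in> {0..T} \<Longrightarrow> t \<in> {0..T} \<Longrightarrow> dist t s < d \<Longrightarrow> dist (clock t) (clock s) < \<delta>"
    using d0 unfolding uniformly_continuous_on_def by blast
  obtain m :: nat where m: "m > 0" "T / m < d"
  proof -
    obtain m :: nat where "T / d < m" using reals_Archimedean2 by blast
    moreover from this have "m > 0" using T d(1) by (metis divide_pos_pos gr0I less_asym of_nat_0)
    ultimately show ?thesis using d(1) that[of m] by (simp add: field_simps)
  qed
  define h where "h = T / m"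
  have h: "h > 0" "h < d" "h * m = T" using m T unfolding h_def by auto
  \<comment> \<open>Exact cell integrals instead of point values: they make sense for merely
    integrable entries, and assumption \<open>anti\<close> applies to them.\<close>
  define M where "M i j l = intv T (i * h) (Suc i * h) (coupling j l)" for i :: nat and j l
  define a where "a = rec_nat (\<lambda>j. if j < N then a0 j else 0)
     (\<lambda>i x j. if j < N then x j + (\<Sum>l<N. M i j l * x l) else 0)"
  have a_0: "a 0 j = (if j < N then a0 j else 0)" for j by (simp add: a_def)
  have a_Suc: "a (Suc i) j = (if j < N then a i j + (\<Sum>l<N. M i j l * a i l) else 0)" for i j
    by (simp add: a_def)
  \<comment> \<open>Index of the half-open cell that contains \<open>s\<close>. At
    \<open>s = 0\<close> the integer is -1, which \<open>nat\<close> sends to 0, so time zero is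
    counted in the first cell.\<close>
  define st where "st s = nat (\<lceil>s / h\<rceil> - 1)" for s :: real
  define v where "v j s = a (st s) j" for j s
  have st: "st s = i" if "s \<in> {real i * h<..real (Suc i) * h}" for s i
  proof -
    have "\<lceil>s / h\<rceil> = int (Suc i)"
      using that h by (intro ceiling_unique) (auto simp: field_simps)
    then show ?thesis unfolding st_def by simp
  qed
  have st_bounds: "real (st s) * h \<le> s" "s \<le> real (Suc (st s)) * h" "st s < m" if "s \<in> {0..T}" for s
  proof -
    have c: "s / h \<le> \<lceil>s / h\<rceil>" "\<lceil>s / h\<rceil> < s / h + 1" by linarith+
    have "s \<ge> 0" using that by simp
    have s1: "real (st s) * h \<le> s \<and> s \<le> real (Suc (st s)) * h"
    proof (cases "s = 0")
      case True
      then show ?thesis using h by (simp add: st_def)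
    next
      case False
      then have "s / h > 0" using \<open>s \<ge> 0\<close> h by simp
      then have "\<lceil>s / h\<rceil> \<ge> 1" by (simp add: le_ceiling_iff)
      then have "real (st s) = \<lceil>s / h\<rceil> - 1" unfolding st_def by simp
      then have "real (st s) \<le> s / h" "s / h \<le> real (Suc (st s))" using c by auto
      then show ?thesis using h by (auto simp: field_simps)
    qed
    then show "real (st s) * h \<le> s" "s \<le> real (Suc (st s)) * h" by auto
    have "s / h \<le> m" using that h by (auto simp: field_simps)
    then have "\<lceil>s / h\<rceil> \<le> int m" by (simp add: ceiling_le_iff)
    then show "st s < m" unfolding st_def using m by linarith
  qed
  have grid: "real i * h \<in> {0..T}" if "i \<le> m" for i
    using that h by (metis atLeastAtMost_iff le_less mult.commute mult_left_mono mult_nonneg_nonneg of_nat_0_le_iff of_nat_le_iff)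
  have v_meas [measurable]: "v j \<in> borel_measurable (lebesgue_on {0..T})" for j
  proof -
    have 1: "(\<lambda>s::real. nat (\<lceil>s / h\<rceil> - 1)) \<in> borel \<rightarrow>\<^sub>M count_space UNIV" by measurable
    have 2: "(\<lambda>i. a i j) \<in> count_space UNIV \<rightarrow>\<^sub>M borel" by simp
    have "v j \<in> borel_measurable borel"
      using measurable_compose[OF 1 2] unfolding v_def[abs_def] st_def[abs_def] .
    then have "v j \<in> borel_measurable lborel" by simp
    then have "v j \<in> borel_measurable lebesgue" by (rule measurable_completion)
    then show ?thesis by (rule measurable_restrict_space1)
  qed
  have v_bd: "\<bar>v j s\<bar> \<le> (\<Sum>i<m. \<bar>a i j\<bar>)" if "s \<in> {0..T}" for j s
    unfolding v_def using st_bounds(3)[OF that] by (intro member_le_sum) auto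
  have Av_int: "integrable (lebesgue_on {0..T}) (\<lambda>s. coupling j l s * v l s)" for j l
    using v_bd by (intro integrable_bounded_mult[OF coupling_integrable v_meas]) auto
  have vv_int: "integrable (lebesgue_on {0..T}) (\<lambda>s. lam j * (v j s)\<^sup>2)" for j
  proof -
    have "integrable (lebesgue_on {0..T}) (\<lambda>s. lam j * (v j s)\<^sup>2)"
    proof (rule integrable_bounded_mult[where C="(\<Sum>i<m. \<bar>a i j\<bar>)\<^sup>2"])
      show "\<bar>(v j s)\<^sup>2\<bar> \<le> (\<Sum>i<m. \<bar>a i j\<bar>)\<^sup>2" if "s \<in> space (lebesgue_on {0..T})" for s
        using v_bd[of s j] that by (simp add: abs_le_square_iff[symmetric])
    qed auto
    then show ?thesis .
  qed
  define E where "E i = (\<Sum>j<N. (a i j)\<^sup>2)" for i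
  define D where "D i = (\<Sum>j<N. lam j * (a i j)\<^sup>2)" for i
  define Dv where "Dv s = (\<Sum>j<N. lam j * (v j s)\<^sup>2)" for s
  have Dv_int: "integrable (lebesgue_on {0..T}) Dv" unfolding Dv_def[abs_def] using vv_int by simp
  have D0: "D i \<ge> 0" for i unfolding D_def using lam by (auto intro!: sum_nonneg)
  have E0: "E i \<ge> 0" for i unfolding E_def by (auto intro!: sum_nonneg)
  define \<omega> where "\<omega> i = clock (real (Suc i) * h) - clock (real i * h)" for i
  have om0: "\<omega> i \<ge> 0" for i unfolding \<omega>_def using clock_mono[of "real i * h" "real (Suc i) * h"] h
    by (auto simp: mult_right_mono)
  have om_d: "\<omega> i < \<delta>" if "i < m" for i
  proof -
    have "dist (real (Suc i) * h) (real i * h) < d" using h by (simp add: dist_real_def algebra_simps)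
    from d(2)[OF grid grid this] that have "dist (clock (real (Suc i) * h)) (clock (real i * h)) < \<delta>" by auto
    then show ?thesis unfolding \<omega>_def dist_real_def by linarith
  qed
  have om_eq: "\<omega> i = intv T (real i * h) (real (Suc i) * h) (\<lambda>s. 1 + beta s)" for i
    unfolding \<omega>_def using h by (intro clock_diff) (auto simp: mult_right_mono)
  have M_le: "\<bar>M i j l\<bar> \<le> K * \<omega> i" if "j < N" for i j l
  proof -
    have "\<bar>M i j l\<bar> \<le> intv T (real i * h) (real (Suc i) * h) (\<lambda>s. K * (1 + beta s))"
      unfolding M_def using K that beta_plus_1_integrable by (intro intv_abs_le coupling_integrable) auto
    then show ?thesis unfolding om_eq intv_mult_left by simp
  qed
  \<comment> \<open>Expand the square of a + M a: in the cross term transport vanishes by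
    antisymmetry and diffusion leaves \<open>- 2 * h * D i\<close>; the square of M a is estimated
    by Cauchy-Schwarz in each row.\<close>
  have energy: "E (Suc i) + 2 * h * D i \<le> E i * (1 + \<omega> i / clock T)" if i: "i < m" for i
  proof -
    define MB where "MB j l = intv T (real i * h) (real (Suc i) * h) (B j l)" for j l
    have ih: "0 \<le> real i * h" "real i * h \<le> real (Suc i) * h" "real (Suc i) * h \<le> T"
      using grid[of i] grid[of "Suc i"] i h by (auto simp: mult_right_mono)
    have M_MB: "M i j l = MB j l - (if l = j then lam j * h else 0)" for j l
      unfolding M_def MB_def coupling_def using integral_Ioc_const[OF ih, of "lam j"]
      by (subst intv_diff[OF B_int]) (auto simp: algebra_simps)
    define X where "X = (\<Sum>j<N. \<Sum>l<N. a i j * (MB j l * a i l))"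
    have "X = (\<Sum>j<N. \<Sum>l<N. - (a i l * (MB l j * a i j)))"
      unfolding X_def MB_def by (subst anti[OF ih]) (simp add: algebra_simps)
    also have "\<dots> = - X" unfolding X_def by (simp add: sum_negf) (rule sum.swap)
    finally have X0: "X = 0" by simp
    have cross: "(\<Sum>j<N. a i j * (\<Sum>l<N. M i j l * a i l)) = - h * D i"
    proof -
      have "(\<Sum>j<N. a i j * (\<Sum>l<N. M i j l * a i l)) = (\<Sum>j<N. (\<Sum>l<N. a i j * (MB j l * a i l)) - lam j * h * (a i j)\<^sup>2)"
      proof (rule sum.cong)
        fix j assume "j \<in> {..<N}"
        then have "(\<Sum>l<N. M i j l * a i l) = (\<Sum>l<N. MB j l * a i l) - lam j * h * a i j"
          unfolding M_MB by (simp add: left_diff_distrib sum_subtractf if_distrib[of "\<lambda>x. x * _"] sum.delta cong: if_cong)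
        then show "a i j * (\<Sum>l<N. M i j l * a i l) = (\<Sum>l<N. a i j * (MB j l * a i l)) - lam j * h * (a i j)\<^sup>2"
          by (simp add: right_diff_distrib sum_distrib_left power2_eq_square)
      qed simp
      also have "\<dots> = X - h * D i" unfolding X_def D_def by (simp add: sum_subtractf sum_distrib_left algebra_simps)
      finally show ?thesis using X0 by simp
    qed
    have quad: "(\<Sum>j<N. (\<Sum>l<N. M i j l * a i l)\<^sup>2) \<le> E i * (\<omega> i / clock T)"
    proof -
      have "(\<Sum>l<N. M i j l * a i l)\<^sup>2 \<le> (real N * (K * \<omega> i)\<^sup>2) * E i" if "j < N" for j
      proof -
        have "(\<Sum>l<N. M i j l * a i l)\<^sup>2 \<le> (\<Sum>l<N. (M i j l)\<^sup>2) * E i"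
          unfolding E_def by (rule Cauchy_Schwarz_ineq_sum)
        also have "(\<Sum>l<N. (M i j l)\<^sup>2) \<le> (\<Sum>l<N. (K * \<omega> i)\<^sup>2)"
          using M_le[OF that] by (intro sum_mono) (metis abs_ge_zero abs_le_square_iff abs_of_nonneg order_trans)
        finally show ?thesis using E0 by (simp add: mult_right_mono)
      qed
      then have "(\<Sum>j<N. (\<Sum>l<N. M i j l * a i l)\<^sup>2) \<le> (\<Sum>j<N. (real N * (K * \<omega> i)\<^sup>2) * E i)"
        by (intro sum_mono) auto
      also have "\<dots> = (K\<^sup>2 * real N ^ 2 * \<omega> i) * (\<omega> i * E i)" by (simp add: power2_eq_square algebra_simps)
      also have "\<dots> \<le> (1 / clock T) * (\<omega> i * E i)"
      proof (intro mult_right_mono)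
        have "\<omega> i \<le> 1 / (K\<^sup>2 * real N ^ 2 * clock T + 1)" using om_d[OF i] unfolding \<delta>_def by simp
        then have "\<omega> i * (K\<^sup>2 * real N ^ 2 * clock T + 1) \<le> 1" using den by (simp add: field_simps)
        then have "K\<^sup>2 * real N ^ 2 * \<omega> i * clock T \<le> 1" using om0[of i] by (simp add: algebra_simps)
        then show "K\<^sup>2 * real N ^ 2 * \<omega> i \<le> 1 / clock T" using GT by (simp add: field_simps)
        show "0 \<le> \<omega> i * E i" using om0 E0 by simp
      qed
      finally show ?thesis by (simp add: algebra_simps)
    qed
    have "E (Suc i) = (\<Sum>j<N. (a i j + (\<Sum>l<N. M i j l * a i l))\<^sup>2)"
      unfolding E_def a_Suc by (rule sum.cong) auto
    also have "\<dots> = E i + 2 * (\<Sum>j<N. a i j * (\<Sum>l<N. M i j l * a i l)) + (\<Sum>j<N. (\<Sum>l<N. M i j l * a i l)\<^sup>2)"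
      unfolding E_def power2_sum sum.distrib by (simp add: sum_distrib_left mult.assoc)
    finally show ?thesis using cross quad by (simp add: algebra_simps)
  qed
  \<comment> \<open>Energy at a node plus the dissipation accumulated up to it. The estimate that
    follows is a discrete Gronwall inequality: by \<open>1 + x \<le> exp x\<close> the growth
    factors multiply to an exponential in which the clock increments telescope.\<close>
  define \<Phi> where "\<Phi> i = E i + intv T 0 (real i * h) Dv" for i :: nat
  have Dv0: "intv T 0 t Dv \<ge> 0" for t unfolding Dv_def
    using lam by (intro Bochner_Integration.integral_nonneg) (auto intro!: sum_nonneg mult_nonneg_nonneg)
  have Phi: "\<Phi> i \<le> S * exp (clock (real i * h) / clock T)" if "i \<le> m" for i
    using that
  proof (induction i)
    case 0
    have "E 0 = (\<Sum>j<N. (a0 j)\<^sup>2)" unfolding E_def a_0 by (rule sum.cong) auto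
    then show ?case unfolding \<Phi>_def clock_def using a0[of N] by simp
  next
    case (Suc i)
    then have i: "i < m" by simp
    have ih: "0 \<le> real i * h" "real i * h \<le> real (Suc i) * h" "real (Suc i) * h \<le> T"
      using grid[of i] grid[of "Suc i"] i h by (auto simp: mult_right_mono)
    have "intv T (real i * h) (real (Suc i) * h) Dv = intv T (real i * h) (real (Suc i) * h) (\<lambda>_. D i)"
      by (rule intv_cong) (auto simp: Dv_def D_def v_def st)
    also have "\<dots> = h * D i" using integral_Ioc_const[OF ih] by (simp add: algebra_simps)
    finally have "\<Phi> (Suc i) = E (Suc i) + intv T 0 (real i * h) Dv + h * D i"
      unfolding \<Phi>_def using integral_Ioc_add[OF Dv_int ih(1,2)] by simp
    also have "\<dots> \<le> E i * (1 + \<omega> i / clock T) + intv T 0 (real i * h) Dv"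
      using energy[OF i] D0[of i] h mult_nonneg_nonneg[of h "D i"] by linarith
    also have "\<dots> \<le> \<Phi> i * (1 + \<omega> i / clock T)"
      unfolding \<Phi>_def using Dv0[of "real i * h"] om0[of i] GT by (simp add: algebra_simps)
    also have "\<dots> \<le> (S * exp (clock (real i * h) / clock T)) * exp (\<omega> i / clock T)"
      using Suc om0[of i] GT S_nonneg
      by (intro mult_mono) (auto intro!: exp_ge_add_one_self)
    also have "\<dots> = S * exp (clock (real (Suc i) * h) / clock T)"
      unfolding \<omega>_def by (simp add: exp_add[symmetric] mult.assoc diff_divide_distrib)
    finally show ?case .
  qed
  \<comment> \<open>The exponent is at most 1, so the factor 3 in all later bounds is an upper bound
    for \<open>exp 1\<close>.\<close>
  have Phi3: "\<Phi> i \<le> 3 * S" if "i \<le> m" for i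
  proof -
    have "clock (real i * h) \<le> clock T" using grid[OF that] by (intro clock_mono) auto
    then have "exp (clock (real i * h) / clock T) \<le> exp 1" using GT by (simp add: divide_le_eq)
    also have "\<dots> \<le> 3" using exp_le by simp
    finally have "S * exp (clock (real i * h) / clock T) \<le> S * 3" using S_nonneg by (rule mult_left_mono)
    then show ?thesis using Phi[OF that] by linarith
  qed
  have vS: "(\<Sum>j<N. (v j t)\<^sup>2) \<le> 3 * S" if "t \<in> {0..T}" for t
    using Phi3[of "st t"] st_bounds(3)[OF that] Dv0[of "real (st t) * h"] unfolding \<Phi>_def E_def v_def by simp
  have vR: "\<bar>v l t\<bar> \<le> R" if "t \<in> {0..T}" "l < N" for l t
  proof -
    have "(v l t)\<^sup>2 \<le> (\<Sum>j<N. (v j t)\<^sup>2)" using that by (intro member_le_sum) auto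
    then have "(v l t)\<^sup>2 \<le> 3 * S" using vS[OF that(1)] by simp
    then show ?thesis unfolding R_def using real_le_rsqrt[of "\<bar>v l t\<bar>"] by simp
  qed
  have vD: "(LINT t|lebesgue_on {0..T}. (\<Sum>j<N. lam j * (v j t)\<^sup>2)) \<le> 3 * S"
    using Phi3[of m] E0[of m] intv_full[OF Dv_int] h unfolding \<Phi>_def Dv_def by (simp add: mult.commute)
  define F where "F j s = (\<Sum>l<N. coupling j l s * v l s)" for j s
  have F_int: "integrable (lebesgue_on {0..T}) (F j)" for j unfolding F_def[abs_def] using Av_int by simp
  \<comment> \<open>At the nodes the iterate satisfies the integral equation exactly, because on
    each cell the unknown is frozen and the coefficients are integrated without error. Only the cell
    in progress contributes to the final error.\<close>
  have consist: "a i j = a0 j + intv T 0 (real i * h) (F j)" if "i \<le> m" "j < N" for i j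
    using that(1)
  proof (induction i)
    case 0
    then show ?case using that a_0 by simp
  next
    case (Suc i)
    have ih: "0 \<le> real i * h" "real i * h \<le> real (Suc i) * h" using h by (auto simp: mult_right_mono)
    have "intv T (real i * h) (real (Suc i) * h) (F j) = intv T (real i * h) (real (Suc i) * h) (\<lambda>s. \<Sum>l<N. a i l * coupling j l s)"
      by (rule intv_cong) (auto simp: F_def v_def st mult.commute)
    also have "\<dots> = (\<Sum>l<N. intv T (real i * h) (real (Suc i) * h) (\<lambda>s. a i l * coupling j l s))"
      using coupling_integrable by (intro intv_sum) auto
    also have "\<dots> = (\<Sum>l<N. M i j l * a i l)" unfolding intv_mult_left M_def by (simp add: mult.commute)
    finally have "intv T 0 (real (Suc i) * h) (F j) = intv T 0 (real i * h) (F j) + (\<Sum>l<N. M i j l * a i l)"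
      using integral_Ioc_add[OF F_int ih] by simp
    then show ?case using Suc that unfolding a_Suc by simp
  qed
  have "\<bar>v j t - (a0 j + intv T 0 t (F j))\<bar> \<le> \<epsilon>" if "j < N" "t \<in> {0..T}" for j t
  proof -
    let ?i = "st t"
    note sb = st_bounds[OF that(2)]
    have "v j t - (a0 j + intv T 0 t (F j)) = - intv T (real ?i * h) t (F j)"
      using consist[of ?i j] sb that integral_Ioc_add[OF F_int _ sb(1), of 0 j] h unfolding v_def by simp
    moreover have "\<bar>intv T (real ?i * h) t (F j)\<bar> \<le> intv T (real ?i * h) t (\<lambda>s. (K * real N * R) * (1 + beta s))"
    proof (rule intv_abs_le[OF F_int])
      show "integrable (lebesgue_on {0..T}) (\<lambda>s. K * real N * R * (1 + beta s))" using beta_plus_1_integrable by simp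
      fix s assume s: "s \<in> {0..T}"
      have "\<bar>F j s\<bar> \<le> (\<Sum>l<N. \<bar>coupling j l s\<bar> * \<bar>v l s\<bar>)" unfolding F_def by (rule order_trans[OF sum_abs]) (simp add: abs_mult)
      also have "\<dots> \<le> (\<Sum>l<N. (K * (1 + beta s)) * R)"
        using K[OF that(1) s] vR[OF s] R0 K1 beta(1)[of s] by (intro sum_mono mult_mono) auto
      finally show "\<bar>F j s\<bar> \<le> K * real N * R * (1 + beta s)" by (simp add: mult_ac)
    qed
    moreover have "intv T (real ?i * h) t (\<lambda>s. (K * real N * R) * (1 + beta s)) = (K * real N * R) * (clock t - clock (real ?i * h))"
      unfolding intv_mult_left using sb h by (subst clock_diff) auto
    moreover have "(K * real N * R) * (clock t - clock (real ?i * h)) \<le> \<epsilon>"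
    proof -
      have gi: "real ?i * h \<in> {0..T}" using grid[of ?i] sb by simp
      have "dist t (real ?i * h) < d" using sb h by (simp add: dist_real_def algebra_simps)
      then have "dist (clock t) (clock (real ?i * h)) < \<delta>" using d(2)[OF gi that(2)] by simp
      then have "clock t - clock (real ?i * h) \<le> \<epsilon> / (K * real N * R + 1)" unfolding \<delta>_def dist_real_def by linarith
      then have "(K * real N * R) * (clock t - clock (real ?i * h)) \<le> (K * real N * R) * (\<epsilon> / (K * real N * R + 1))"
        using K1 R0 by (intro mult_left_mono) auto
      also have "\<dots> \<le> \<epsilon>" using den(2) eps by (simp add: field_simps)
      finally show ?thesis .
    qed
    ultimately show ?thesis by linarith
  qed
  then show ?thesis using v_meas vS vD unfolding F_def by (intro exI[of _ v]) auto
qed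

end

section \<open>Passage to the limit in the Galerkin approximation\<close>

text \<open>Cauchy-Schwarz on the coordinates beyond a fixed K, where the tail of \<open>y\<close>
  is small, leaves finitely many coordinates. The truncation \<open>m n\<close> lets each
  \<open>x n\<close> be a vector of its own finite dimension. This is weak convergence in L^2
  expressed on coefficients.\<close>

lemma ell2_weak_limit:
  fixes x :: "nat \<Rightarrow> nat \<Rightarrow> real" and y z :: "nat \<Rightarrow> real" and m :: "nat \<Rightarrow> nat"
  assumes xz: "\<And>l. (\<lambda>n. x n l) \<longlonglongrightarrow> z l"
    and C: "\<And>n. (\<Sum>l<m n. (x n l)\<^sup>2) \<le> C"
    and D: "\<And>n. (\<Sum>l<n. (y l)\<^sup>2) \<le> D"
    and m: "filterlim m at_top sequentially"
  shows "summable (\<lambda>l. y l * z l)" "(\<lambda>n. \<Sum>l<m n. y l * x n l) \<longlonglongrightarrow> (\<Sum>l. y l * z l)"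
proof -
  \<comment> \<open>As soon as \<open>m n \<ge> K\<close>, the first K squares are part of the
    bounded sum, so the bound survives the limit.\<close>
  have zC: "(\<Sum>l<K. (z l)\<^sup>2) \<le> C" for K
  proof (rule LIMSEQ_le_const2)
    show "(\<lambda>n. \<Sum>l<K. (x n l)\<^sup>2) \<longlonglongrightarrow> (\<Sum>l<K. (z l)\<^sup>2)"
      by (intro tendsto_intros xz)
    have "eventually (\<lambda>n. m n \<ge> K) sequentially"
      using m by (simp add: filterlim_at_top)
    then obtain N where N: "\<And>n. n \<ge> N \<Longrightarrow> m n \<ge> K" by (auto simp: eventually_sequentially)
    show "\<exists>N. \<forall>n\<ge>N. (\<Sum>l<K. (x n l)\<^sup>2) \<le> C"
    proof (intro exI allI impI)
      fix n assume "n \<ge> N"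
      then have "(\<Sum>l<K. (x n l)\<^sup>2) \<le> (\<Sum>l<m n. (x n l)\<^sup>2)"
        using N by (intro sum_mono2) auto
      then show "(\<Sum>l<K. (x n l)\<^sup>2) \<le> C" using C[of n] by linarith
    qed
  qed
  have C0: "C \<ge> 0" using zC[of 0] by simp
  have sy: "summable (\<lambda>l. (y l)\<^sup>2)" by (rule bounded_imp_summable[where B=D]) (use D[of "Suc _"] in \<open>simp_all add: lessThan_Suc_atMost\<close>)
  have sz: "summable (\<lambda>l. (z l)\<^sup>2)" by (rule bounded_imp_summable[where B=C]) (use zC[of "Suc _"] in \<open>simp_all add: lessThan_Suc_atMost\<close>)
  show syz: "summable (\<lambda>l. y l * z l)"
  proof (rule summable_comparison_test')
    show "summable (\<lambda>l. (y l)\<^sup>2 + (z l)\<^sup>2)" using sy sz by (rule summable_add)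
    fix l :: nat
    have "0 \<le> (\<bar>y l\<bar> - \<bar>z l\<bar>)\<^sup>2" by simp
    then have "2 * (\<bar>y l\<bar> * \<bar>z l\<bar>) \<le> (y l)\<^sup>2 + (z l)\<^sup>2" by (simp add: power2_diff)
    moreover have "0 \<le> \<bar>y l\<bar> * \<bar>z l\<bar>" by simp
    ultimately show "norm (y l * z l) \<le> (y l)\<^sup>2 + (z l)\<^sup>2"
      unfolding real_norm_def abs_mult by linarith
  qed
  have tail: "\<bar>(\<Sum>l<M. y l * u l) - (\<Sum>l<K. y l * u l)\<bar> \<le> \<eta> * sqrt C"
    if "K \<le> M" "(\<Sum>l=K..<M. (y l)\<^sup>2) \<le> \<eta>\<^sup>2" "(\<Sum>l<M. (u l)\<^sup>2) \<le> C" "\<eta> \<ge> 0" for K M u \<eta>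
  proof -
    have "(\<Sum>l<M. y l * u l) = (\<Sum>l<K. y l * u l) + (\<Sum>l=K..<M. y l * u l)"
      using that(1) by (metis lessThan_atLeast0 sum.atLeastLessThan_concat zero_le)
    moreover have "(\<Sum>l=K..<M. y l * u l)\<^sup>2 \<le> (\<eta> * sqrt C)\<^sup>2"
    proof -
      have "(\<Sum>l=K..<M. y l * u l)\<^sup>2 \<le> (\<Sum>l=K..<M. (y l)\<^sup>2) * (\<Sum>l=K..<M. (u l)\<^sup>2)"
        by (rule Cauchy_Schwarz_ineq_sum)
      also have "\<dots> \<le> \<eta>\<^sup>2 * C"
      proof (intro mult_mono)
        have "(\<Sum>l=K..<M. (u l)\<^sup>2) \<le> (\<Sum>l<M. (u l)\<^sup>2)" by (intro sum_mono2) auto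
        then show "(\<Sum>l=K..<M. (u l)\<^sup>2) \<le> C" using that(3) by linarith
      qed (use that in \<open>auto intro!: sum_nonneg\<close>)
      finally show ?thesis using C0 by (simp add: power_mult_distrib)
    qed
    then have "\<bar>\<Sum>l=K..<M. y l * u l\<bar> \<le> \<eta> * sqrt C"
      using that(4) C0 by (metis abs_le_square_iff abs_of_nonneg mult_nonneg_nonneg real_sqrt_ge_zero)
    ultimately show ?thesis by linarith
  qed
  show "(\<lambda>n. \<Sum>l<m n. y l * x n l) \<longlonglongrightarrow> (\<Sum>l. y l * z l)"
  proof (rule LIMSEQ_I)
    fix e :: real assume e: "e > 0"
    define \<eta> where "\<eta> = e / (4 * (sqrt C + 1))"
    have s1: "sqrt C + 1 > 0" using C0 by (auto intro!: add_nonneg_pos)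
    have eta: "\<eta> > 0" "\<eta> * sqrt C \<le> e / 4" unfolding \<eta>_def using e s1 C0 by (auto simp: field_simps)
    obtain K where K: "\<And>m n. m \<ge> K \<Longrightarrow> norm (\<Sum>l=m..<n. (y l)\<^sup>2) < \<eta>\<^sup>2"
      using sy eta(1) unfolding summable_Cauchy by (metis zero_less_power)
    have yK: "(\<Sum>l=K..<M. (y l)\<^sup>2) \<le> \<eta>\<^sup>2" for M using K[of K M] by (simp add: sum_nonneg)
    have "(\<lambda>n. \<Sum>l<n. y l * z l) \<longlonglongrightarrow> (\<Sum>l. y l * z l)" using syz by (rule summable_LIMSEQ)
    then have "(\<lambda>n. \<bar>(\<Sum>l<n. y l * z l) - (\<Sum>l<K. y l * z l)\<bar>) \<longlonglongrightarrow> \<bar>(\<Sum>l. y l * z l) - (\<Sum>l<K. y l * z l)\<bar>"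
      by (intro tendsto_intros)
    then have z1: "\<bar>(\<Sum>l. y l * z l) - (\<Sum>l<K. y l * z l)\<bar> \<le> \<eta> * sqrt C"
      by (rule LIMSEQ_le_const2) (use tail[OF _ yK zC] eta in auto)
    have "(\<lambda>n. (\<Sum>l<K. y l * x n l)) \<longlonglongrightarrow> (\<Sum>l<K. y l * z l)" by (intro tendsto_intros xz)
    then obtain N1 where N1: "\<And>n. n \<ge> N1 \<Longrightarrow> norm ((\<Sum>l<K. y l * x n l) - (\<Sum>l<K. y l * z l)) < e / 4"
      using LIMSEQ_D[of _ _ "e/4"] e by force
    have "eventually (\<lambda>n. m n \<ge> K) sequentially"
      using m by (simp add: filterlim_at_top)
    then obtain N2 where N2: "\<And>n. n \<ge> N2 \<Longrightarrow> m n \<ge> K" by (auto simp: eventually_sequentially)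
    show "\<exists>no. \<forall>n\<ge>no. norm ((\<Sum>l<m n. y l * x n l) - (\<Sum>l. y l * z l)) < e"
    proof (intro exI allI impI)
      fix n assume n: "n \<ge> max N1 N2"
      have 1: "\<bar>(\<Sum>l<m n. y l * x n l) - (\<Sum>l<K. y l * x n l)\<bar> \<le> \<eta> * sqrt C"
        using n eta by (intro tail[OF _ yK C] N2) auto
      have 2: "\<bar>(\<Sum>l<K. y l * x n l) - (\<Sum>l<K. y l * z l)\<bar> < e / 4" using N1[of n] n by simp
      show "norm ((\<Sum>l<m n. y l * x n l) - (\<Sum>l. y l * z l)) < e"
        using 1 2 z1 eta(2) e unfolding real_norm_def by linarith
    qed
  qed
qed

context galerkin
begin

text \<open>The limit system is stated in integrated form, which passes to the limit by dominated
  convergence although its right hand side is merely integrable in time. The two energy bounds are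
  kept for finite sums, where they follow by pointwise convergence of finitely many
  coefficients.\<close>

theorem galerkin_coefficients:
  obtains c where "\<And>j. continuous_on {0..T} (c j)"
    and "\<And>n t. t \<in> {0..T} \<Longrightarrow> (\<Sum>j<n. (c j t)\<^sup>2) \<le> 3 * S"
    and "\<And>n. (LINT t|lebesgue_on {0..T}. (\<Sum>j<n. lam j * (c j t)\<^sup>2)) \<le> 3 * S"
    and "\<And>j. integrable (lebesgue_on {0..T}) (\<lambda>s. (\<Sum>l. B j l s * c l s) - lam j * c j s)"
    and "\<And>j t. t \<in> {0..T} \<Longrightarrow> c j t = a0 j + intv T 0 t (\<lambda>s. (\<Sum>l. B j l s * c l s) - lam j * c j s)"
proof -
  let ?L = "lebesgue_on {0..T}"
  \<comment> \<open>The tolerance 1 / (N + 1) makes the defect of the integral equation vanish as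
    the dimension grows.\<close>
  have "\<forall>N. \<exists>v. (\<forall>j. v j \<in> borel_measurable (lebesgue_on {0..T})) \<and>
    (\<forall>t\<in>{0..T}. (\<Sum>j<N. (v j t)\<^sup>2) \<le> 3 * S) \<and>
    (LINT t|lebesgue_on {0..T}. (\<Sum>j<N. lam j * (v j t)\<^sup>2)) \<le> 3 * S \<and>
    (\<forall>j<N. \<forall>t\<in>{0..T}. \<bar>v j t - (a0 j + intv T 0 t (\<lambda>s. \<Sum>l<N. coupling j l s * v l s))\<bar> \<le> 1 / real (Suc N))"
    by (intro allI euler) simp
  from choice[OF this] obtain v where v: "\<forall>N. (\<forall>j. v N j \<in> borel_measurable (lebesgue_on {0..T})) \<and>
    (\<forall>t\<in>{0..T}. (\<Sum>j<N. (v N j t)\<^sup>2) \<le> 3 * S) \<and>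
    (LINT t|lebesgue_on {0..T}. (\<Sum>j<N. lam j * (v N j t)\<^sup>2)) \<le> 3 * S \<and>
    (\<forall>j<N. \<forall>t\<in>{0..T}. \<bar>v N j t - (a0 j + intv T 0 t (\<lambda>s. \<Sum>l<N. coupling j l s * v N l s))\<bar> \<le> 1 / real (Suc N))"
    by blast
  have v_meas: "v N j \<in> borel_measurable ?L" for N j
    using spec[OF v, of N] by (elim conjE) (rule spec)
  have v_S: "(\<Sum>j<N. (v N j t)\<^sup>2) \<le> 3 * S" if "t \<in> {0..T}" for N t
    using spec[OF v, of N] that by (elim conjE) (rule bspec)
  have v_lam: "(LINT t|?L. (\<Sum>j<N. lam j * (v N j t)\<^sup>2)) \<le> 3 * S" for N
    using spec[OF v, of N] by (elim conjE)
  have v_eq: "\<bar>v N j t - (a0 j + intv T 0 t (\<lambda>s. \<Sum>l<N. coupling j l s * v N l s))\<bar> \<le> 1 / real (Suc N)"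
    if "j < N" "t \<in> {0..T}" for N j t
  proof -
    from spec[OF v, of N] have "\<forall>j<N. \<forall>t\<in>{0..T}. \<bar>v N j t - (a0 j + intv T 0 t (\<lambda>s. \<Sum>l<N. coupling j l s * v N l s))\<bar> \<le> 1 / real (Suc N)"
      by (elim conjE)
    with that show ?thesis by blast
  qed
  note [measurable] = v_meas
  define F where "F N j s = (\<Sum>l<N. coupling j l s * v N l s)" for N j s
  \<comment> \<open>The iterate \<open>v N j\<close> is piecewise constant. Its companion
    \<open>w N j\<close> is continuous in time, as Arzela-Ascoli requires, and for j < N differs
    from it by at most 1 / (N + 1).\<close>
  define w where "w N j t = a0 j + intv T 0 t (F N j)" for N j t
  define R where "R = sqrt (3 * S)"
  have R0: "R \<ge> 0" and R2: "R\<^sup>2 = 3 * S" unfolding R_def using S_nonneg by auto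
  have v_R: "\<bar>v N l t\<bar> \<le> R" if "t \<in> {0..T}" "l < N" for N l t
  proof -
    have "(v N l t)\<^sup>2 \<le> (\<Sum>j<N. (v N j t)\<^sup>2)" using that by (intro member_le_sum) auto
    then have "(v N l t)\<^sup>2 \<le> 3 * S" using v_S[OF that(1), of N] by linarith
    then show ?thesis unfolding R_def using real_le_rsqrt[of "\<bar>v N l t\<bar>"] by simp
  qed
  have F_int: "integrable ?L (F N j)" for N j
    unfolding F_def[abs_def] using v_R
    by (intro Bochner_Integration.integrable_sum integrable_bounded_mult[OF coupling_integrable, where C=R]) auto
  have F_eq: "F N j s = (\<Sum>l<N. B j l s * v N l s) - (if j < N then lam j * v N j s else 0)" for N j s
    unfolding F_def coupling_def
    by (simp add: left_diff_distrib sum_subtractf if_distrib[of "\<lambda>x. x * _"] cong: if_cong)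
  \<comment> \<open>Independent of N: row j is bounded by \<open>bessel\<close> in the l^2 norm over
    l and paired with the energy bound for \<open>v\<close>, rather than summed entry by
    entry.\<close>
  define k' where "k' j = (kap j + lam j) * R" for j
  have k'0: "k' j \<ge> 0" for j unfolding k'_def using kap lam R0 by simp
  have F_le: "\<bar>F N j s\<bar> \<le> k' j * (1 + beta s)" if s: "s \<in> {0..T}" for N j s
  proof -
    have "(\<Sum>l<N. B j l s * v N l s)\<^sup>2 \<le> (\<Sum>l<N. (B j l s)\<^sup>2) * (\<Sum>l<N. (v N l s)\<^sup>2)"
      by (rule Cauchy_Schwarz_ineq_sum)
    also have "\<dots> \<le> (kap j * beta s)\<^sup>2 * R\<^sup>2"
      unfolding R2 using bessel[OF s] v_S[OF s] by (intro mult_mono) (auto intro!: sum_nonneg)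
    also have "\<dots> = (kap j * beta s * R)\<^sup>2" by (simp add: power_mult_distrib)
    finally have "\<bar>\<Sum>l<N. B j l s * v N l s\<bar> \<le> kap j * beta s * R"
      using kap[of j] beta(1)[of s] R0 by (metis abs_le_square_iff abs_of_nonneg mult_nonneg_nonneg)
    moreover have "\<bar>if j < N then lam j * v N j s else 0\<bar> \<le> lam j * R"
      using v_R[OF s] lam[of j] R0 by (auto simp: abs_mult intro!: mult_left_mono)
    ultimately have "\<bar>F N j s\<bar> \<le> kap j * beta s * R + lam j * R" unfolding F_eq by linarith
    also have "\<dots> \<le> k' j * (1 + beta s)"
      unfolding k'_def using kap[of j] lam[of j] beta(1)[of s] R0 by (simp add: algebra_simps)
    finally show ?thesis .
  qed
  have w_diff: "\<bar>w N j t - w N j s\<bar> \<le> k' j * \<bar>clock t - clock s\<bar>" if "s \<in> {0..T}" "t \<in> {0..T}" for N j s t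
  proof -
    have *: "\<bar>w N j t - w N j s\<bar> \<le> k' j * \<bar>clock t - clock s\<bar>" if "s \<in> {0..T}" "t \<in> {0..T}" "s \<le> t" for s t
    proof -
      have "w N j t - w N j s = intv T s t (F N j)"
        unfolding w_def using integral_Ioc_add[OF F_int, of 0 s t] that by simp
      also have "\<bar>\<dots>\<bar> \<le> intv T s t (\<lambda>s. k' j * (1 + beta s))"
        using F_le beta_plus_1_integrable by (intro intv_abs_le F_int) auto
      also have "\<dots> = k' j * (clock t - clock s)" unfolding intv_mult_left using that by (subst clock_diff) auto
      also have "\<dots> \<le> k' j * \<bar>clock t - clock s\<bar>" using k'0 by (intro mult_left_mono) auto
      finally show ?thesis .
    qed
    show ?thesis using *[OF that] *[OF that(2,1)] by (cases "s \<le> t") (auto simp: abs_minus_commute)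
  qed
  \<comment> \<open>Along the subsequence \<open>r\<close> the j-th coefficient converges uniformly
    on \<open>{0..T}\<close>; the diagonal argument runs over j.\<close>
  define P where "P j r \<longleftrightarrow> (\<exists>g. continuous_on {0..T} g \<and>
     (\<forall>e>0. \<exists>N. \<forall>n t. n \<ge> N \<and> t \<in> {0..T} \<longrightarrow> norm (w (r n) j t - g t) < e))" for j and r :: "nat \<Rightarrow> nat"
  have sub: "\<exists>k. strict_mono (k :: nat \<Rightarrow> nat) \<and> P j (r \<circ> k)" for j r
  proof -
    have bd: "norm (w (r n) j t) \<le> \<bar>a0 j\<bar> + k' j * \<bar>clock T\<bar>" if "t \<in> {0..T}" for n t
    proof -
      have "\<bar>w (r n) j t - w (r n) j 0\<bar> \<le> k' j * \<bar>clock t - clock 0\<bar>" using that T by (intro w_diff) auto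
      moreover have "\<bar>clock t - clock 0\<bar> \<le> \<bar>clock T\<bar>" using clock_mono[of 0 t] clock_mono[of t T] that unfolding clock_def by auto
      then have "k' j * \<bar>clock t - clock 0\<bar> \<le> k' j * \<bar>clock T\<bar>" using k'0 by (rule mult_left_mono)
      moreover have "w (r n) j 0 = a0 j" unfolding w_def by simp
      ultimately show ?thesis unfolding real_norm_def by linarith
    qed
    have eq: "\<exists>d>0. \<forall>n y. y \<in> {0..T} \<and> norm (x - y) < d \<longrightarrow> norm (w (r n) j x - w (r n) j y) < e"
      if x: "x \<in> {0..T}" and e: "e > 0" for x e :: real
    proof -
      have "e / (k' j + 1) > 0" using e k'0[of j] by simp
      then obtain d where d: "d > 0" "\<And>y. y \<in> {0..T} \<Longrightarrow> dist y x < d \<Longrightarrow> dist (clock y) (clock x) < e / (k' j + 1)"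
        using clock_cont x unfolding continuous_on_iff by blast
      have "norm (w (r n) j x - w (r n) j y) < e" if "y \<in> {0..T}" "norm (x - y) < d" for n y
      proof -
        have "\<bar>clock x - clock y\<bar> < e / (k' j + 1)" using d(2)[OF that(1)] that(2) by (simp add: dist_real_def abs_minus_commute)
        then have "(k' j + 1) * \<bar>clock x - clock y\<bar> < e" using k'0[of j] by (simp add: field_simps)
        moreover have "k' j * \<bar>clock x - clock y\<bar> \<le> (k' j + 1) * \<bar>clock x - clock y\<bar>" by (simp add: mult_right_mono)
        ultimately show ?thesis using w_diff[OF that(1) x, of "r n" j] unfolding real_norm_def by linarith
      qed
      then show ?thesis using d(1) by blast
    qed
    obtain g k where g: "continuous_on {0..T} g" "strict_mono (k :: nat \<Rightarrow> nat)"
       "\<And>e. 0 < e \<Longrightarrow> \<exists>N. \<forall>n x. n \<ge> N \<and> x \<in> {0..T} \<longrightarrow> norm (w (r (k n)) j x - g x) < e"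
      by (rule Arzela_Ascoli[of "{0..T}" "\<lambda>n. w (r n) j" "\<bar>a0 j\<bar> + k' j * \<bar>clock T\<bar>"])
         (use bd eq in auto)
    show ?thesis unfolding P_def comp_def using g by blast
  qed
  \<comment> \<open>A diagonal sequence is a subsequence of the i-th one only from some index on, so
    the property has to ignore finitely many terms.\<close>
  have PP: "P i (r \<circ> k2)"
    if P: "P i (r \<circ> k1)" and sub: "\<And>j. N \<le> j \<Longrightarrow> \<exists>j'. j \<le> j' \<and> k2 j = k1 j'"
    for i r k1 k2 and N :: nat
  proof -
    from P obtain g where g: "continuous_on {0..T} g"
      "\<And>e. e > 0 \<Longrightarrow> \<exists>N. \<forall>n t. n \<ge> N \<and> t \<in> {0..T} \<longrightarrow> norm (w (r (k1 n)) i t - g t) < e"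
      unfolding P_def comp_def by blast
    have "\<exists>N. \<forall>n t. n \<ge> N \<and> t \<in> {0..T} \<longrightarrow> norm (w (r (k2 n)) i t - g t) < e" if e: "e > 0" for e :: real
    proof -
      obtain N' where N': "\<forall>n t. n \<ge> N' \<and> t \<in> {0..T} \<longrightarrow> norm (w (r (k1 n)) i t - g t) < e" using g(2)[OF e] by blast
      show ?thesis
      proof (intro exI[of _ "max N N'"] allI impI)
        fix n t assume "max N N' \<le> n \<and> t \<in> {0..T}"
        moreover from this obtain j' where "n \<le> j'" "k2 n = k1 j'" using sub[of n] by auto
        ultimately show "norm (w (r (k2 n)) i t - g t) < e" using N' by auto
      qed
    qed
    then show "P i (r \<circ> k2)" unfolding P_def comp_def using g(1) by blast
  qed
  have "\<exists>k. strict_mono (k :: nat \<Rightarrow> nat) \<and> (\<forall>j. P j (id \<circ> k))"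
  proof (rule subsequence_diagonalization_lemma[of P id, OF sub])
    fix i r k1 k2 and N :: nat
    assume "P i (r \<circ> k1)" "\<And>j. N \<le> j \<Longrightarrow> \<exists>j'. j \<le> j' \<and> k2 j = k1 j'"
    then show "P i (r \<circ> k2)" by (rule PP)
  next
    fix k :: "nat \<Rightarrow> nat" assume "strict_mono k" "\<And>i. P i (id \<circ> k)"
    then show "\<exists>k. strict_mono (k :: nat \<Rightarrow> nat) \<and> (\<forall>j. P j (id \<circ> k))" by blast
  qed
  then obtain k where k: "strict_mono (k :: nat \<Rightarrow> nat)" "\<And>j. P j (id \<circ> k)" by blast
  then obtain c where c_cont: "\<And>j. continuous_on {0..T} (c j)"
    and c_lim: "\<And>j e. e > 0 \<Longrightarrow> \<exists>N. \<forall>n t. n \<ge> N \<and> t \<in> {0..T} \<longrightarrow> norm (w (k n) j t - c j t) < e"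
    unfolding P_def comp_def id_def by metis
  have kn: "k n \<ge> n" for n using k(1) by (rule seq_suble)
  have w_c: "(\<lambda>n. w (k n) j t) \<longlonglongrightarrow> c j t" if "t \<in> {0..T}" for j t
    by (rule LIMSEQ_I) (use c_lim[of _ j] that in blast)
  have v_c: "(\<lambda>n. v (k n) j t) \<longlonglongrightarrow> c j t" if t: "t \<in> {0..T}" for j t
  proof -
    have "(\<lambda>n. v (k n) j t - w (k n) j t) \<longlonglongrightarrow> 0"
    proof (rule Lim_null_comparison)
      show "eventually (\<lambda>n. norm (v (k n) j t - w (k n) j t) \<le> 1 / real (Suc n)) sequentially"
        unfolding eventually_sequentially
      proof (intro exI[of _ "Suc j"] allI impI)
        fix n assume "Suc j \<le> n"
        then have "j < k n" using kn[of n] by linarith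
        from v_eq[OF this t] have "norm (v (k n) j t - w (k n) j t) \<le> 1 / real (Suc (k n))"
          unfolding w_def F_def[abs_def] by simp
        also have "\<dots> \<le> 1 / real (Suc n)" using kn[of n] by (intro divide_left_mono) auto
        finally show "norm (v (k n) j t - w (k n) j t) \<le> 1 / real (Suc n)" .
      qed
      show "(\<lambda>n. 1 / real (Suc n)) \<longlonglongrightarrow> 0" by (rule LIMSEQ_Suc[OF lim_1_over_n])
    qed
    from tendsto_add[OF this w_c[OF t, of j]] show ?thesis by simp
  qed
  have kmono: "filterlim k at_top sequentially" by (rule filterlim_subseq[OF k(1)])
  have c_S: "(\<Sum>j<n. (c j t)\<^sup>2) \<le> 3 * S" if t: "t \<in> {0..T}" for n t
  proof (rule LIMSEQ_le_const2)
    show "(\<lambda>i. \<Sum>j<n. (v (k i) j t)\<^sup>2) \<longlonglongrightarrow> (\<Sum>j<n. (c j t)\<^sup>2)"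
      by (intro tendsto_intros v_c t)
    show "\<exists>N. \<forall>i\<ge>N. (\<Sum>j<n. (v (k i) j t)\<^sup>2) \<le> 3 * S"
    proof (intro exI[of _ n] allI impI)
      fix i assume "n \<le> i"
      then have "(\<Sum>j<n. (v (k i) j t)\<^sup>2) \<le> (\<Sum>j<k i. (v (k i) j t)\<^sup>2)"
        using kn[of i] by (intro sum_mono2) auto
      then show "(\<Sum>j<n. (v (k i) j t)\<^sup>2) \<le> 3 * S" using v_S[OF t, of "k i"] by linarith
    qed
  qed
  have c_meas [measurable]: "c j \<in> borel_measurable ?L" for j
    by (rule continuous_imp_measurable_on_sets_lebesgue[OF c_cont]) simp
  have vv_int: "integrable ?L (\<lambda>t. lam j * (v N j t)\<^sup>2)" if "j < N" for j N
  proof (rule integrable_bounded_mult[where C="R\<^sup>2"])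
    show "\<bar>(v N j s)\<^sup>2\<bar> \<le> R\<^sup>2" if "s \<in> space ?L" for s
      using v_R[of s j N] that \<open>j < N\<close> R0 by (simp add: abs_le_square_iff[symmetric])
  qed auto
  \<comment> \<open>The shifted index \<open>i + n\<close> guarantees
    \<open>k (i + n) \<ge> n\<close>: the first n modes belong to the approximation for every i, and
    the energy bound applies to all terms of the sequence.\<close>
  have c_lam: "(LINT t|?L. (\<Sum>j<n. lam j * (c j t)\<^sup>2)) \<le> 3 * S" for n
  proof (rule LIMSEQ_le_const2)
    show "(\<lambda>i. LINT t|?L. (\<Sum>j<n. lam j * (v (k (i + n)) j t)\<^sup>2)) \<longlonglongrightarrow> (LINT t|?L. (\<Sum>j<n. lam j * (c j t)\<^sup>2))"
    proof (rule integral_dominated_convergence[where w="\<lambda>_. \<Sum>j<n. lam j * R\<^sup>2"])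
      show "AE t in ?L. (\<lambda>i. \<Sum>j<n. lam j * (v (k (i + n)) j t)\<^sup>2) \<longlonglongrightarrow> (\<Sum>j<n. lam j * (c j t)\<^sup>2)"
      proof (rule AE_I2)
        fix t assume "t \<in> space ?L"
        then have t: "t \<in> {0..T}" by simp
        have "(\<lambda>i. v (k (i + n)) j t) \<longlonglongrightarrow> c j t" for j
          using LIMSEQ_ignore_initial_segment[OF v_c[OF t, of j], of n] by simp
        then show "(\<lambda>i. \<Sum>j<n. lam j * (v (k (i + n)) j t)\<^sup>2) \<longlonglongrightarrow> (\<Sum>j<n. lam j * (c j t)\<^sup>2)"
          by (intro tendsto_intros)
      qed
      show "AE t in ?L. norm (\<Sum>j<n. lam j * (v (k (i + n)) j t)\<^sup>2) \<le> (\<Sum>j<n. lam j * R\<^sup>2)" for i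
      proof (rule AE_I2)
        fix t assume "t \<in> space ?L"
        then have t: "t \<in> {0..T}" by simp
        have "(v (k (i + n)) j t)\<^sup>2 \<le> R\<^sup>2" if "j < n" for j
          using v_R[OF t, of j "k (i + n)"] kn[of "i + n"] that R0 by (simp add: abs_le_square_iff[symmetric])
        then show "norm (\<Sum>j<n. lam j * (v (k (i + n)) j t)\<^sup>2) \<le> (\<Sum>j<n. lam j * R\<^sup>2)"
          using lam by (simp add: sum_nonneg abs_of_nonneg) (intro sum_mono mult_left_mono; simp)
      qed
    qed auto
    show "\<exists>N. \<forall>i\<ge>N. (LINT t|?L. (\<Sum>j<n. lam j * (v (k (i + n)) j t)\<^sup>2)) \<le> 3 * S"
    proof (intro exI[of _ 0] allI impI)
      fix i
      have "(LINT t|?L. (\<Sum>j<n. lam j * (v (k (i + n)) j t)\<^sup>2)) \<le> (LINT t|?L. (\<Sum>j<k (i + n). lam j * (v (k (i + n)) j t)\<^sup>2))"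
        using kn[of "i + n"] vv_int lam
        by (intro integral_mono Bochner_Integration.integrable_sum sum_mono2) auto
      also have "\<dots> \<le> 3 * S" by (rule v_lam)
      finally show "(LINT t|?L. (\<Sum>j<n. lam j * (v (k (i + n)) j t)\<^sup>2)) \<le> 3 * S" .
    qed
  qed
  \<comment> \<open>At a fixed time, row j of \<open>B\<close> is a fixed square summable sequence,
    so \<open>ell2_weak_limit\<close> gives convergence of the right hand sides to
    \<open>H\<close>.\<close>
  define H where "H j s = (\<Sum>l. B j l s * c l s) - lam j * c j s" for j s
  have F_H: "(\<lambda>n. F (k n) j s) \<longlonglongrightarrow> H j s" if s: "s \<in> {0..T}" for j s
  proof -
    have "(\<lambda>n. \<Sum>l<k n. B j l s * v (k n) l s) \<longlonglongrightarrow> (\<Sum>l. B j l s * c l s)"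
      by (rule ell2_weak_limit(2)[OF v_c[OF s] v_S[OF s] bessel[OF s] kmono])
    moreover have "(\<lambda>n. if j < k n then lam j * v (k n) j s else 0) \<longlonglongrightarrow> lam j * c j s"
    proof (rule Lim_transform_eventually)
      show "(\<lambda>n. lam j * v (k n) j s) \<longlonglongrightarrow> lam j * c j s" by (intro tendsto_intros v_c s)
      have "eventually (\<lambda>n. j < k n) sequentially"
        unfolding eventually_sequentially using kn by (intro exI[of _ "Suc j"]) (meson Suc_le_lessD le_trans)
      then show "eventually (\<lambda>n. lam j * v (k n) j s = (if j < k n then lam j * v (k n) j s else 0)) sequentially"
        by eventually_elim simp
    qed
    ultimately show ?thesis unfolding F_eq H_def by (rule tendsto_diff)
  qed
  have F_meas: "F N j \<in> borel_measurable ?L" for N j using F_int by blast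
  have H_meas: "H j \<in> borel_measurable ?L" for j
    by (rule borel_measurable_LIMSEQ_real[OF F_H F_meas]) simp
  have H_le: "\<bar>H j s\<bar> \<le> k' j * (1 + beta s)" if s: "s \<in> {0..T}" for j s
    using tendsto_rabs[OF F_H[OF s]] by (rule LIMSEQ_le_const2) (use F_le[OF s] in auto)
  have H_int: "integrable ?L (H j)" for j
  proof (rule Bochner_Integration.integrable_bound)
    show "integrable ?L (\<lambda>s. k' j * (1 + beta s))" using beta_plus_1_integrable by simp
    show "AE s in ?L. norm (H j s) \<le> norm (k' j * (1 + beta s))"
    proof (rule AE_I2)
      fix s assume "s \<in> space ?L"
      then show "norm (H j s) \<le> norm (k' j * (1 + beta s))" using H_le[of s j] by simp
    qed
  qed (rule H_meas)
  have c_eq: "c j t = a0 j + intv T 0 t (H j)" if t: "t \<in> {0..T}" for j t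
  proof (rule LIMSEQ_unique[OF w_c[OF t]])
    have "(\<lambda>n. intv T 0 t (F (k n) j)) \<longlonglongrightarrow> intv T 0 t (H j)"
    proof (rule integral_dominated_convergence[where w="\<lambda>s. k' j * (1 + beta s)"])
      show "AE s in ?L. (\<lambda>n. indicat_real {0<..t} s * F (k n) j s) \<longlonglongrightarrow> indicat_real {0<..t} s * H j s"
        using F_H by (intro AE_I2 tendsto_intros) auto
      show "AE s in ?L. norm (indicat_real {0<..t} s * F (k n) j s) \<le> k' j * (1 + beta s)" for n
        using F_le k'0 beta(1) by (intro AE_I2) (auto simp: indicator_def intro!: mult_nonneg_nonneg add_nonneg_nonneg)
    qed (use integrable_Ioc[OF F_int] integrable_Ioc[OF H_int] beta_plus_1_integrable in auto)
    then show "(\<lambda>n. w (k n) j t) \<longlonglongrightarrow> a0 j + intv T 0 t (H j)"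
      unfolding w_def by (intro tendsto_intros)
  qed
  show ?thesis
    by (rule that[OF c_cont c_S c_lam]) (use H_int c_eq in \<open>auto simp: H_def[abs_def]\<close>)
qed

end

section \<open>Integration by parts and the Hartley basis on the torus\<close>

lemma torus_finite: "finite_measure torus"
  unfolding torus_def by (rule finite_measure_lebesgue_on) auto

lemma space_torus [simp]: "space torus = cbox 0 1"
  unfolding torus_def by simp

lemma torus_integrable_const [simp]: "integrable torus (\<lambda>x::real^'n. c::real)"
  using finite_measure.integrable_const[OF torus_finite] .

lemma continuous_imp_torus_measurable:
  fixes f :: "real^'n \<Rightarrow> 'b::euclidean_space"
  assumes "continuous_on UNIV f"
  shows "f \<in> borel_measurable torus"
  unfolding torus_def
  by (rule continuous_imp_measurable_on_sets_lebesgue) (use assms continuous_on_subset in auto)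

lemma torus_bounded:
  fixes f :: "real^'n \<Rightarrow> 'b::real_normed_vector"
  assumes "continuous_on UNIV f"
  obtains C where "C \<ge> 0" "\<And>x. x \<in> cbox 0 1 \<Longrightarrow> norm (f x) \<le> C"
proof -
  have "compact (f ` cbox 0 1)"
    using assms continuous_on_subset by (intro compact_continuous_image) auto
  then have "bounded (f ` cbox 0 1)" by (rule compact_imp_bounded)
  then obtain C where "\<And>y. y \<in> f ` cbox 0 1 \<Longrightarrow> norm y \<le> C" unfolding bounded_iff by blast
  then show ?thesis by (intro that[of "max C 0"]) (auto simp: le_max_iff_disj)
qed

lemma torus_integrable_cont:
  fixes f :: "real^'n \<Rightarrow> 'b::euclidean_space"
  assumes "continuous_on UNIV f"
  shows "integrable torus f"
proof -
  obtain C where "C \<ge> 0" "\<And>x. x \<in> cbox 0 1 \<Longrightarrow> norm (f x) \<le> C" using torus_bounded[OF assms] by blast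
  then show ?thesis
    by (intro finite_measure.integrable_const_bound[OF torus_finite, of _ C] AE_I2 continuous_imp_torus_measurable assms) auto
qed

lemma torus_integrable_mult_cont:
  fixes f h :: "real^'n \<Rightarrow> real"
  assumes "integrable torus h" "continuous_on UNIV f"
  shows "integrable torus (\<lambda>x. h x * f x)"
proof -
  obtain C where C: "C \<ge> 0" "\<And>x. x \<in> cbox 0 1 \<Longrightarrow> norm (f x) \<le> C" using torus_bounded[OF assms(2)] by blast
  show ?thesis
  proof (rule Bochner_Integration.integrable_bound)
    show "integrable torus (\<lambda>x. h x * C)" using assms by simp
    show "(\<lambda>x. h x * f x) \<in> borel_measurable torus"
      using assms continuous_imp_torus_measurable[OF assms(2)] by (intro borel_measurable_times) auto
    show "AE x in torus. norm (h x * f x) \<le> norm (h x * C)"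
      using C by (intro AE_I2) (auto simp: abs_mult intro!: mult_left_mono)
  qed
qed

lemma torus_integral_lborel:
  fixes f :: "real^'n \<Rightarrow> real"
  assumes "f \<in> borel_measurable borel"
  shows "(LINT x|torus. f x) = (LINT x|lborel. indicat_real (cbox 0 1) x * f x)"
proof -
  have "(LINT x|torus. f x) = (LINT x|lebesgue. indicat_real (cbox 0 1) x *\<^sub>R f x)"
    unfolding torus_def by (rule integral_restrict_space) simp
  also have "\<dots> = (LINT x|lborel. indicat_real (cbox 0 1) x *\<^sub>R f x)"
    by (rule integral_completion) (use assms in simp)
  finally show ?thesis by simp
qed

lemma torus_measure_1: "(LINT x|(torus :: (real^'n) measure). (1::real)) = 1"
proof -
  have "Sigma_Algebra.measure lborel (cbox 0 (1 :: real^'n)) = (\<Prod>b\<in>Basis. (1 :: real^'n) \<bullet> b - 0 \<bullet> b)"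
    by (rule content_cbox) (auto simp: inner_Basis Basis_vec_def inner_axis)
  also have "\<dots> = 1" by (rule prod.neutral) (auto simp: Basis_vec_def inner_axis)
  finally have 1: "Sigma_Algebra.measure lborel (cbox 0 (1 :: real^'n)) = 1" .
  have "(LINT x|(torus :: (real^'n) measure). (1::real)) = (LINT x|lborel. indicat_real (cbox 0 (1 :: real^'n)) x * 1)"
    by (rule torus_integral_lborel) simp
  also have "\<dots> = 1" using 1 by simp
  finally show ?thesis .
qed

lemma measure_torus [simp]: "Sigma_Algebra.measure (torus :: (real^'n) measure) (cbox 0 1) = 1"
  using torus_measure_1[where 'n='n] by simp

lemma lborel_integral_translate:
  fixes f :: "'a::euclidean_space \<Rightarrow> real"
  assumes "f \<in> borel_measurable borel"
  shows "(LINT x|lborel. f (c + x)) = (LINT x|lborel. f x)"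
proof -
  have "(LINT x|lborel. f x) = (LINT x|distr lborel borel ((+) c). f x)" by (simp add: lborel_distr_plus)
  also have "\<dots> = (LINT x|lborel. f (c + x))" by (rule integral_distr) (use assms in auto)
  finally show ?thesis by simp
qed

lemma AE_not_hyperplane: "AE y in lborel. (y :: real^'n) $ i \<noteq> c"
proof -
  have "negligible {y :: real^'n. y \<bullet> axis i 1 = c}"
    by (rule negligible_standard_hyperplane) (auto simp: Basis_vec_def)
  then have "{y :: real^'n. y $ i = c} \<in> null_sets lebesgue"
    by (simp add: negligible_iff_null_sets inner_axis)
  moreover have "{y :: real^'n. y $ i = c} \<in> sets lborel" by measurable
  ultimately have "{y :: real^'n. y $ i = c} \<in> null_sets lborel" by (simp add: null_sets_completion_iff)
  then show ?thesis by (rule AE_I') auto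
qed

lemma periodic_axis:
  fixes f :: "real^'n \<Rightarrow> 'b"
  assumes "periodic f" shows "f (axis i 1 + x) = f x"
proof -
  have "\<forall>j. (axis i 1 :: real^'n) $ j \<in> \<int>" by (auto simp: axis_def)
  then show ?thesis using assms unfolding periodic_def by (metis add.commute)
qed

text \<open>
  Cutting the shifted cube along \<open>x\<^sub>i = 1\<close> and translating one piece back by a period gives the
  cube again.
\<close>

lemma torus_integral_shift:
  fixes f :: "real^'n \<Rightarrow> real"
  assumes f: "continuous_on UNIV f" and per: "periodic f" and h: "0 < h" "h < 1"
  shows "(LINT x|torus. f (h *\<^sub>R axis i 1 + x)) = (LINT x|torus. f x)"
proof -
  let ?e = "axis i 1 :: real^'n"
  have fb [measurable]: "f \<in> borel_measurable borel" using f by (rule borel_measurable_continuous_onI)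
  define P where "P y = indicat_real (cbox 0 1 \<inter> {y. h \<le> y $ i}) y" for y :: "real^'n"
  define Q where "Q y = indicat_real (cbox 0 1 \<inter> {y. y $ i \<le> h}) y" for y :: "real^'n"
  have Pb [measurable]: "P \<in> borel_measurable borel" unfolding P_def[abs_def] by measurable
  have Qb [measurable]: "Q \<in> borel_measurable borel" unfolding Q_def[abs_def] by measurable
  have cP: "compact (cbox 0 1 \<inter> {y :: real^'n. h \<le> y $ i})"
    by (intro compact_Int_closed compact_cbox closed_Collect_le continuous_intros)
  have cQ: "compact (cbox 0 1 \<inter> {y :: real^'n. y $ i \<le> h})"
    by (intro compact_Int_closed compact_cbox closed_Collect_le continuous_intros)
  have iP: "integrable lborel (\<lambda>y. P y * f y)"
    using borel_integrable_compact[OF cP continuous_on_subset[OF f subset_UNIV]] unfolding P_def by (simp add: scaleR_conv_of_real)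
  have iQ: "integrable lborel (\<lambda>y. Q y * f y)"
    using borel_integrable_compact[OF cQ continuous_on_subset[OF f subset_UNIV]] unfolding Q_def by (simp add: scaleR_conv_of_real)
  have iQ': "integrable lborel (\<lambda>y. Q (- ?e + y) * f y)"
  proof -
    have "integrable (distr lborel borel ((+) (- ?e))) (\<lambda>y. Q y * f y)" using iQ by (simp add: lborel_distr_plus)
    then have "integrable lborel (\<lambda>y. Q (- ?e + y) * f (- ?e + y))"
      by (subst (asm) integrable_distr_eq) auto
    moreover have "f (- ?e + y) = f y" for y using periodic_axis[OF per, of i "- ?e + y"] by simp
    ultimately show ?thesis by simp
  qed
  have fc: "(\<lambda>x. f (h *\<^sub>R ?e + x)) \<in> borel_measurable borel" by measurable
  have "(LINT x|torus. f (h *\<^sub>R ?e + x)) = (LINT x|lborel. indicat_real (cbox 0 1) (- (h *\<^sub>R ?e) + (h *\<^sub>R ?e + x)) * f (h *\<^sub>R ?e + x))"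
    unfolding torus_integral_lborel[OF fc] by simp
  also have "\<dots> = (LINT y|lborel. indicat_real (cbox 0 1) (- (h *\<^sub>R ?e) + y) * f y)"
    by (rule lborel_integral_translate[where f="\<lambda>y. indicat_real (cbox 0 1) (- (h *\<^sub>R ?e) + y) * f y"]) measurable
  also have "\<dots> = (LINT y|lborel. P y * f y + Q (- ?e + y) * f y)"
  proof (rule integral_cong_AE)
    show "AE y in lborel. indicat_real (cbox 0 1) (- (h *\<^sub>R ?e) + y) * f y = P y * f y + Q (- ?e + y) * f y"
      using AE_not_hyperplane[of i 1]
    proof eventually_elim
      case (elim y)
      have 1: "- (h *\<^sub>R ?e) + y \<in> cbox 0 1 \<longleftrightarrow> (\<forall>j. j \<noteq> i \<longrightarrow> 0 \<le> y $ j \<and> y $ j \<le> 1) \<and> h \<le> y $ i \<and> y $ i \<le> 1 + h"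
        by (auto simp: mem_box_cart axis_def split: if_splits)
      have 2: "y \<in> cbox 0 1 \<longleftrightarrow> (\<forall>j. j \<noteq> i \<longrightarrow> 0 \<le> y $ j \<and> y $ j \<le> 1) \<and> 0 \<le> y $ i \<and> y $ i \<le> 1"
        by (auto simp: mem_box_cart)
      have 3: "- ?e + y \<in> cbox 0 1 \<longleftrightarrow> (\<forall>j. j \<noteq> i \<longrightarrow> 0 \<le> y $ j \<and> y $ j \<le> 1) \<and> 1 \<le> y $ i \<and> y $ i \<le> 2"
        by (auto simp: mem_box_cart axis_def split: if_splits)
      have "indicat_real (cbox 0 1) (- (h *\<^sub>R ?e) + y) = P y + Q (- ?e + y)"
        unfolding P_def Q_def indicator_def using elim h 1 2 3 by (auto simp: axis_def)
      then show ?case by (simp add: distrib_right)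
    qed
  qed measurable
  also have "\<dots> = (LINT y|lborel. P y * f y) + (LINT y|lborel. Q (- ?e + y) * f y)"
    using iP iQ' by (rule Bochner_Integration.integral_add)
  also have "(LINT y|lborel. Q (- ?e + y) * f y) = (LINT y|lborel. Q (- ?e + (?e + y)) * f (?e + y))"
    by (rule lborel_integral_translate[symmetric, where f="\<lambda>y. Q (- ?e + y) * f y"]) measurable
  also have "\<dots> = (LINT y|lborel. Q y * f y)" by (simp add: periodic_axis[OF per])
  also have "(LINT y|lborel. P y * f y) + (LINT y|lborel. Q y * f y) = (LINT y|lborel. P y * f y + Q y * f y)"
    using iP iQ by simp
  also have "\<dots> = (LINT y|lborel. indicat_real (cbox 0 1) y * f y)"
  proof (rule integral_cong_AE)
    show "AE y in lborel. P y * f y + Q y * f y = indicat_real (cbox 0 1) y * f y"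
      using AE_not_hyperplane[of i h] by eventually_elim (auto simp: P_def Q_def indicator_def)
  qed measurable
  also have "\<dots> = (LINT x|torus. f x)" by (simp add: torus_integral_lborel)
  finally show ?thesis .
qed

text \<open>Difference quotients of a periodic function integrate to zero by translation invariance,
  the mean value theorem bounds them uniformly, and dominated convergence yields the derivative. All
  integration by parts in space rests on this.\<close>

lemma torus_integral_deriv_zero:
  fixes f f' :: "real^'n \<Rightarrow> real"
  assumes per: "periodic f" and f: "continuous_on UNIV f" and f': "continuous_on UNIV f'"
    and der: "\<And>x s. ((\<lambda>s. f (s *\<^sub>R axis i 1 + x)) has_real_derivative f' (s *\<^sub>R axis i 1 + x)) (at s)"
  shows "(LINT x|torus. f' x) = 0"
proof -
  let ?e = "axis i 1 :: real^'n"
  \<comment> \<open>The offset 2 keeps every step strictly between 0 and 1, as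
    \<open>torus_integral_shift\<close> demands.\<close>
  define h where "h n = 1 / (real n + 2)" for n
  have h: "0 < h n" "h n < 1" for n unfolding h_def by (auto simp: field_simps)
  have h0: "h \<longlonglongrightarrow> 0" unfolding h_def by real_asymp
  define q where "q n x = (f (h n *\<^sub>R ?e + x) - f x) / h n" for n x
  have fs: "continuous_on UNIV (\<lambda>x. f (h n *\<^sub>R ?e + x))" for n
    by (intro continuous_on_compose2[OF f] continuous_intros) auto
  have qc: "continuous_on UNIV (q n)" for n
    unfolding q_def[abs_def] using h[of n] by (intro continuous_intros fs f) auto
  have q0: "(LINT x|torus. q n x) = 0" for n
    unfolding q_def using torus_integral_shift[OF f per h, of n i] torus_integrable_cont[OF f] torus_integrable_cont[OF fs]
    by simp
  \<comment> \<open>Points of the cube have norm at most d and the intermediate point is shifted by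
    less than 1, so it stays in this ball.\<close>
  have "compact (f' ` cball 0 (real CARD('n) + 1))"
    using f' continuous_on_subset by (intro compact_continuous_image) auto
  then have "bounded (f' ` cball 0 (real CARD('n) + 1))" by (rule compact_imp_bounded)
  then obtain C where C: "\<And>y. y \<in> f' ` cball 0 (real CARD('n) + 1) \<Longrightarrow> norm y \<le> C"
    unfolding bounded_iff by meson
  have "(\<lambda>n. LINT x|torus. q n x) \<longlonglongrightarrow> (LINT x|torus. f' x)"
  proof (rule integral_dominated_convergence[where w="\<lambda>_. C"])
    show "AE x in torus. (\<lambda>n. q n x) \<longlonglongrightarrow> f' x"
    proof (rule AE_I2)
      fix x :: "real^'n"
      have "((\<lambda>s. (f (s *\<^sub>R ?e + x) - f x) / s) \<longlongrightarrow> f' x) (at 0)"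
        using der[of x 0] by (simp add: has_field_derivative_iff)
      then show "(\<lambda>n. q n x) \<longlonglongrightarrow> f' x"
        unfolding q_def
      proof (rule tendsto_compose_eventually[OF _ h0])
        show "\<forall>\<^sub>F n in sequentially. h n \<noteq> 0"
          by (intro always_eventually allI) (use h in \<open>metis less_irrefl\<close>)
      qed
    qed
    show "AE x in torus. norm (q n x) \<le> C" for n
    proof (rule AE_I2)
      fix x :: "real^'n" assume "x \<in> space torus"
      then have x: "x \<in> cbox 0 1" by simp
      have "norm x \<le> (\<Sum>j\<in>UNIV. \<bar>x $ j\<bar>)" by (rule norm_le_l1_cart)
      also have "\<dots> \<le> (\<Sum>j\<in>(UNIV :: 'n set). 1)" using x by (intro sum_mono) (auto simp: mem_box_cart)
      finally have nx: "norm x \<le> real CARD('n)" by simp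
      obtain s where s: "0 < s" "s < h n" "f (h n *\<^sub>R ?e + x) - f (0 *\<^sub>R ?e + x) = (h n - 0) * f' (s *\<^sub>R ?e + x)"
        using MVT2[of 0 "h n" "\<lambda>s. f (s *\<^sub>R ?e + x)" "\<lambda>s. f' (s *\<^sub>R ?e + x)"] h[of n] der by blast
      have "norm (s *\<^sub>R ?e + x) \<le> real CARD('n) + 1"
        using norm_triangle_ineq[of "s *\<^sub>R ?e" x] nx s h[of n] by simp
      then have "norm (f' (s *\<^sub>R ?e + x)) \<le> C" by (intro C) auto
      moreover have "q n x = f' (s *\<^sub>R ?e + x)" unfolding q_def using s h[of n] by simp
      ultimately show "norm (q n x) \<le> C" by simp
    qed
  qed (use continuous_imp_torus_measurable qc f' in auto)
  then show ?thesis unfolding q0 by (simp add: LIMSEQ_const_iff)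
qed

section \<open>Lattice frequencies and Hartley functions\<close>

definition Zvec :: "(real^'n) set" where "Zvec = {k. \<forall>i. k $ i \<in> \<int>}"

lemma Zvec_closed [simp, intro]:
  "0 \<in> Zvec" "k \<in> Zvec \<Longrightarrow> - k \<in> Zvec" "k \<in> Zvec \<Longrightarrow> l \<in> Zvec \<Longrightarrow> k + l \<in> Zvec"
  "k \<in> Zvec \<Longrightarrow> l \<in> Zvec \<Longrightarrow> k - l \<in> Zvec"
  unfolding Zvec_def by auto

lemma Zvec_uminus_iff [simp]: "- k \<in> Zvec \<longleftrightarrow> k \<in> Zvec"
  unfolding Zvec_def by auto

lemma Zvec_inner: "k \<in> Zvec \<Longrightarrow> l \<in> Zvec \<Longrightarrow> k \<bullet> l \<in> \<int>"
  unfolding Zvec_def inner_vec_def by auto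

lemma cos_sin_add_2pi_Ints:
  assumes "m \<in> \<int>" shows "cos (x + 2 * pi * m) = cos x" "sin (x + 2 * pi * m) = sin x"
proof -
  obtain n where n: "m = of_int n" using assms by (rule Ints_cases)
  show "cos (x + 2 * pi * m) = cos x" "sin (x + 2 * pi * m) = sin x"
    unfolding n cos_add sin_add using cos_int_2pin[of n] sin_int_2pin[of n] by simp_all
qed

lemma periodic_trig:
  assumes "k \<in> Zvec"
  shows "periodic (\<lambda>x. cos (2 * pi * (k \<bullet> x)))" "periodic (\<lambda>x. sin (2 * pi * (k \<bullet> x)))"
proof -
  have "k \<bullet> l \<in> \<int>" if "\<forall>i. l $ i \<in> \<int>" for l
    using Zvec_inner[OF assms, of l] that by (simp add: Zvec_def)
  then show "periodic (\<lambda>x. cos (2 * pi * (k \<bullet> x)))" "periodic (\<lambda>x. sin (2 * pi * (k \<bullet> x)))"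
    unfolding periodic_def by (auto simp: inner_right_distrib distrib_left cos_sin_add_2pi_Ints)
qed

lemma trig_deriv:
  fixes k x :: "real^'n"
  shows "((\<lambda>s. cos (2 * pi * (k \<bullet> (s *\<^sub>R axis i 1 + x)))) has_real_derivative - (2 * pi * k $ i) * sin (2 * pi * (k \<bullet> (s *\<^sub>R axis i 1 + x)))) (at s)"
    "((\<lambda>s. sin (2 * pi * (k \<bullet> (s *\<^sub>R axis i 1 + x)))) has_real_derivative (2 * pi * k $ i) * cos (2 * pi * (k \<bullet> (s *\<^sub>R axis i 1 + x)))) (at s)"
  unfolding inner_right_distrib inner_scaleR_right inner_axis
  by (auto intro!: derivative_eq_intros)

lemma torus_integral_trig:
  fixes k :: "real^'n"
  assumes k: "k \<in> Zvec"
  shows "(LINT x|torus. cos (2 * pi * (k \<bullet> x))) = (if k = 0 then 1 else 0)"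
    and "(LINT x|torus. sin (2 * pi * (k \<bullet> x))) = 0"
proof -
  have "(LINT x|torus. cos (2 * pi * (k \<bullet> x))) = 0 \<and> (LINT x|torus. sin (2 * pi * (k \<bullet> x))) = 0" if "k \<noteq> 0"
  proof -
    have "\<exists>i. k $ i \<noteq> 0" using that by (auto simp: vec_eq_iff)
    then obtain i where i: "k $ i \<noteq> 0" ..
    have "(LINT x|torus. (2 * pi * k $ i) * cos (2 * pi * (k \<bullet> x))) = 0"
      by (rule torus_integral_deriv_zero[OF periodic_trig(2)[OF k] _ _ trig_deriv(2)]) (intro continuous_intros)+
    moreover have "(LINT x|torus. - (2 * pi * k $ i) * sin (2 * pi * (k \<bullet> x))) = 0"
      by (rule torus_integral_deriv_zero[OF periodic_trig(1)[OF k] _ _ trig_deriv(1)]) (intro continuous_intros)+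
    ultimately show ?thesis using i by simp
  qed
  then show "(LINT x|torus. cos (2 * pi * (k \<bullet> x))) = (if k = 0 then 1 else 0)"
    "(LINT x|torus. sin (2 * pi * (k \<bullet> x))) = 0"
    using torus_measure_1 by (cases "k = 0"; auto)+
qed

definition cas :: "real^'n \<Rightarrow> real^'n \<Rightarrow> real" where
  "cas k x = cos (2 * pi * (k \<bullet> x)) + sin (2 * pi * (k \<bullet> x))"

lemma cas_cont [continuous_intros]: "continuous_on S (cas k)"
  unfolding cas_def[abs_def] by (intro continuous_intros)

lemma cas_periodic: "k \<in> Zvec \<Longrightarrow> periodic (cas k)"
  using periodic_trig[of k] unfolding periodic_def cas_def by auto

lemma cas_bound: "\<bar>cas k x\<bar> \<le> 2"
  unfolding cas_def using abs_cos_le_one[of "2 * pi * (k \<bullet> x)"] abs_sin_le_one[of "2 * pi * (k \<bullet> x)"]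
  by linarith

lemma cas_uminus: "cas (- k) x = cos (2 * pi * (k \<bullet> x)) - sin (2 * pi * (k \<bullet> x))"
  by (simp add: cas_def)

lemma cas_deriv:
  fixes k x :: "real^'n"
  shows "((\<lambda>s. cas k (s *\<^sub>R axis i 1 + x)) has_real_derivative 2 * pi * k $ i * cas (- k) (s *\<^sub>R axis i 1 + x)) (at s)"
  unfolding cas_uminus unfolding cas_def by (rule DERIV_cong[OF DERIV_add[OF trig_deriv]]) (simp add: algebra_simps)

lemma cas_mult: "cas k x * cas l x = cos (2 * pi * ((k - l) \<bullet> x)) + sin (2 * pi * ((k + l) \<bullet> x))"
proof -
  have "2 * pi * ((k - l) \<bullet> x) = 2 * pi * (k \<bullet> x) - 2 * pi * (l \<bullet> x)"
    "2 * pi * ((k + l) \<bullet> x) = 2 * pi * (k \<bullet> x) + 2 * pi * (l \<bullet> x)"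
    by (simp_all add: inner_diff_left inner_add_left algebra_simps)
  then show ?thesis unfolding cas_def cos_diff sin_add by (simp only: cos_diff sin_add) (simp add: algebra_simps)
qed

text \<open>The kernel cos(2 pi m . (x - y)) separates variables when m and -m are used together, so
  convolution with it maps into the span of \<open>cas m\<close> and
  \<open>cas (- m)\<close>.\<close>

lemma cas_cas_sub: "cas m x * cas m y + cas (- m) x * cas (- m) y = 2 * cos (2 * pi * (m \<bullet> (x - y)))"
proof -
  have "2 * pi * (m \<bullet> (x - y)) = 2 * pi * (m \<bullet> x) - 2 * pi * (m \<bullet> y)"
    by (simp add: inner_diff_right algebra_simps)
  then show ?thesis unfolding cas_def by (simp only: cos_diff) (simp add: algebra_simps)
qed

text \<open>In the product formula the sine term has mean zero at every frequency, and the cosine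
  term has a nonzero mean only when its frequency k - l is zero.\<close>

lemma cas_orthonormal:
  assumes "k \<in> Zvec" "l \<in> Zvec"
  shows "(LINT x|torus. cas k x * cas l x) = (if k = l then 1 else 0)"
proof -
  have "(LINT x|torus. cas k x * cas l x) = (LINT x|torus. cos (2 * pi * ((k - l) \<bullet> x))) + (LINT x|torus. sin (2 * pi * ((k + l) \<bullet> x)))"
    unfolding cas_mult by (intro Bochner_Integration.integral_add torus_integrable_cont continuous_intros)
  then show ?thesis using assms by (simp add: torus_integral_trig)
qed

text \<open>First derivatives exchange the frequencies k and -k of the Hartley basis. This is why
  the gradient of the solution is expanded in the functions with negated index.\<close>

lemma torus_ibp_cas:
  fixes f f' :: "real^'n \<Rightarrow> real"
  assumes k: "k \<in> Zvec" and per: "periodic f" and f: "continuous_on UNIV f" and f': "continuous_on UNIV f'"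
    and der: "\<And>x s. ((\<lambda>s. f (s *\<^sub>R axis i 1 + x)) has_real_derivative f' (s *\<^sub>R axis i 1 + x)) (at s)"
  shows "(LINT x|torus. f' x * cas k x) = - (2 * pi * k $ i) * (LINT x|torus. f x * cas (- k) x)"
proof -
  have "(LINT x|torus. f' x * cas k x + f x * (2 * pi * k $ i * cas (- k) x)) = 0"
  proof (rule torus_integral_deriv_zero)
    show "periodic (\<lambda>x. f x * cas k x)" using per cas_periodic[OF k] unfolding periodic_def by auto
    show "((\<lambda>s. f (s *\<^sub>R axis i 1 + x) * cas k (s *\<^sub>R axis i 1 + x)) has_real_derivative
       f' (s *\<^sub>R axis i 1 + x) * cas k (s *\<^sub>R axis i 1 + x) + f (s *\<^sub>R axis i 1 + x) * (2 * pi * k $ i * cas (- k) (s *\<^sub>R axis i 1 + x))) (at s)" for x s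
      by (rule DERIV_cong[OF DERIV_mult[OF der cas_deriv]]) (simp add: algebra_simps)
  qed (intro continuous_intros f f')+
  moreover have "integrable torus (\<lambda>x. f' x * cas k x)" "integrable torus (\<lambda>x. f x * (2 * pi * k $ i * cas (- k) x))"
    by (intro torus_integrable_cont continuous_intros f f')+
  ultimately have "(LINT x|torus. f' x * cas k x) + (LINT x|torus. f x * (2 * pi * k $ i * cas (- k) x)) = 0"
    by simp
  moreover have "(LINT x|torus. f x * (2 * pi * k $ i * cas (- k) x)) = (2 * pi * k $ i) * (LINT x|torus. f x * cas (- k) x)"
    by (subst integral_mult_right_zero[symmetric]) (simp add: mult_ac)
  ultimately show ?thesis by simp
qed

section \<open>A positive trigonometric kernel\<close>

text \<open>Even trigonometric polynomials with lattice frequencies. The inductive form reduces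
  every statement that is linear in the kernel to a single frequency, while closure under products
  gives the powers used for concentration.\<close>

inductive cospoly :: "(real^'n \<Rightarrow> real) \<Rightarrow> bool" where
  base: "m \<in> Zvec \<Longrightarrow> cospoly (\<lambda>z. c * cos (2 * pi * (m \<bullet> z)))"
| add: "cospoly f \<Longrightarrow> cospoly g \<Longrightarrow> cospoly (\<lambda>z. f z + g z)"

lemma cospoly_const: "cospoly (\<lambda>z. c)"
  using cospoly.base[of 0 c] by simp

lemma cospoly_sum:
  assumes "finite I" "\<And>i. i \<in> I \<Longrightarrow> cospoly (f i)"
  shows "cospoly (\<lambda>z. \<Sum>i\<in>I. f i z)"
  using assms by (induction I) (auto intro: cospoly_const cospoly.add)

lemma cospoly_mult:
  assumes "cospoly f" "cospoly g"
  shows "cospoly (\<lambda>z. f z * g z)"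
  using assms(1)
proof induction
  case (base m c)
  show ?case using assms(2)
  proof induction
    case b: (base m' c')
    have "(\<lambda>z. c * cos (2 * pi * (m \<bullet> z)) * (c' * cos (2 * pi * (m' \<bullet> z)))) =
      (\<lambda>z. (c * c' / 2) * cos (2 * pi * ((m + m') \<bullet> z)) + (c * c' / 2) * cos (2 * pi * ((m - m') \<bullet> z)))"
    proof
      fix z
      have "2 * pi * ((m + m') \<bullet> z) = 2 * pi * (m \<bullet> z) + 2 * pi * (m' \<bullet> z)"
        "2 * pi * ((m - m') \<bullet> z) = 2 * pi * (m \<bullet> z) - 2 * pi * (m' \<bullet> z)"
        by (simp_all add: inner_diff_left inner_add_left algebra_simps)
      then show "c * cos (2 * pi * (m \<bullet> z)) * (c' * cos (2 * pi * (m' \<bullet> z))) =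
        (c * c' / 2) * cos (2 * pi * ((m + m') \<bullet> z)) + (c * c' / 2) * cos (2 * pi * ((m - m') \<bullet> z))"
        by (simp only: cos_add cos_diff) (simp add: algebra_simps)
    qed
    then show ?case using base b by (simp only:) (intro cospoly.add cospoly.base; simp)
  next
    case (add f g)
    then show ?case by (simp add: distrib_left cospoly.add)
  qed
next
  case (add f g)
  then show ?case by (simp add: distrib_right cospoly.add)
qed

lemma cospoly_power: "cospoly f \<Longrightarrow> cospoly (\<lambda>z. f z ^ n)"
  by (induction n) (auto intro: cospoly_const cospoly_mult)

lemma cospoly_cont: "cospoly f \<Longrightarrow> continuous_on S f"
  by (induction rule: cospoly.induct) (auto intro!: continuous_intros)

lemma cospoly_diff_cont:
  assumes "cospoly f" shows "continuous_on UNIV (\<lambda>y. f (x - y))"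
  by (rule continuous_on_compose2[OF cospoly_cont[OF assms, of UNIV]]) (auto intro!: continuous_intros)

section \<open>Convolution with even trigonometric polynomials\<close>

lemma conv_base:
  fixes f :: "real^'n \<Rightarrow> real"
  assumes f: "continuous_on UNIV f"
  shows "(LINT y|torus. (c * cos (2 * pi * (m \<bullet> (x - y)))) * f y) =
    c / 2 * (cas m x * (LINT y|torus. f y * cas m y) + cas (- m) x * (LINT y|torus. f y * cas (- m) y))"
proof -
  have i: "integrable torus (\<lambda>y. f y * cas m y)" for m :: "real^'n"
    by (intro torus_integrable_cont continuous_intros f)
  have "(LINT y|torus. (c * cos (2 * pi * (m \<bullet> (x - y)))) * f y) =
    (LINT y|torus. (c / 2 * cas m x) * (f y * cas m y) + (c / 2 * cas (- m) x) * (f y * cas (- m) y))"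
  proof (rule Bochner_Integration.integral_cong[OF refl])
    fix y
    have "c * cos (2 * pi * (m \<bullet> (x - y))) = c / 2 * (cas m x * cas m y + cas (- m) x * cas (- m) y)"
      unfolding cas_cas_sub by simp
    then show "c * cos (2 * pi * (m \<bullet> (x - y))) * f y =
       (c / 2 * cas m x) * (f y * cas m y) + (c / 2 * cas (- m) x) * (f y * cas (- m) y)"
      by (simp add: algebra_simps)
  qed
  also have "\<dots> = (c / 2 * cas m x) * (LINT y|torus. f y * cas m y) + (c / 2 * cas (- m) x) * (LINT y|torus. f y * cas (- m) y)"
    using i[of m] i[of "- m"] by (subst Bochner_Integration.integral_add) auto
  finally show ?thesis by (simp add: algebra_simps)
qed

lemma conv_add:
  fixes f :: "real^'n \<Rightarrow> real"
  assumes "continuous_on UNIV f" "cospoly K" "cospoly L"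
  shows "(LINT y|torus. (K (x - y) + L (x - y)) * f y) = (LINT y|torus. K (x - y) * f y) + (LINT y|torus. L (x - y) * f y)"
  unfolding distrib_right
  by (intro Bochner_Integration.integral_add torus_integrable_cont continuous_intros cospoly_diff_cont assms)

lemma conv_cont:
  fixes f :: "real^'n \<Rightarrow> real"
  assumes K: "cospoly K" and f: "continuous_on UNIV f"
  shows "continuous_on UNIV (\<lambda>x. LINT y|torus. K (x - y) * f y)"
  using K
proof induction
  case (base m c)
  show ?case unfolding conv_base[OF f] by (intro continuous_intros)
next
  case (add g h)
  then show ?case using conv_add[OF f add(1,2)] by (simp add: continuous_on_add)
qed

text \<open>By the addition theorem only the zero frequency has a nonzero mean, so reflecting and
  translating the argument does not change the integral.\<close>

lemma cospoly_integral:
  assumes "cospoly (K :: real^'n \<Rightarrow> real)"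
  shows "(LINT y|torus. K (x - y)) = (LINT y|torus. K y)"
  using assms
proof induction
  case (base m c)
  have [simp]: "integrable torus (\<lambda>y::real^'n. cos (2 * pi * (m \<bullet> y)))"
    by (intro torus_integrable_cont continuous_intros)
  have [simp]: "integrable torus (\<lambda>y::real^'n. sin (2 * pi * (m \<bullet> y)))"
    by (intro torus_integrable_cont continuous_intros)
  have "c * cos (2 * pi * (m \<bullet> (x - y))) = (c * cos (2 * pi * (m \<bullet> x))) * cos (2 * pi * (m \<bullet> y))
     + (c * sin (2 * pi * (m \<bullet> x))) * sin (2 * pi * (m \<bullet> y))" for y
  proof -
    have "2 * pi * (m \<bullet> (x - y)) = 2 * pi * (m \<bullet> x) - 2 * pi * (m \<bullet> y)"
      by (simp add: inner_diff_right algebra_simps)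
    then show ?thesis by (simp only: cos_diff) (simp add: algebra_simps)
  qed
  then have "(LINT y|torus. c * cos (2 * pi * (m \<bullet> (x - y)))) =
    (c * cos (2 * pi * (m \<bullet> x))) * (LINT y|torus. cos (2 * pi * (m \<bullet> y))) + (c * sin (2 * pi * (m \<bullet> x))) * (LINT y|torus. sin (2 * pi * (m \<bullet> y)))"
    by simp
  then show ?case using base by (auto simp: torus_integral_trig)
next
  case (add f g)
  have i: "integrable torus (\<lambda>y. f (x - y))" "integrable torus (\<lambda>y. g (x - y))" "integrable torus f" "integrable torus g"
    by (intro torus_integrable_cont cospoly_diff_cont cospoly_cont add)+
  then show ?case using add by simp
qed

text \<open>Average over the coordinates of (1 + cos(2 pi z_i)) / 2; it lies in [0,1] and equals 1
  exactly on the lattice, so its normalised powers concentrate there.\<close>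

definition bump :: "real^'n \<Rightarrow> real" where
  "bump z = (\<Sum>i\<in>UNIV. 1 + cos (2 * pi * (axis i 1 \<bullet> z))) / (2 * real CARD('n))"

lemma cospoly_bump: "cospoly (bump :: real^'n \<Rightarrow> real)"
proof -
  have ax: "(axis i 1 :: real^'n) \<in> Zvec" for i unfolding Zvec_def axis_def by auto
  have "cospoly (\<lambda>z :: real^'n. (\<Sum>i\<in>UNIV. 1 + 1 * cos (2 * pi * (axis i 1 \<bullet> z))) * (1 / (2 * real CARD('n))))"
    by (intro cospoly_mult cospoly_sum cospoly.intros cospoly_const ax) auto
  then show ?thesis unfolding bump_def[abs_def] by simp
qed

lemma bump_bounds: "0 \<le> bump z" "bump (z :: real^'n) \<le> 1"
proof -
  have "0 \<le> 1 + cos (t::real)" "1 + cos t \<le> 2" for t using cos_ge_minus_one[of t] by (linarith, simp)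
  then show "0 \<le> bump z" unfolding bump_def by (auto intro!: sum_nonneg divide_nonneg_nonneg)
  have "(\<Sum>i\<in>UNIV. 1 + cos (2 * pi * (axis i 1 \<bullet> z))) \<le> (\<Sum>i\<in>(UNIV::'n set). 2)"
    by (intro sum_mono) (simp add: \<open>\<And>t. 1 + cos t \<le> 2\<close>)
  then show "bump z \<le> 1" unfolding bump_def by simp
qed

lemma bump_0: "bump (0 :: real^'n) = 1"
  unfolding bump_def by simp

text \<open>Outside a neighbourhood of the lattice the powers of \<open>bump\<close> decay faster than their integrals.\<close>

lemma bump_concentrated:
  assumes \<delta>: "\<delta> > 0"
  shows "\<exists>q<1. q \<ge> 0 \<and> (\<forall>z :: real^'n. bump z > q \<longrightarrow> (\<exists>k\<in>Zvec. norm (z - k) < \<delta>))"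
proof -
  let ?d = "real CARD('n)"
  have d1: "?d \<ge> 1" using zero_less_card_finite[where 'a='n] by linarith
  \<comment> \<open>The l^1 bound for the norm turns d deviations of size \<delta>' into at most
    \<delta> / 2; the cap 1/4 keeps \<open>2 * pi * \<delta>'\<close> in the range where cosine
    decreases.\<close>
  define \<delta>' where "\<delta>' = min (\<delta> / (2 * ?d)) (1 / 4)"
  have d': "\<delta>' > 0" "\<delta>' \<le> 1/4" "?d * \<delta>' \<le> \<delta> / 2" unfolding \<delta>'_def using \<delta> d1 by (auto simp: min_def field_simps)
  \<comment> \<open>The value of \<open>bump\<close> when one coordinate is at distance \<delta>'
    from the integers and all others are integers.\<close>
  define q where "q = 1 - (1 - cos (2 * pi * \<delta>')) / (2 * ?d)"
  have "cos (2 * pi * \<delta>') < cos 0" using d' by (intro cos_monotone_0_pi) (auto simp: field_simps)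
  then have q1: "q < 1" unfolding q_def using d1 by (auto simp: field_simps)
  have "1 - cos (2 * pi * \<delta>') \<le> 2 * ?d" using d1 cos_ge_minus_one[of "2 * pi * \<delta>'"] by linarith
  then have q0: "q \<ge> 0" unfolding q_def using d1 by (simp add: divide_le_eq)
  have "\<exists>k\<in>Zvec. norm (z - k) < \<delta>" if z: "bump z > q" for z :: "real^'n"
  proof -
    define k where "k = (\<chi> i. real_of_int (round (z $ i)))"
    have k: "k \<in> Zvec" unfolding k_def Zvec_def by simp
    define w where "w = z - k"
    have w: "\<bar>w $ i\<bar> \<le> 1 / 2" for i
      unfolding w_def k_def using of_int_round_abs_le[of "z $ i"] by (simp add: abs_minus_commute)
    have cosw: "cos (2 * pi * (axis i 1 \<bullet> z)) = cos (2 * pi * \<bar>w $ i\<bar>)" for i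
    proof -
      have "axis i 1 \<bullet> z = w $ i + of_int (round (z $ i))"
        unfolding w_def k_def by (simp add: inner_axis')
      then have "cos (2 * pi * (axis i 1 \<bullet> z)) = cos (2 * pi * w $ i)"
        using cos_sin_add_2pi_Ints(1)[of "of_int (round (z $ i))" "2 * pi * w $ i"]
        by (simp add: distrib_left)
      also have "\<dots> = cos (2 * pi * \<bar>w $ i\<bar>)" by (cases "w $ i \<ge> 0") (auto simp: abs_if)
      finally show ?thesis .
    qed
    have "\<bar>w $ i\<bar> < \<delta>'" for i
    proof (rule ccontr)
      assume "\<not> \<bar>w $ i\<bar> < \<delta>'"
      then have "cos (2 * pi * \<bar>w $ i\<bar>) \<le> cos (2 * pi * \<delta>')"
        using d' w[of i] by (intro cos_monotone_0_pi_le) (auto simp: field_simps)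
      moreover have "1 - cos (2 * pi * \<bar>w $ i\<bar>) \<le> (\<Sum>j\<in>UNIV. 1 - cos (2 * pi * \<bar>w $ j\<bar>))"
        by (rule member_le_sum) auto
      moreover have "(\<Sum>j\<in>UNIV. 1 - cos (2 * pi * \<bar>w $ j\<bar>)) = 2 * ?d * (1 - bump z)"
        unfolding bump_def cosw using d1 by (simp add: sum_subtractf sum.distrib field_simps)
      ultimately have "1 - cos (2 * pi * \<delta>') \<le> 2 * ?d * (1 - bump z)" by linarith
      moreover have "1 - cos (2 * pi * \<delta>') = 2 * ?d * (1 - q)" unfolding q_def using d1 by simp
      ultimately have "1 - q \<le> 1 - bump z" using d1 by simp
      then show False using z by simp
    qed
    then have "(\<Sum>i\<in>UNIV. \<bar>w $ i\<bar>) \<le> (\<Sum>i\<in>(UNIV::'n set). \<delta>')" by (intro sum_mono) (simp add: less_imp_le)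
    then have "norm w \<le> ?d * \<delta>'" using norm_le_l1_cart[of w] by simp
    then have "norm w < \<delta>" using d' \<delta> by linarith
    then show ?thesis using k unfolding w_def by blast
  qed
  then show ?thesis using q0 q1 by blast
qed

text \<open>By continuity \<open>bump\<close> is at least q on a small cube at the origin, and the
  volume of that cube serves as c for every n.\<close>

lemma bump_integral_lower:
  assumes "q < 1" "q \<ge> 0"
  shows "\<exists>c>0. \<forall>n. c * q ^ n \<le> (LINT y|torus. bump (y :: real^'n) ^ n)"
proof -
  let ?d = "real CARD('n)"
  have d1: "?d \<ge> 1" using zero_less_card_finite[where 'a='n] by linarith
  have bc: "continuous_on UNIV (bump :: real^'n \<Rightarrow> real)" by (rule cospoly_cont[OF cospoly_bump])
  have "\<exists>d>0. \<forall>y. dist y (0 :: real^'n) < d \<longrightarrow> dist (bump y) (bump (0 :: real^'n)) < 1 - q"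
    using spec[OF bspec[OF bc[unfolded continuous_on_iff] UNIV_I[of 0]], of "1 - q"] assms by simp
  then obtain d where d: "d > 0" "\<And>y :: real^'n. dist y 0 < d \<Longrightarrow> dist (bump y) (bump (0 :: real^'n)) < 1 - q"
    by blast
  define \<eta> where "\<eta> = min 1 (d / (2 * ?d))"
  have eta: "\<eta> > 0" "\<eta> \<le> 1" "?d * \<eta> < d" 
  proof -
    show "\<eta> > 0" "\<eta> \<le> 1" unfolding \<eta>_def using d d1 by auto
    have "?d * \<eta> \<le> ?d * (d / (2 * ?d))" unfolding \<eta>_def using d1 by (intro mult_left_mono) auto
    also have "\<dots> < d" using d d1 by simp
    finally show "?d * \<eta> < d" .
  qed
  have big: "bump y \<ge> q" if "y \<in> cbox 0 (\<chi> i. \<eta>)" for y :: "real^'n"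
  proof -
    have "norm y \<le> (\<Sum>j\<in>UNIV. \<bar>y $ j\<bar>)" by (rule norm_le_l1_cart)
    also have "\<dots> \<le> (\<Sum>j\<in>(UNIV :: 'n set). \<eta>)" using that by (intro sum_mono) (auto simp: mem_box_cart)
    finally have "norm y < d" using eta by simp
    then show ?thesis using d(2)[of y] by (simp add: bump_0 dist_real_def) 
  qed
  have sub: "cbox 0 (\<chi> i. \<eta>) \<subseteq> cbox 0 (1 :: real^'n)"
    using eta by (auto simp: mem_box_cart) (meson order_trans)
  define c where "c = Sigma_Algebra.measure lborel (cbox 0 (\<chi> i. \<eta>) :: (real^'n) set)"
  have "c = (\<Prod>b\<in>Basis. ((\<chi> i. \<eta>) :: real^'n) \<bullet> b - 0 \<bullet> b)"
    unfolding c_def by (rule content_cbox) (use eta in \<open>auto simp: Basis_vec_def inner_axis\<close>)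
  also have "\<dots> > 0" using eta by (intro prod_pos) (auto simp: Basis_vec_def inner_axis)
  finally have c: "c > 0" .
  have "c * q ^ n \<le> (LINT y|torus. bump (y :: real^'n) ^ n)" for n
  proof -
    have bn: "continuous_on UNIV (\<lambda>y :: real^'n. bump y ^ n)" by (intro continuous_intros cospoly_cont cospoly_bump)
    have "c * q ^ n = (LINT y|lborel. indicat_real (cbox 0 (\<chi> i. \<eta>)) (y :: real^'n) * q ^ n)"
      unfolding c_def by simp
    also have "\<dots> \<le> (LINT y|lborel. indicat_real (cbox 0 1) (y :: real^'n) * bump y ^ n)"
    proof (rule integral_mono)
      show "integrable lborel (\<lambda>y :: real^'n. indicat_real (cbox 0 (\<chi> i. \<eta>)) y * q ^ n)"
        by (intro integrable_mult_left integrable_real_indicator emeasure_lborel_cbox_finite) auto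
      show "integrable lborel (\<lambda>y :: real^'n. indicat_real (cbox 0 1) y * bump y ^ n)"
        using borel_integrable_compact[OF compact_cbox continuous_on_subset[OF bn subset_UNIV]] by simp
      show "indicat_real (cbox 0 (\<chi> i. \<eta>)) y * q ^ n \<le> indicat_real (cbox 0 1) y * bump y ^ n" for y :: "real^'n"
        using big[of y] sub assms bump_bounds[of y] by (auto simp: indicator_def intro!: power_mono)
    qed
    also have "\<dots> = (LINT y|torus. bump (y :: real^'n) ^ n)"
      using bn by (intro torus_integral_lborel[symmetric] borel_measurable_continuous_onI)
    finally show ?thesis .
  qed
  then show ?thesis using c by blast
qed

text \<open>Normalised powers of \<open>bump\<close>. Nonnegativity and unit mass give bounds
  uniform in n, and membership in \<open>cospoly\<close> keeps the convolutions inside the span of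
  the modes.\<close>

lemma fejer_kernel:
  obtains K :: "nat \<Rightarrow> real^'n \<Rightarrow> real" where "\<And>n. cospoly (K n)" "\<And>n z. K n z \<ge> 0"
    "\<And>n x. (LINT y|torus. K n (x - y)) = 1"
    "\<And>f x. continuous_on UNIV f \<Longrightarrow> periodic f \<Longrightarrow> (\<lambda>n. LINT y|torus. K n (x - y) * f y) \<longlonglongrightarrow> f x"
proof -
  define c where "c n = (LINT y|torus. bump (y :: real^'n) ^ n)" for n
  have c0: "c n > 0" for n
  proof -
    obtain a where a: "a > 0" "\<And>n. a * (1/2) ^ n \<le> c n"
      using bump_integral_lower[of "1/2", where 'n='n] unfolding c_def by auto
    then have "0 < a * (1/2) ^ n" by simp
    then show ?thesis using a(2)[of n] by linarith
  qed
  define K where "K n z = bump z ^ n * (1 / c n)" for n and z :: "real^'n"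
  have K: "cospoly (K n)" for n unfolding K_def[abs_def]
    by (intro cospoly_mult cospoly_power cospoly_bump cospoly_const)
  have K0: "K n z \<ge> 0" for n z unfolding K_def using bump_bounds(1)[of z] c0[of n] by simp
  have K1: "(LINT y|torus. K n (x - y)) = 1" for n x
    unfolding cospoly_integral[OF K] using c0[of n] unfolding K_def c_def by simp
  have Ki: "integrable torus (\<lambda>y. K n (x - y))" for n x
    by (intro torus_integrable_cont cospoly_diff_cont K)
  have "(\<lambda>n. LINT y|torus. K n (x - y) * f y) \<longlonglongrightarrow> f x"
    if f: "continuous_on UNIV f" and per: "periodic f" for f x
  proof (rule LIMSEQ_I)
    fix e :: real assume e: "e > 0"
    obtain C where C: "C \<ge> 0" "\<And>x. x \<in> cbox 0 1 \<Longrightarrow> norm (f x) \<le> C" using torus_bounded[OF f] by blast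
    define D where "D = C + \<bar>f x\<bar>"
    have D0: "D \<ge> 0" unfolding D_def using C by simp
    have "\<exists>\<delta>>0. \<forall>y \<in> UNIV. dist y x < \<delta> \<longrightarrow> dist (f y) (f x) < e / 2"
      using spec[OF bspec[OF f[unfolded continuous_on_iff] UNIV_I[of x]], of "e / 2"] e by simp
    then obtain \<delta> where \<delta>: "\<delta> > 0" "\<And>y. dist y x < \<delta> \<Longrightarrow> dist (f y) (f x) < e / 2"
      by blast
    obtain q where q: "q < 1" "q \<ge> 0" "\<And>z :: real^'n. bump z > q \<Longrightarrow> \<exists>k\<in>Zvec. norm (z - k) < \<delta>"
      using bump_concentrated[OF \<delta>(1), where 'n='n] by blast
    \<comment> \<open>The gap between q and q' is decisive: away from the lattice the kernel is at
      most \<open>q ^ n / c n\<close>, while \<open>c n \<ge> a * q' ^ n\<close>, so the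
      contribution there decays like \<open>(q / q') ^ n\<close>.\<close>
    obtain q' where q': "q < q'" "q' < 1" using q(1) dense by blast
    obtain a where a: "a > 0" "\<And>n. a * q' ^ n \<le> c n"
      using bump_integral_lower[of q', where 'n='n] q q' unfolding c_def by auto
    have close: "\<bar>f y - f x\<bar> < e / 2" if b: "bump (x - y) > q" for y
    proof -
      obtain k where k: "k \<in> Zvec" "norm (x - y - k) < \<delta>" using q(3)[OF b] by blast
      have "f (y + k) = f y" using per k(1) unfolding periodic_def Zvec_def by blast
      moreover have "dist (y + k) x < \<delta>" using k(2) by (simp add: dist_norm norm_minus_commute algebra_simps)
      ultimately show ?thesis using \<delta>(2)[of "y + k"] by (simp add: dist_real_def)
    qed
    have pt: "\<bar>K n (x - y) * (f y - f x)\<bar> \<le> (e / 2) * K n (x - y) + D * (q ^ n / c n)" if y: "y \<in> cbox 0 1" for n y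
    proof (cases "bump (x - y) > q")
      case True
      have "\<bar>K n (x - y) * (f y - f x)\<bar> \<le> K n (x - y) * (e / 2)"
        unfolding abs_mult abs_of_nonneg[OF K0] by (rule mult_left_mono[OF less_imp_le[OF close[OF True]] K0])
      moreover have "0 \<le> D * (q ^ n / c n)" using D0 q c0[of n] by simp
      ultimately show ?thesis by (simp add: mult.commute)
    next
      case False
      have "K n (x - y) \<le> q ^ n / c n"
        unfolding K_def using False c0[of n] bump_bounds(1)[of "x - y"] by (auto simp: field_simps intro!: power_mono)
      moreover have "\<bar>f y - f x\<bar> \<le> D" unfolding D_def using C(2)[OF y] by auto
      ultimately have "\<bar>K n (x - y) * (f y - f x)\<bar> \<le> (q ^ n / c n) * D"
        unfolding abs_mult using K0[of n "x - y"] by (intro mult_mono) auto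
      moreover have "0 \<le> (e / 2) * K n (x - y)" using e K0[of n "x - y"] by simp
      ultimately show ?thesis by (simp add: mult.commute)
    qed
    have bound: "\<bar>(LINT y|torus. K n (x - y) * f y) - f x\<bar> \<le> e / 2 + D * (q ^ n / c n)" for n
    proof -
      have i: "integrable torus (\<lambda>y. K n (x - y) * f y)"
        by (intro torus_integrable_cont continuous_intros cospoly_diff_cont K f)
      have i2: "integrable torus (\<lambda>y. K n (x - y) * (f y - f x))"
        by (intro torus_integrable_cont continuous_intros cospoly_diff_cont K f)
      have "(LINT y|torus. K n (x - y) * f y) - f x = (LINT y|torus. K n (x - y) * f y) - (LINT y|torus. K n (x - y) * f x)"
        using K1[of n x] by simp
      also have "\<dots> = (LINT y|torus. K n (x - y) * (f y - f x))"
        using i Ki[of n x] by (simp add: right_diff_distrib)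
      also have "\<bar>\<dots>\<bar> \<le> (LINT y|torus. \<bar>K n (x - y) * (f y - f x)\<bar>)"
        by (rule integral_abs_bound)
      also have "\<dots> \<le> (LINT y|torus. (e / 2) * K n (x - y) + D * (q ^ n / c n))"
        using pt Ki[of n x] i2 by (intro integral_mono) auto
      also have "\<dots> = e / 2 + D * (q ^ n / c n)"
      proof -
        have "(LINT y|torus. (e / 2) * K n (x - y) + D * (q ^ n / c n)) =
           (e / 2) * (LINT y|torus. K n (x - y)) + (D * (q ^ n / c n)) * (LINT y|(torus :: (real^'n) measure). 1)"
          using Ki[of n x] by (subst Bochner_Integration.integral_add) auto
        then show ?thesis unfolding K1 torus_measure_1 by simp
      qed
      finally show ?thesis .
    qed
    have "(\<lambda>n. D * ((q / q') ^ n / a)) \<longlonglongrightarrow> D * (0 / a)"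
      using q q' a by (intro tendsto_intros LIMSEQ_power_zero) (auto simp: field_simps)
    then have "(\<lambda>n. D * ((q / q') ^ n / a)) \<longlonglongrightarrow> 0" by simp
    then obtain N where N: "\<And>n. n \<ge> N \<Longrightarrow> norm (D * ((q / q') ^ n / a) - 0) < e / 2"
      using LIMSEQ_D[of _ 0 "e / 2"] e by (metis half_gt_zero)
    show "\<exists>no. \<forall>n\<ge>no. norm ((LINT y|torus. K n (x - y) * f y) - f x) < e"
    proof (intro exI allI impI)
      fix n assume "n \<ge> N"
      from N[OF this] have "D * ((q / q') ^ n / a) < e / 2" unfolding real_norm_def by linarith
      moreover have "q ^ n / c n \<le> q ^ n / (a * q' ^ n)"
        using a q q' c0[of n] by (intro divide_left_mono) auto
      then have "D * (q ^ n / c n) \<le> D * ((q / q') ^ n / a)"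
        using D0 by (intro mult_left_mono) (auto simp: power_divide field_simps)
      ultimately show "norm ((LINT y|torus. K n (x - y) * f y) - f x) < e"
        using bound[of n] unfolding real_norm_def by linarith
    qed
  qed
  then show thesis by (rule that[of K, OF K K0 K1])
qed

text \<open>Convolution with a nonnegative kernel of unit mass is an average. This provides the
  majorants, independent of the kernel, for all later limit passages.\<close>

lemma conv_bound:
  fixes f :: "real^'n \<Rightarrow> real"
  assumes "cospoly K" "\<And>z. K z \<ge> 0" "\<And>x. (LINT y|torus. K (x - y)) = 1" "continuous_on UNIV f"
    "\<And>y. y \<in> cbox 0 1 \<Longrightarrow> \<bar>f y\<bar> \<le> C"
  shows "\<bar>LINT y|torus. K (x - y) * f y\<bar> \<le> C"
proof -
  have "\<bar>LINT y|torus. K (x - y) * f y\<bar> \<le> (LINT y|torus. \<bar>K (x - y) * f y\<bar>)"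
    by (rule integral_abs_bound)
  also have "\<dots> \<le> (LINT y|torus. K (x - y) * C)"
  proof (rule integral_mono)
    show "integrable torus (\<lambda>y. \<bar>K (x - y) * f y\<bar>)" "integrable torus (\<lambda>y. K (x - y) * C)"
      by (intro torus_integrable_cont continuous_intros cospoly_diff_cont assms)+
    show "\<bar>K (x - y) * f y\<bar> \<le> K (x - y) * C" if "y \<in> space torus" for y
      using assms(2)[of "x - y"] assms(5)[of y] that by (auto simp: abs_mult intro!: mult_left_mono)
  qed
  also have "\<dots> = C" using assms(3)[of x] by simp
  finally show ?thesis .
qed

lemma conv_orthogonal:
  fixes f h :: "real^'n \<Rightarrow> real"
  assumes K: "cospoly K" and h: "integrable torus h" and orth: "\<And>m. m \<in> Zvec \<Longrightarrow> (LINT x|torus. h x * cas m x) = 0"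
    and f: "continuous_on UNIV f"
  shows "(LINT x|torus. h x * (LINT y|torus. K (x - y) * f y)) = 0"
  using K
proof induction
  case (base m c)
  define p q where "p = c / 2 * (LINT y|torus. f y * cas m y)" and "q = c / 2 * (LINT y|torus. f y * cas (- m) y)"
  have [simp]: "integrable torus (\<lambda>x. h x * cas m x)" for m
    by (intro torus_integrable_mult_cont h continuous_intros)
  have "(LINT x|torus. h x * (LINT y|torus. (c * cos (2 * pi * (m \<bullet> (x - y)))) * f y)) =
     (LINT x|torus. p * (h x * cas m x) + q * (h x * cas (- m) x))"
    unfolding conv_base[OF f] p_def q_def by (intro Bochner_Integration.integral_cong refl) (simp add: algebra_simps)
  also have "\<dots> = 0" using orth base by simp
  finally show ?case .
next
  case (add K L)
  have "integrable torus (\<lambda>x. h x * (LINT y|torus. K (x - y) * f y))" "integrable torus (\<lambda>x. h x * (LINT y|torus. L (x - y) * f y))"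
    by (intro torus_integrable_mult_cont h conv_cont add f)+
  then show ?case using add by (simp add: conv_add[OF f add(1,2)] distrib_left)
qed

text \<open>The convolutions of \<open>f\<close> are combinations of modes and hence orthogonal to
  \<open>h\<close>. As \<open>h\<close> is only integrable, the limit is taken by dominated
  convergence with a uniform bound on the convolutions.\<close>

lemma orthogonal_continuous:
  fixes f h :: "real^'n \<Rightarrow> real"
  assumes h: "integrable torus h" and orth: "\<And>m. m \<in> Zvec \<Longrightarrow> (LINT x|torus. h x * cas m x) = 0"
    and f: "continuous_on UNIV f" "periodic f"
  shows "(LINT x|torus. h x * f x) = 0"
proof -
  obtain K :: "nat \<Rightarrow> real^'n \<Rightarrow> real" where K: "\<And>n. cospoly (K n)" "\<And>n z. K n z \<ge> 0"
    "\<And>n x. (LINT y|torus. K n (x - y)) = 1"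
    "\<And>f x. continuous_on UNIV f \<Longrightarrow> periodic f \<Longrightarrow> (\<lambda>n. LINT y|torus. K n (x - y) * f y) \<longlonglongrightarrow> f x"
    using fejer_kernel by blast
  obtain C where C: "C \<ge> 0" "\<And>x. x \<in> cbox 0 1 \<Longrightarrow> norm (f x) \<le> C" using torus_bounded[OF f(1)] by blast
  have "(\<lambda>n. LINT x|torus. h x * (LINT y|torus. K n (x - y) * f y)) \<longlonglongrightarrow> (LINT x|torus. h x * f x)"
  proof (rule integral_dominated_convergence[where w="\<lambda>x. \<bar>h x\<bar> * C"])
    show "AE x in torus. (\<lambda>n. h x * (LINT y|torus. K n (x - y) * f y)) \<longlonglongrightarrow> h x * f x"
      by (intro AE_I2 tendsto_intros K f)
    show "AE x in torus. norm (h x * (LINT y|torus. K n (x - y) * f y)) \<le> \<bar>h x\<bar> * C" for n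
      using conv_bound[OF K(1,2,3) f(1), of C] C(2) by (intro AE_I2) (auto simp: abs_mult intro!: mult_left_mono)
    show "(\<lambda>x. h x * f x) \<in> borel_measurable torus" using torus_integrable_mult_cont[OF h f(1)] by blast
    show "(\<lambda>x. h x * (LINT y|torus. K n (x - y) * f y)) \<in> borel_measurable torus" for n
      using torus_integrable_mult_cont[OF h conv_cont[OF K(1) f(1)]] by blast
    show "integrable torus (\<lambda>x. \<bar>h x\<bar> * C)" using h by simp
  qed
  then show ?thesis by (simp add: conv_orthogonal[OF K(1) h orth f(1)] LIMSEQ_const_iff)
qed

section \<open>Completeness of the Hartley basis\<close>

text \<open>Dynkin's argument: boxes are stable under intersection and generate the Borel sets. The
  complement step needs the integral over the whole space to vanish, which is shown beforehand by
  exhausting the space with boxes.\<close>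

lemma integrable_zero_boxes:
  fixes g :: "'a::euclidean_space \<Rightarrow> real"
  assumes g: "integrable lborel g" and box0: "\<And>a b. (LINT x|lborel. indicat_real (box a b) x * g x) = 0"
  shows "AE x in lborel. g x = 0"
proof (rule sigma_finite_measure.density_zero[OF lborel.sigma_finite_measure_axioms g])
  have tot: "(LINT x|lborel. g x) = 0"
  proof -
    have "(\<lambda>n. LINT x|lborel. indicat_real (box (- real n *\<^sub>R One) (real n *\<^sub>R One)) x * g x) \<longlonglongrightarrow> (LINT x|lborel. g x)"
    proof (rule integral_dominated_convergence[where w="\<lambda>x. \<bar>g x\<bar>"])
      show "AE x in lborel. (\<lambda>n. indicat_real (box (- real n *\<^sub>R One) (real n *\<^sub>R One)) x * g x) \<longlonglongrightarrow> g x"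
      proof (rule AE_I2, rule tendsto_eventually)
        fix x :: 'a
        obtain N :: nat where N: "norm x < N" using reals_Archimedean2 by blast
        show "\<forall>\<^sub>F n in sequentially. indicat_real (box (- real n *\<^sub>R One) (real n *\<^sub>R One)) x * g x = g x"
          unfolding eventually_sequentially
        proof (intro exI[of _ N] allI impI)
          fix n assume "N \<le> n"
          then have "\<bar>x \<bullet> i\<bar> < real n" if "i \<in> Basis" for i using Basis_le_norm[OF that, of x] N by linarith
          then have "x \<in> box (- real n *\<^sub>R One) (real n *\<^sub>R One)"
            by (auto simp: mem_box abs_less_iff inner_Basis) (metis minus_less_iff)
          then show "indicat_real (box (- real n *\<^sub>R One) (real n *\<^sub>R One)) x * g x = g x" by simp
        qed
      qed
      show "AE x in lborel. norm (indicat_real (box (- real n *\<^sub>R One) (real n *\<^sub>R One)) x * g x) \<le> \<bar>g x\<bar>" for n :: nat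
        by (intro AE_I2) (auto simp: indicator_def)
    qed (use g in auto)
    then show ?thesis by (simp add: box0 LIMSEQ_const_iff)
  qed
  fix A :: "'a set" assume "A \<in> sets lborel"
  then have A: "A \<in> sigma_sets UNIV (range (\<lambda>(a, b). box a b))"
    by (simp add: borel_eq_box sets_measure_of)
  have sets: "B \<in> sets borel" if "B \<in> sigma_sets UNIV (range (\<lambda>(a, b). box a b))" for B :: "'a set"
    using that by (simp add: borel_eq_box sets_measure_of)
  have stable: "Int_stable (range (\<lambda>(a, b). box a b :: 'a set))"
    by (auto simp: Int_stable_def box_Int_box)
  have pow: "range (\<lambda>(a, b). box a b :: 'a set) \<subseteq> Pow UNIV" by simp
  show "set_lebesgue_integral lborel A g = 0"
    using stable pow A
  proof (induction A rule: sigma_sets_induct_disjoint)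
    case (basic A)
    then show ?case using box0 by (auto simp: set_lebesgue_integral_def)
  next
    case empty
    then show ?case by (simp add: set_lebesgue_integral_def)
  next
    case (compl A)
    have i: "integrable lborel (\<lambda>x. indicat_real A x * g x)"
      using integrable_mult_indicator[OF _ g, of A] sets[OF compl(1)] by simp
    have "set_lebesgue_integral lborel (UNIV - A) g = (LINT x|lborel. g x - indicat_real A x * g x)"
      unfolding set_lebesgue_integral_def by (intro Bochner_Integration.integral_cong) (auto simp: indicator_def)
    also have "\<dots> = 0" using g i tot compl unfolding set_lebesgue_integral_def by simp
    finally show ?case .
  next
    case (union A)
    have Ai: "A i \<in> sets lborel" for i using union(2) by (simp, intro sets) blast
    have "set_integrable lborel (\<Union>i. A i) g"
      unfolding set_integrable_def
      by (intro integrable_mult_indicator g) (use Ai in auto)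
    then have "set_lebesgue_integral lborel (\<Union>i. A i) g = (\<Sum>i. set_lebesgue_integral lborel (A i) g)"
      using union(1) by (intro lebesgue_integral_countable_add Ai) (auto simp: disjoint_family_on_def)
    then show ?case using union by simp
  qed
qed

lemma cos_pi_less: "0 \<le> r \<Longrightarrow> r < s \<Longrightarrow> s \<le> 1 \<Longrightarrow> cos (pi * s) < cos (pi * r)"
  by (intro cos_monotone_0_pi) auto

text \<open>A continuous function of period 1 that approximates the indicator: a point of [0,1] lies
  in the interval exactly when the cosine centred at the midpoint exceeds its value at the
  endpoints. Multiplying the excess by n and clamping it to [0,1] gives the limit.\<close>

lemma box_indicator_limit:
  fixes a b x :: real
  assumes "0 \<le> a" "a < b" "b \<le> 1" "0 \<le> x" "x \<le> 1"
  shows "(\<lambda>n. max 0 (min 1 (real n * (cos (2 * pi * (x - (a + b) / 2)) - cos (pi * (b - a)))))) \<longlonglongrightarrow> indicat_real {a<..<b} x"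
proof -
  define u where "u = \<bar>x - (a + b) / 2\<bar>"
  have cu: "cos (2 * pi * (x - (a + b) / 2)) = cos (2 * pi * u)"
  proof -
    have "2 * pi * u = \<bar>2 * pi * (x - (a + b) / 2)\<bar>" unfolding u_def by (simp add: abs_mult)
    then show ?thesis by (simp only: cos_abs_real)
  qed
  have u0: "u \<ge> 0" unfolding u_def by simp
  show ?thesis
  proof (cases "u < (b - a) / 2")
    case True
    then have ind: "indicat_real {a<..<b} x = 1" proof -
      have "a < x" "x < b" using True unfolding u_def by (auto simp: abs_if field_simps split: if_splits)
      then show ?thesis by simp
    qed
    have "cos (pi * (b - a)) < cos (2 * pi * u)"
      using cos_pi_less[of "2 * u" "b - a"] True u0 assms by (simp add: mult_ac)
    then have q: "cos (2 * pi * u) - cos (pi * (b - a)) > 0" (is "?q > 0") by simp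
    obtain N :: nat where N: "1 / ?q < N" using reals_Archimedean2 by blast
    show ?thesis unfolding ind cu
    proof (rule tendsto_eventually, unfold eventually_sequentially, intro exI[of _ N] allI impI)
      fix n assume "N \<le> n"
      then have "1 / ?q \<le> real n" using N by linarith
      then have "1 \<le> real n * ?q" using q by (simp add: divide_le_eq)
      then show "max 0 (min 1 (real n * ?q)) = 1" by simp
    qed
  next
    case False
    then have ind: "indicat_real {a<..<b} x = 0" unfolding u_def indicator_def
      by (auto simp: abs_if field_simps split: if_splits)
    have u1: "u \<le> 1 - (b - a) / 2" unfolding u_def using assms by (auto simp: abs_le_iff field_simps)
    have "cos (2 * pi * u) \<le> cos (pi * (b - a))"
    proof (cases "u \<le> 1 / 2")
      case True
      then show ?thesis using cos_pi_less[of "b - a" "2 * u"] False assms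
        by (cases "2 * u = b - a") (auto simp: mult_ac)
    next
      \<comment> \<open>Beyond half a period the point is closer to the next copy of the midpoint,
        at distance 1 - u; \<open>0 \<le> a\<close> and \<open>b \<le> 1\<close> keep this distance
        at least half the length.\<close>
      case g: False
      have "cos (2 * pi * u) = cos (2 * pi * (1 - u))"
        using cos_2pi_minus[of "2 * pi * u"] by (simp add: right_diff_distrib)
      also have "\<dots> \<le> cos (pi * (b - a))"
      proof -
        have "b - a \<le> 2 * (1 - u)" "2 * (1 - u) \<le> 1" "0 \<le> b - a" using g u1 assms by (auto simp: field_simps)
        then have "cos (pi * (2 * (1 - u))) \<le> cos (pi * (b - a))"
          using cos_pi_less[of "b - a" "2 * (1 - u)"] by (cases "2 * (1 - u) = b - a") auto
        then show ?thesis by (simp add: mult_ac)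
      qed
      finally show ?thesis .
    qed
    note le = this
    have "max 0 (min 1 (real n * (cos (2 * pi * u) - cos (pi * (b - a))))) = 0" for n
    proof -
      from le have "real n * (cos (2 * pi * u) - cos (pi * (b - a))) \<le> 0" by (intro mult_nonneg_nonpos) auto
      then show ?thesis by simp
    qed
    then show ?thesis unfolding ind cu by simp
  qed
qed

lemma torus_orthogonal_box:
  fixes h :: "real^'n \<Rightarrow> real"
  assumes h: "integrable torus h" and orth: "\<And>m. m \<in> Zvec \<Longrightarrow> (LINT x|torus. h x * cas m x) = 0"
    and ab: "\<And>i. 0 \<le> a $ i" "\<And>i. a $ i < b $ i" "\<And>i. b $ i \<le> 1"
  shows "(LINT x|torus. indicat_real (box a b) x * h x) = 0"
proof -
  define p where "p n x = (\<Prod>i\<in>UNIV. max 0 (min 1 (real n * (cos (2 * pi * (axis i 1 \<bullet> (x - (1/2) *\<^sub>R (a + b)))) - cos (pi * (b $ i - a $ i))))))"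
    for n :: nat and x :: "real^'n"
  have p_cont: "continuous_on UNIV (p n)" for n unfolding p_def[abs_def] by (intro continuous_intros)
  have p_per: "periodic (p n)" for n
  proof -
    have ax: "(axis i 1 :: real^'n) \<in> Zvec" for i unfolding Zvec_def axis_def by auto
    have "cos (2 * pi * (axis i 1 \<bullet> (x + k - c))) = cos (2 * pi * (axis i 1 \<bullet> (x - c)))"
      if "\<forall>i. k $ i \<in> \<int>" for k x c :: "real^'n" and i
    proof -
      have "cos (2 * pi * (axis i 1 \<bullet> ((x - c) + k))) = cos (2 * pi * (axis i 1 \<bullet> (x - c)))"
        using periodic_trig(1)[OF ax, of i] that unfolding periodic_def by blast
      moreover have "(x - c) + k = x + k - c" by simp
      ultimately show ?thesis by simp
    qed
    then show ?thesis unfolding periodic_def p_def by simp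
  qed
  have p01: "0 \<le> p n x" "p n x \<le> 1" for n x unfolding p_def by (auto intro!: prod_nonneg prod_le_1)
  have p_lim: "(\<lambda>n. p n x) \<longlonglongrightarrow> indicat_real (box a b) x" if x: "x \<in> cbox 0 1" for x
  proof -
    have "(\<lambda>n. p n x) \<longlonglongrightarrow> (\<Prod>i\<in>UNIV. indicat_real {a $ i<..<b $ i} (x $ i))"
      unfolding p_def
    proof (rule tendsto_prod)
      fix i
      have "axis i 1 \<bullet> (x - (1/2) *\<^sub>R (a + b)) = x $ i - (a $ i + b $ i) / 2"
        by (simp add: inner_axis')
      then show "(\<lambda>n. max 0 (min 1 (real n * (cos (2 * pi * (axis i 1 \<bullet> (x - (1/2) *\<^sub>R (a + b)))) - cos (pi * (b $ i - a $ i)))))) \<longlonglongrightarrow> indicat_real {a $ i<..<b $ i} (x $ i)"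
        using box_indicator_limit[OF ab(1)[of i] ab(2)[of i] ab(3)[of i], of "x $ i"] x by (simp add: mem_box_cart)
    qed
    also have "(\<Prod>i\<in>UNIV. indicat_real {a $ i<..<b $ i} (x $ i)) = indicat_real (box a b) x"
      by (auto simp: indicator_def mem_box_cart prod_zero_iff)
    finally show ?thesis .
  qed
  have "(\<lambda>n. LINT x|torus. h x * p n x) \<longlonglongrightarrow> (LINT x|torus. indicat_real (box a b) x * h x)"
  proof (rule integral_dominated_convergence[where w="\<lambda>x. \<bar>h x\<bar>"])
    show "AE x in torus. (\<lambda>n. h x * p n x) \<longlonglongrightarrow> indicat_real (box a b) x * h x"
      by (rule AE_I2, subst mult.commute) (intro tendsto_intros p_lim, simp)
    show "AE x in torus. norm (h x * p n x) \<le> \<bar>h x\<bar>" for n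
      using p01 by (intro AE_I2) (auto simp: abs_mult intro!: mult_left_le)
    show "(\<lambda>x. h x * p n x) \<in> borel_measurable torus" for n
      using torus_integrable_mult_cont[OF h p_cont] by blast
    have "(\<lambda>x. indicat_real (box a b) x) \<in> borel_measurable torus"
      unfolding torus_def by (intro measurable_restrict_space1 measurable_completion) simp
    then show "(\<lambda>x. indicat_real (box a b) x * h x) \<in> borel_measurable torus"
      using h by (intro borel_measurable_times) auto
  qed (use h in auto)
  then show ?thesis by (simp add: orthogonal_continuous[OF h orth p_cont p_per] LIMSEQ_const_iff)
qed

lemma AE_torus_iff:
  "(AE x in torus. P x) \<longleftrightarrow> (AE x in lborel. x \<in> cbox 0 (1::real^'n) \<longrightarrow> P x)"
  unfolding torus_def by (subst AE_restrict_space_iff) (auto simp: AE_completion_iff)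

text \<open>Continuous periodic functions approximate indicators of boxes, and an integrable
  function with vanishing box integrals is zero. A Borel representative of the extension by zero is
  used, because \<open>h\<close> is only Lebesgue measurable while the box argument takes place on
  \<open>lborel\<close>.\<close>

theorem torus_orthogonal_zero:
  fixes h :: "real^'n \<Rightarrow> real"
  assumes h: "integrable torus h" and orth: "\<And>m. m \<in> Zvec \<Longrightarrow> (LINT x|torus. h x * cas m x) = 0"
  shows "AE x in torus. h x = 0"
proof -
  have box0: "(LINT x|torus. indicat_real (box a b) x * h x) = 0" for a b
  proof -
    \<comment> \<open>In the interior of the cube a box and its clipped version agree, and the faces
      are null sets. If a side of the clipped box degenerates, the box is empty.\<close>
    define a' where "a' = (\<chi> i. max 0 (a $ i))"
    define b' where "b' = (\<chi> i. min 1 (b $ i))"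
    have im: "(\<lambda>x. indicat_real (box a b) x * h x) \<in> borel_measurable torus" for a b
    proof -
      have "(\<lambda>x. indicat_real (box a b) x) \<in> borel_measurable torus"
        unfolding torus_def by (intro measurable_restrict_space1 measurable_completion) simp
      then show ?thesis using h by (intro borel_measurable_times) auto
    qed
    have "AE x in lborel. \<forall>i. (x :: real^'n) $ i \<noteq> 0 \<and> x $ i \<noteq> 1"
      unfolding AE_all_countable using AE_not_hyperplane by (auto intro: AE_conjI)
    then have "AE x in torus. indicat_real (box a b) x * h x = indicat_real (box a' b') x * h x"
      unfolding AE_torus_iff
    proof eventually_elim
      case (elim x)
      show ?case
      proof
        assume "x \<in> cbox 0 1"
        then have "0 < x $ i \<and> x $ i < 1" for i using spec[OF elim, of i] by (auto simp: mem_box_cart less_le)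
        then have "x \<in> box a b \<longleftrightarrow> x \<in> box a' b'" unfolding a'_def b'_def by (auto simp: mem_box_cart)
        then show "indicat_real (box a b) x * h x = indicat_real (box a' b') x * h x" by (simp add: indicator_def)
      qed
    qed
    then have "(LINT x|torus. indicat_real (box a b) x * h x) = (LINT x|torus. indicat_real (box a' b') x * h x)"
      by (intro integral_cong_AE im)
    also have "\<dots> = 0"
    proof (cases "\<forall>i. a' $ i < b' $ i")
      case True
      then show ?thesis by (intro torus_orthogonal_box[OF h orth]) (auto simp: a'_def b'_def)
    next
      case False
      then have "box a' b' = {}" by (auto simp: mem_box_cart) (meson less_trans)
      then show ?thesis by simp
    qed
    finally show ?thesis .
  qed
  define H where "H x = indicat_real (cbox 0 1) x * h x" for x
  have Hm: "H \<in> borel_measurable lebesgue"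
    using h unfolding H_def[abs_def] torus_def
    by (subst (asm) integrable_restrict_space) (auto dest: borel_measurable_integrable)
  have Hi: "integrable lebesgue H"
    using h unfolding H_def[abs_def] torus_def by (subst (asm) integrable_restrict_space) auto
  obtain g where g: "g \<in> borel_measurable lborel" "AE x in lborel. H x = g x"
    using completion_ex_borel_measurable_real[OF Hm] by blast
  have gl: "g \<in> borel_measurable lebesgue" using g(1) by (rule measurable_completion)
  have ae: "AE x in lebesgue. H x = g x" using g(2) by (rule AE_completion)
  have "integrable lebesgue g" by (rule iffD1[OF integrable_cong_AE[OF Hm gl ae] Hi])
  then have gi: "integrable lborel g" using g(1) by (simp add: integrable_completion)
  have "(LINT x|lborel. indicat_real (box a b) x * g x) = 0" for a b
  proof -
    have "(LINT x|lborel. indicat_real (box a b) x * g x) = (LINT x|lebesgue. indicat_real (box a b) x * g x)"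
      by (rule integral_completion[symmetric]) (use g(1) in simp)
    also have "\<dots> = (LINT x|lebesgue. indicat_real (box a b) x * H x)"
    proof (rule integral_cong_AE)
      have ib: "(\<lambda>x. indicat_real (box a b) x) \<in> borel_measurable lebesgue" by (intro measurable_completion) simp
      show "(\<lambda>x. indicat_real (box a b) x * g x) \<in> borel_measurable lebesgue" by (intro borel_measurable_times ib gl)
      show "(\<lambda>x. indicat_real (box a b) x * H x) \<in> borel_measurable lebesgue" by (intro borel_measurable_times ib Hm)
      show "AE x in lebesgue. indicat_real (box a b) x * g x = indicat_real (box a b) x * H x"
        using ae by eventually_elim simp
    qed
    also have "\<dots> = (LINT x|lebesgue. indicat_real (cbox 0 1) x *\<^sub>R (indicat_real (box a b) x * h x))"
      unfolding H_def by (intro Bochner_Integration.integral_cong) auto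
    also have "\<dots> = (LINT x|torus. indicat_real (box a b) x * h x)"
      unfolding torus_def by (rule integral_restrict_space[symmetric]) simp
    finally show ?thesis using box0 by simp
  qed
  then have "AE x in lborel. g x = 0" by (rule integrable_zero_boxes[OF gi])
  with g(2) have "AE x in lborel. x \<in> cbox 0 1 \<longrightarrow> h x = 0"
    by eventually_elim (auto simp: H_def)
  then show ?thesis unfolding AE_torus_iff .
qed

section \<open>Square integrable functions\<close>

lemma L2_mult_integrable:
  fixes f g :: "'a \<Rightarrow> real"
  assumes [measurable]: "f \<in> borel_measurable M" "g \<in> borel_measurable M"
    and f: "integrable M (\<lambda>x. (f x)\<^sup>2)" and g: "integrable M (\<lambda>x. (g x)\<^sup>2)"
  shows "integrable M (\<lambda>x. f x * g x)"
proof (rule Bochner_Integration.integrable_bound)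
  show "integrable M (\<lambda>x. (f x)\<^sup>2 + (g x)\<^sup>2)" using f g by simp
  have "\<bar>a * b\<bar> \<le> \<bar>a\<^sup>2 + b\<^sup>2\<bar>" for a b :: real
  proof -
    have "0 \<le> (\<bar>a\<bar> - \<bar>b\<bar>)\<^sup>2" by simp
    then have "2 * (\<bar>a\<bar> * \<bar>b\<bar>) \<le> a\<^sup>2 + b\<^sup>2" by (simp add: power2_diff)
    moreover have "0 \<le> \<bar>a\<bar> * \<bar>b\<bar>" by simp
    ultimately show ?thesis unfolding abs_mult by linarith
  qed
  then show "AE x in M. norm (f x * g x) \<le> norm ((f x)\<^sup>2 + (g x)\<^sup>2)"
    unfolding real_norm_def by (intro AE_I2)
qed simp

lemma L2_add:
  fixes f g :: "'a \<Rightarrow> real"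
  assumes "f \<in> borel_measurable M" "g \<in> borel_measurable M"
    and "integrable M (\<lambda>x. (f x)\<^sup>2)" "integrable M (\<lambda>x. (g x)\<^sup>2)"
  shows "integrable M (\<lambda>x. (f x + g x)\<^sup>2)" "integrable M (\<lambda>x. (f x - g x)\<^sup>2)"
  using L2_mult_integrable[OF assms] assms by (simp_all add: power2_sum power2_diff mult.assoc)

lemma L2_Cauchy_Schwarz:
  fixes f g :: "'a \<Rightarrow> real"
  assumes m: "f \<in> borel_measurable M" "g \<in> borel_measurable M"
    and f: "integrable M (\<lambda>x. (f x)\<^sup>2)" and g: "integrable M (\<lambda>x. (g x)\<^sup>2)"
  shows "(LINT x|M. f x * g x)\<^sup>2 \<le> (LINT x|M. (f x)\<^sup>2) * (LINT x|M. (g x)\<^sup>2)"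
proof -
  define a b c where "a = (LINT x|M. (f x)\<^sup>2)" and "b = (LINT x|M. f x * g x)" and "c = (LINT x|M. (g x)\<^sup>2)"
  note fg = L2_mult_integrable[OF m f g]
  have c0: "c \<ge> 0" unfolding c_def by simp
  show ?thesis
  proof (cases "c = 0")
    case True
    then have "AE x in M. (g x)\<^sup>2 = 0" unfolding c_def using g by (subst (asm) integral_nonneg_eq_0_iff_AE) auto
    then have "(LINT x|M. f x * g x) = (LINT x|M. 0)"
      using m by (intro integral_cong_AE) auto
    then show ?thesis by simp
  next
    case False
    define t where "t = b / c"
    have "0 \<le> (LINT x|M. (f x - t * g x)\<^sup>2)" by simp
    also have "\<dots> = (LINT x|M. (f x)\<^sup>2 - 2 * t * (f x * g x) + t\<^sup>2 * (g x)\<^sup>2)"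
      by (intro Bochner_Integration.integral_cong) (auto simp: power2_diff power_mult_distrib)
    also have "\<dots> = a - 2 * t * b + t\<^sup>2 * c" unfolding a_def b_def c_def using f g fg by simp
    also have "\<dots> = a - b\<^sup>2 / c" unfolding t_def using False by (simp add: power2_eq_square field_simps)
    finally have "b\<^sup>2 \<le> a * c" using c0 False by (simp add: field_simps)
    then show ?thesis unfolding a_def b_def c_def .
  qed
qed

text \<open>
  The limit is taken along one fixed subsequence and chosen as \<open>lim\<close>, so that a pointwise symmetry of all
  \<open>f n\<close>, such as periodicity, passes to it everywhere.
\<close>

lemma L2_complete:
  fixes f :: "nat \<Rightarrow> 'a \<Rightarrow> real"
  assumes [measurable]: "\<And>n. f n \<in> borel_measurable M" and f2: "\<And>n. integrable M (\<lambda>x. (f n x)\<^sup>2)"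
    and cauchy: "\<And>\<epsilon>. \<epsilon> > 0 \<Longrightarrow> \<exists>N. \<forall>m\<ge>N. \<forall>n\<ge>N. (LINT x|M. (f m x - f n x)\<^sup>2) \<le> \<epsilon>"
  obtains r where "strict_mono (r :: nat \<Rightarrow> nat)"
    "integrable M (\<lambda>x. (lim (\<lambda>n. f (r n) x))\<^sup>2)"
    "(\<lambda>n. LINT x|M. (f n x - lim (\<lambda>n. f (r n) x))\<^sup>2) \<longlonglongrightarrow> 0"
proof -
  have fd: "integrable M (\<lambda>x. (f m x - f n x)\<^sup>2)" for m n using f2 by (intro L2_add) auto
  \<comment> \<open>The rate 1/4 leaves room for the weights \<open>2 ^ k\<close> below: the
    weighted squares still have summable integrals, so their sum is finite almost everywhere, which
    forces geometric decay of the increments.\<close>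
  have "\<exists>N. \<forall>m\<ge>N. \<forall>n\<ge>N. (LINT x|M. (f m x - f n x)\<^sup>2) \<le> (1/4) ^ k" for k :: nat
    by (rule cauchy) simp
  then obtain N where N: "\<And>k m n. m \<ge> N k \<Longrightarrow> n \<ge> N k \<Longrightarrow> (LINT x|M. (f m x - f n x)\<^sup>2) \<le> (1/4) ^ k"
    by metis
  define r where "r = rec_nat (N 0) (\<lambda>k x. Suc (max x (N (Suc k))))"
  have rS: "r (Suc k) = Suc (max (r k) (N (Suc k)))" for k unfolding r_def by simp
  have r: "strict_mono r" unfolding strict_mono_Suc_iff rS by (simp add: less_Suc_eq_le)
  have rN: "r k \<ge> N k" for k by (cases k) (auto simp: r_def)
  have rN': "r k \<ge> N l" if "k \<ge> l" for k l
    using rN[of l] that strict_mono_less_eq[OF r, of l k] by linarith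
  define d where "d k x = f (r (Suc k)) x - f (r k) x" for k x
  have [measurable]: "d k \<in> borel_measurable M" for k unfolding d_def[abs_def] by measurable
  have dint: "(LINT x|M. (d k x)\<^sup>2) \<le> (1/4) ^ k" for k
    unfolding d_def by (rule N) (auto intro: rN rN')
  have di: "integrable M (\<lambda>x. (d k x)\<^sup>2)" for k unfolding d_def by (rule fd)
  have nn: "(\<integral>\<^sup>+x. ennreal (2 ^ k * (d k x)\<^sup>2) \<partial>M) \<le> ennreal ((1/2) ^ k)" for k
  proof -
    have "(\<integral>\<^sup>+x. ennreal (2 ^ k * (d k x)\<^sup>2) \<partial>M) = ennreal (LINT x|M. 2 ^ k * (d k x)\<^sup>2)"
      using di by (intro nn_integral_eq_integral) auto
    also have "\<dots> \<le> ennreal (2 ^ k * (1/4) ^ k)" using dint[of k] by (intro ennreal_leI) simp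
    also have "2 ^ k * (1/4) ^ k = (1/2::real) ^ k" by (simp add: power_mult_distrib[symmetric])
    finally show ?thesis .
  qed
  have "(\<integral>\<^sup>+x. (\<Sum>k. ennreal (2 ^ k * (d k x)\<^sup>2)) \<partial>M) = (\<Sum>k. \<integral>\<^sup>+x. ennreal (2 ^ k * (d k x)\<^sup>2) \<partial>M)"
    by (rule nn_integral_suminf) measurable
  also have "\<dots> \<le> (\<Sum>k. ennreal ((1/2) ^ k))" by (intro suminf_le nn) auto
  also have "\<dots> = ennreal (\<Sum>k. (1/2) ^ k)" by (rule suminf_ennreal2) auto
  also have "\<dots> < \<infinity>" by simp
  finally have fin: "AE x in M. (\<Sum>k. ennreal (2 ^ k * (d k x)\<^sup>2)) \<noteq> \<infinity>"
    by (intro nn_integral_noteq_infinite) auto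
  have conv: "AE x in M. convergent (\<lambda>n. f (r n) x)"
    using fin
  proof eventually_elim
    case (elim x)
    define C where "C = enn2real (\<Sum>k. ennreal (2 ^ k * (d k x)\<^sup>2))"
    have C: "C \<ge> 0" "(\<Sum>k. ennreal (2 ^ k * (d k x)\<^sup>2)) = ennreal C"
      unfolding C_def using elim by (auto simp: less_top)
    have b: "\<bar>d k x\<bar> \<le> sqrt C * (1 / sqrt 2) ^ k" for k
    proof -
      define h where "h k = ennreal (2 ^ k * (d k x)\<^sup>2)" for k
      have "(\<Sum>j\<in>{k}. h j) \<le> suminf h" by (rule sum_le_suminf) auto
      then have "h k \<le> suminf h" by simp
      also have "suminf h = ennreal C" using C(2) unfolding h_def[abs_def] .
      finally have "2 ^ k * (d k x)\<^sup>2 \<le> C" unfolding h_def using C(1) by (simp only: ennreal_le_iff)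
      then have "(d k x)\<^sup>2 \<le> C * (1 / 2) ^ k" by (simp add: field_simps power_divide)
      then have "\<bar>d k x\<bar> \<le> sqrt (C * (1 / 2) ^ k)" using real_le_rsqrt[of "\<bar>d k x\<bar>"] by simp
      also have "\<dots> = sqrt C * (1 / sqrt 2) ^ k" by (simp add: real_sqrt_mult real_sqrt_power real_sqrt_divide)
      finally show ?thesis .
    qed
    have "1 / sqrt 2 < (1 :: real)" by simp
    then have "summable (\<lambda>k. sqrt C * (1 / sqrt 2) ^ k)" by (intro summable_mult summable_geometric) (simp only: real_norm_def, simp)
    then have "summable (\<lambda>k. d k x)"
      by (rule summable_comparison_test'[where N=0]) (simp only: real_norm_def b)
    then have "convergent (\<lambda>n. \<Sum>k<n. d k x)" by (simp add: summable_iff_convergent)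
    moreover have "(\<Sum>k<n. d k x) = f (r n) x - f (r 0) x" for n unfolding d_def by (rule sum_lessThan_telescope)
    ultimately have "convergent (\<lambda>n. f (r n) x - f (r 0) x)" by simp
    then have "convergent (\<lambda>n. (f (r n) x - f (r 0) x) + f (r 0) x)" by (intro convergent_add convergent_const)
    then show ?case by simp
  qed
  define F where "F x = lim (\<lambda>n. f (r n) x)" for x
  have [measurable]: "F \<in> borel_measurable M" unfolding F_def[abs_def] by measurable
  have lim: "AE x in M. (\<lambda>n. f (r n) x) \<longlonglongrightarrow> F x"
    using conv unfolding F_def by eventually_elim (simp add: convergent_LIMSEQ_iff)
  \<comment> \<open>Fatou along the subsequence turns the Cauchy estimate into an estimate of the
    distance to the limit, from which square integrability of the limit follows as well.\<close>
  have fatou: "(\<integral>\<^sup>+x. ennreal ((f n x - F x)\<^sup>2) \<partial>M) \<le> ennreal ((1/4) ^ l)" if "n \<ge> N l" for n l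
  proof -
    have "(\<integral>\<^sup>+x. ennreal ((f n x - F x)\<^sup>2) \<partial>M) = (\<integral>\<^sup>+x. liminf (\<lambda>k. ennreal ((f n x - f (r k) x)\<^sup>2)) \<partial>M)"
    proof (rule nn_integral_cong_AE)
      show "AE x in M. ennreal ((f n x - F x)\<^sup>2) = liminf (\<lambda>k. ennreal ((f n x - f (r k) x)\<^sup>2))"
        using lim
      proof eventually_elim
        case (elim x)
        have "(\<lambda>k. ennreal ((f n x - f (r k) x)\<^sup>2)) \<longlonglongrightarrow> ennreal ((f n x - F x)\<^sup>2)"
          by (intro tendsto_ennrealI tendsto_intros elim)
        then show ?case by (intro lim_imp_Liminf[symmetric]) auto
      qed
    qed
    also have "\<dots> \<le> liminf (\<lambda>k. \<integral>\<^sup>+x. ennreal ((f n x - f (r k) x)\<^sup>2) \<partial>M)"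
      by (rule nn_integral_liminf) measurable
    also have "\<dots> \<le> ennreal ((1/4) ^ l)"
    proof (rule Liminf_le)
      have "(\<integral>\<^sup>+x. ennreal ((f n x - f (r k) x)\<^sup>2) \<partial>M) \<le> ennreal ((1/4) ^ l)" if "k \<ge> l" for k
      proof -
        have "(\<integral>\<^sup>+x. ennreal ((f n x - f (r k) x)\<^sup>2) \<partial>M) = ennreal (LINT x|M. (f n x - f (r k) x)\<^sup>2)"
          using fd by (intro nn_integral_eq_integral) auto
        also have "\<dots> \<le> ennreal ((1/4) ^ l)" by (intro ennreal_leI N) (use \<open>n \<ge> N l\<close> rN'[OF that] in auto)
        finally show ?thesis .
      qed
      then show "\<forall>\<^sub>F k in sequentially. (\<integral>\<^sup>+x. ennreal ((f n x - f (r k) x)\<^sup>2) \<partial>M) \<le> ennreal ((1/4) ^ l)"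
        unfolding eventually_sequentially by blast
    qed simp
    finally show ?thesis .
  qed
  have dF: "integrable M (\<lambda>x. (f n x - F x)\<^sup>2)" if "n \<ge> N l" for n l
    using fatou[OF that] by (intro integrableI_bounded) (auto intro: le_less_trans)
  have bF: "(LINT x|M. (f n x - F x)\<^sup>2) \<le> (1/4) ^ l" if "n \<ge> N l" for n l
  proof -
    have "ennreal (LINT x|M. (f n x - F x)\<^sup>2) = (\<integral>\<^sup>+x. ennreal ((f n x - F x)\<^sup>2) \<partial>M)"
      using dF[OF that] by (intro nn_integral_eq_integral[symmetric]) auto
    also have "\<dots> \<le> ennreal ((1/4) ^ l)" by (rule fatou[OF that])
    finally show ?thesis by (simp add: ennreal_le_iff)
  qed
  have "integrable M (\<lambda>x. (f (N 0) x - (f (N 0) x - F x))\<^sup>2)"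
    by (rule L2_add(2)[OF _ _ f2 dF]) auto
  then have F2: "integrable M (\<lambda>x. (F x)\<^sup>2)" by simp
  have "(\<lambda>n. LINT x|M. (f n x - F x)\<^sup>2) \<longlonglongrightarrow> 0"
  proof (rule LIMSEQ_I)
    fix e :: real assume "e > 0"
    then obtain l where l: "(1/4 :: real) ^ l < e" using real_arch_pow_inv[of e "1/4"] by auto
    have "norm ((LINT x|M. (f n x - F x)\<^sup>2) - 0) < e" if "n \<ge> N l" for n
      using bF[OF that] l by simp
    then show "\<exists>no. \<forall>n\<ge>no. norm ((LINT x|M. (f n x - F x)\<^sup>2) - 0) < e" by blast
  qed
  then show ?thesis using that[OF r] F2 unfolding F_def by blast
qed

section \<open>Orthonormal series with time-dependent coefficients\<close>

lemma Bessel_inequality: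
  fixes f :: "'a \<Rightarrow> real" and e :: "'i \<Rightarrow> 'a \<Rightarrow> real"
  assumes [measurable]: "f \<in> borel_measurable M" "\<And>j. e j \<in> borel_measurable M"
    and f: "integrable M (\<lambda>x. (f x)\<^sup>2)" and e: "\<And>j. integrable M (\<lambda>x. (e j x)\<^sup>2)"
    and on: "\<And>i j. i \<in> I \<Longrightarrow> j \<in> I \<Longrightarrow> (LINT x|M. e i x * e j x) = (if i = j then 1 else 0)"
    and I: "finite I"
  shows "(\<Sum>j\<in>I. (LINT x|M. f x * e j x)\<^sup>2) \<le> (LINT x|M. (f x)\<^sup>2)"
proof -
  define c where "c j = (LINT x|M. f x * e j x)" for j
  have fe: "integrable M (\<lambda>x. f x * e j x)" for j by (intro L2_mult_integrable f e) auto
  have ee: "integrable M (\<lambda>x. e i x * e j x)" for i j by (intro L2_mult_integrable e) auto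
  have sq: "(f x - (\<Sum>j\<in>I. c j * e j x))\<^sup>2 = (f x)\<^sup>2 - 2 * (\<Sum>j\<in>I. c j * (f x * e j x)) + (\<Sum>i\<in>I. \<Sum>j\<in>I. (c i * c j) * (e i x * e j x))" for x
    unfolding power2_diff power2_eq_square[of "sum _ _"] sum_product by (simp add: sum_distrib_left mult_ac)
  have "0 \<le> (LINT x|M. (f x - (\<Sum>j\<in>I. c j * e j x))\<^sup>2)" by simp
  also have "\<dots> = (LINT x|M. (f x)\<^sup>2) - 2 * (\<Sum>j\<in>I. c j * c j) + (\<Sum>i\<in>I. \<Sum>j\<in>I. (c i * c j) * (LINT x|M. e i x * e j x))"
    unfolding sq using f fe ee by (simp add: c_def)
  also have "(\<Sum>i\<in>I. \<Sum>j\<in>I. (c i * c j) * (LINT x|M. e i x * e j x)) = (\<Sum>i\<in>I. c i * c i)"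
  proof (rule sum.cong[OF refl])
    fix i assume i: "i \<in> I"
    have "(\<Sum>j\<in>I. (c i * c j) * (LINT x|M. e i x * e j x)) = (\<Sum>j\<in>I. if i = j then c i * c j else 0)"
      using on[OF i] by (intro sum.cong) auto
    then show "(\<Sum>j\<in>I. (c i * c j) * (LINT x|M. e i x * e j x)) = c i * c i" using I i by simp
  qed
  finally show ?thesis unfolding c_def by (simp add: power2_eq_square)
qed

lemma Pythagoras_sum:
  fixes e :: "'i \<Rightarrow> 'a \<Rightarrow> real"
  assumes [measurable]: "\<And>j. e j \<in> borel_measurable M" and e: "\<And>j. integrable M (\<lambda>x. (e j x)\<^sup>2)"
    and on: "\<And>i j. i \<in> I \<Longrightarrow> j \<in> I \<Longrightarrow> (LINT x|M. e i x * e j x) = (if i = j then 1 else 0)"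
    and I: "finite I"
  shows "(LINT x|M. (\<Sum>j\<in>I. c j * e j x)\<^sup>2) = (\<Sum>j\<in>I. (c j)\<^sup>2)"
proof -
  have ee: "integrable M (\<lambda>x. e i x * e j x)" for i j by (intro L2_mult_integrable e) auto
  have "(LINT x|M. (\<Sum>j\<in>I. c j * e j x)\<^sup>2) = (LINT x|M. (\<Sum>i\<in>I. \<Sum>j\<in>I. (c i * c j) * (e i x * e j x)))"
    unfolding power2_eq_square sum_product by (simp add: mult_ac)
  also have "\<dots> = (\<Sum>i\<in>I. \<Sum>j\<in>I. (c i * c j) * (LINT x|M. e i x * e j x))" using ee by simp
  also have "\<dots> = (\<Sum>i\<in>I. (c i)\<^sup>2)"
  proof (rule sum.cong[OF refl])
    fix i assume i: "i \<in> I"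
    have "(\<Sum>j\<in>I. (c i * c j) * (LINT x|M. e i x * e j x)) = (\<Sum>j\<in>I. if i = j then c i * c j else 0)"
      using on[OF i] by (intro sum.cong) auto
    then show "(\<Sum>j\<in>I. (c i * c j) * (LINT x|M. e i x * e j x)) = (c i)\<^sup>2" using I i by (simp add: power2_eq_square)
  qed
  finally show ?thesis .
qed

text \<open>Fubini is applied to the product of restrictions of \<open>lborel\<close>, while torus
  and time interval carry completed measures. For functions measurable with respect to the smaller
  sigma-algebra the two give the same integrals.\<close>

lemma lebesgue_on_borel:
  fixes f :: "'a::euclidean_space \<Rightarrow> real"
  assumes f: "f \<in> borel_measurable (restrict_space lborel S)" and S: "S \<in> sets borel"
  shows "f \<in> borel_measurable (lebesgue_on S)"
    and "integrable (lebesgue_on S) f \<longleftrightarrow> integrable (restrict_space lborel S) f"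
    and "(LINT x|lebesgue_on S. f x) = (LINT x|restrict_space lborel S. f x)"
proof -
  have g: "(\<lambda>x. indicat_real S x *\<^sub>R f x) \<in> borel_measurable lborel"
    using f S by (subst (asm) borel_measurable_restrict_space_iff) (auto simp: mult.commute)
  then have g': "(\<lambda>x. indicat_real S x *\<^sub>R f x) \<in> borel_measurable lebesgue" by (rule measurable_completion)
  then show "f \<in> borel_measurable (lebesgue_on S)"
    using S by (subst borel_measurable_restrict_space_iff) (auto simp: mult.commute)
  show "integrable (lebesgue_on S) f \<longleftrightarrow> integrable (restrict_space lborel S) f"
    using S integrable_completion[OF g] by (simp add: integrable_restrict_space)
  show "(LINT x|lebesgue_on S. f x) = (LINT x|restrict_space lborel S. f x)"
    using S integral_completion[OF g] by (simp add: integral_restrict_space)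
qed

lemma AE_lebesgue_on_iff:
  fixes S :: "'a::euclidean_space set"
  assumes "S \<in> sets borel"
  shows "(AE x in lebesgue_on S. P x) \<longleftrightarrow> (AE x in restrict_space lborel S. P x)"
  using assms by (simp add: AE_restrict_space_iff AE_completion_iff)

lemma continuous_measurable_restrict:
  fixes f :: "'a::euclidean_space \<Rightarrow> real"
  assumes "continuous_on S f"
  shows "f \<in> borel_measurable (restrict_space lborel S)"
proof -
  have "sets (restrict_space lborel S) = sets (restrict_space borel S)" by (simp add: sets_restrict_space)
  then show ?thesis
    using borel_measurable_continuous_on_restrict[OF assms] measurable_cong_sets by blast
qed

text \<open>Parseval's identity for \<open>u\<close>, and its pairing with any square integrable
  \<open>f\<close> in terms of coefficients. The pairing has to cover all such f, since b . grad e_j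
  is merely square integrable in space.\<close>

definition L2_expansion :: "(nat \<Rightarrow> real^'n \<Rightarrow> real) \<Rightarrow> (nat \<Rightarrow> real) \<Rightarrow> (real^'n \<Rightarrow> real) \<Rightarrow> bool" where
  "L2_expansion e d u \<longleftrightarrow> u \<in> borel_measurable torus \<and> integrable torus (\<lambda>x. (u x)\<^sup>2) \<and>
     (\<lambda>k. (d k)\<^sup>2) sums (LINT x|torus. (u x)\<^sup>2) \<and>
     (\<forall>f. f \<in> borel_measurable torus \<longrightarrow> integrable torus (\<lambda>x. (f x)\<^sup>2) \<longrightarrow>
       (\<lambda>k. d k * (LINT x|torus. f x * e k x)) sums (LINT x|torus. u x * f x))"

text \<open>Pythagoras in space at each time, integrated in time, makes the partial sums Cauchy in
  L^2 of space-time. One limit on the product, instead of one per time, gives joint measurability; a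
  further subsequence converges in space at almost every time. The result is applied to the solution
  and to each of its partial derivatives.\<close>

lemma coefficient_expansion:
  fixes d :: "nat \<Rightarrow> real \<Rightarrow> real" and e :: "nat \<Rightarrow> real^'n \<Rightarrow> real" and T M :: real
  assumes d: "\<And>k. continuous_on {0..T} (d k)" and e: "\<And>k. continuous_on UNIV (e k)" and per: "\<And>k. periodic (e k)"
    and on: "\<And>i j. (LINT x|torus. e i x * e j x) = (if i = j then 1 else 0)"
    and bd: "\<And>n. (LINT t|lebesgue_on {0..T}. (\<Sum>k<n. (d k t)\<^sup>2)) \<le> M"
  obtains U :: "real \<Rightarrow> real^'n \<Rightarrow> real" where "\<And>t. periodic (U t)"
    "(\<lambda>(t, x). U t x) \<in> borel_measurable (lebesgue_on ({0..T} \<times> cbox 0 1))"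
    "AE t in lebesgue_on {0..T}. L2_expansion e (\<lambda>k. d k t) (U t)"
proof -
  define \<mu> where "\<mu> = restrict_space lborel {0..T}"
  define \<nu> where "\<nu> = restrict_space lborel (cbox 0 (1 :: real^'n))"
  have sp: "space \<mu> = {0..T}" "space \<nu> = cbox 0 1" unfolding \<mu>_def \<nu>_def by auto
  have "finite_measure \<mu>" "finite_measure \<nu>"
    unfolding \<mu>_def \<nu>_def
    by (rule finite_measureI, simp add: emeasure_restrict_space emeasure_lborel_cbox_finite[unfolded infinity_ennreal_def] emeasure_lborel_Icc_eq)+
       (use emeasure_lborel_cbox_finite[of 0 "1 :: real^'n"] in \<open>auto simp: less_top\<close>)
  then interpret mu: finite_measure \<mu> + nu: finite_measure \<nu> by auto
  interpret P: pair_sigma_finite \<mu> \<nu> ..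
  have finP: "finite_measure (\<mu> \<Otimes>\<^sub>M \<nu>)"
    by (intro finite_measureI) (simp add: space_pair_measure nu.emeasure_pair_measure_Times ennreal_mult_eq_top_iff)
  have to_nu: "f \<in> borel_measurable torus" "integrable torus f \<longleftrightarrow> integrable \<nu> f" "(LINT x|torus. f x) = (LINT x|\<nu>. f x)"
    if "f \<in> borel_measurable \<nu>" for f :: "real^'n \<Rightarrow> real"
    using lebesgue_on_borel[of f "cbox 0 1"] that unfolding torus_def \<nu>_def by auto
  have to_mu: "integrable (lebesgue_on {0..T}) f \<longleftrightarrow> integrable \<mu> f" "(LINT x|lebesgue_on {0..T}. f x) = (LINT x|\<mu>. f x)"
    if "f \<in> borel_measurable \<mu>" for f :: "real \<Rightarrow> real"
    using lebesgue_on_borel[of f "{0..T}"] that unfolding \<mu>_def by auto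
  have [measurable]: "d k \<in> borel_measurable \<mu>" for k
    unfolding \<mu>_def by (rule continuous_measurable_restrict[OF d])
  have [measurable]: "e k \<in> borel_measurable \<nu>" for k
    unfolding \<nu>_def by (rule continuous_measurable_restrict[OF continuous_on_subset[OF e subset_UNIV]])
  have onnu: "(LINT x|\<nu>. e i x * e j x) = (if i = j then 1 else 0)" for i j
    using on[of i j] by (subst (asm) to_nu(3)) auto
  have e2: "integrable torus (\<lambda>x. (e k x)\<^sup>2)" for k by (intro torus_integrable_cont continuous_intros e)
  have e2nu: "integrable \<nu> (\<lambda>x. (e k x)\<^sup>2)" for k using e2[of k] by (subst (asm) to_nu(2)) auto
  have em: "e k \<in> borel_measurable torus" for k by (rule continuous_imp_torus_measurable[OF e])
  define S where "S n p = (\<Sum>k<n. d k (fst p) * e k (snd p))" for n p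
  have Sm [measurable]: "S n \<in> borel_measurable (\<mu> \<Otimes>\<^sub>M \<nu>)" for n unfolding S_def[abs_def] by measurable
  have "\<exists>C. \<forall>t\<in>{0..T}. \<bar>d k t\<bar> \<le> C" for k
  proof -
    have "bounded (d k ` {0..T})" by (intro compact_imp_bounded compact_continuous_image d) auto
    then show ?thesis unfolding bounded_iff by auto
  qed
  then obtain D where D: "\<And>k t. t \<in> {0..T} \<Longrightarrow> \<bar>d k t\<bar> \<le> D k" by metis
  have "\<exists>C. \<forall>x\<in>cbox 0 1. \<bar>e k x\<bar> \<le> C" for k
    using torus_bounded[OF e[of k]] by (metis real_norm_def)
  then obtain E where E: "\<And>k x. x \<in> cbox 0 1 \<Longrightarrow> \<bar>e k x\<bar> \<le> E k" by metis
  have S2: "integrable (\<mu> \<Otimes>\<^sub>M \<nu>) (\<lambda>p. (S n p)\<^sup>2)" for n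
  proof (rule finite_measure.integrable_const_bound[OF finP])
    show "AE p in \<mu> \<Otimes>\<^sub>M \<nu>. norm ((S n p)\<^sup>2) \<le> (\<Sum>k<n. D k * E k)\<^sup>2"
    proof (rule AE_I2)
      fix p assume "p \<in> space (\<mu> \<Otimes>\<^sub>M \<nu>)"
      then have p: "fst p \<in> {0..T}" "snd p \<in> cbox 0 1" by (auto simp: space_pair_measure sp)
      have "\<bar>S n p\<bar> \<le> (\<Sum>k<n. \<bar>d k (fst p)\<bar> * \<bar>e k (snd p)\<bar>)"
        unfolding S_def by (rule order_trans[OF sum_abs]) (simp add: abs_mult)
      also have "\<dots> \<le> (\<Sum>k<n. D k * E k)"
      proof (rule sum_mono)
        fix k
        have "0 \<le> D k" using D[OF p(1), of k] by linarith
        then show "\<bar>d k (fst p)\<bar> * \<bar>e k (snd p)\<bar> \<le> D k * E k"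
          using D[OF p(1), of k] E[OF p(2), of k] by (intro mult_mono) auto
      qed
      finally have "\<bar>S n p\<bar> \<le> \<bar>\<Sum>k<n. D k * E k\<bar>" by linarith
      then show "norm ((S n p)\<^sup>2) \<le> (\<Sum>k<n. D k * E k)\<^sup>2" by (simp add: abs_le_square_iff)
    qed
  qed measurable
  have d2: "integrable \<mu> (\<lambda>t. (d k t)\<^sup>2)" for k
  proof (rule mu.integrable_const_bound)
    show "AE t in \<mu>. norm ((d k t)\<^sup>2) \<le> (D k)\<^sup>2"
      using D[of _ k] by (intro AE_I2) (force simp: sp abs_le_square_iff[symmetric])
  qed measurable
  define a where "a k = (LINT t|\<mu>. (d k t)\<^sup>2)" for k
  have suma: "summable a"
  proof (rule bounded_imp_summable)
    show "0 \<le> a k" for k unfolding a_def by simp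
    show "(\<Sum>k\<le>n. a k) \<le> M" for n
      using bd[of "Suc n"] d2 unfolding a_def by (subst (asm) to_mu) (auto simp: lessThan_Suc_atMost)
  qed
  have S_diff: "(LINT p|(\<mu> \<Otimes>\<^sub>M \<nu>). (S m p - S n p)\<^sup>2) = (\<Sum>k=n..<m. a k)" if "n \<le> m" for m n
  proof -
    have i: "integrable (\<mu> \<Otimes>\<^sub>M \<nu>) (\<lambda>p. (S m p - S n p)\<^sup>2)" by (intro L2_add S2 Sm)
    have "S m p - S n p = (\<Sum>k=n..<m. d k (fst p) * e k (snd p))" for p
      unfolding S_def lessThan_atLeast0 by (rule sum_diff_nat_ivl) (use that in auto)
    then have "(LINT p|(\<mu> \<Otimes>\<^sub>M \<nu>). (S m p - S n p)\<^sup>2) = (LINT t|\<mu>. LINT x|\<nu>. (\<Sum>k=n..<m. d k t * e k x)\<^sup>2)"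
      using P.integral_fst'[OF i] by simp
    also have "\<dots> = (LINT t|\<mu>. (\<Sum>k=n..<m. (d k t)\<^sup>2))"
      by (subst Pythagoras_sum) (use e2nu onnu in auto)
    also have "\<dots> = (\<Sum>k=n..<m. a k)" unfolding a_def using d2 by simp
    finally show ?thesis .
  qed
  have cauchy: "\<exists>N. \<forall>m\<ge>N. \<forall>n\<ge>N. (LINT p|(\<mu> \<Otimes>\<^sub>M \<nu>). (S m p - S n p)\<^sup>2) \<le> \<epsilon>" if eps: "\<epsilon> > 0" for \<epsilon>
  proof -
    obtain N where N: "\<And>m n. m \<ge> N \<Longrightarrow> norm (\<Sum>k=m..<n. a k) < \<epsilon>"
      using suma eps unfolding summable_Cauchy by blast
    have *: "(LINT p|(\<mu> \<Otimes>\<^sub>M \<nu>). (S m p - S n p)\<^sup>2) \<le> \<epsilon>" if "n \<ge> N" "n \<le> m" for m n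
      unfolding S_diff[OF that(2)] using N[OF that(1), of m] by simp
    have "(LINT p|(\<mu> \<Otimes>\<^sub>M \<nu>). (S m p - S n p)\<^sup>2) \<le> \<epsilon>" if "n \<ge> N" "m \<ge> N" for m n
      using *[of n m] *[of m n] that by (cases "n \<le> m") (auto simp: power2_commute)
    then show ?thesis by blast
  qed
  obtain r where r: "strict_mono (r :: nat \<Rightarrow> nat)" "integrable (\<mu> \<Otimes>\<^sub>M \<nu>) (\<lambda>p. (lim (\<lambda>n. S (r n) p))\<^sup>2)"
    "(\<lambda>n. LINT p|(\<mu> \<Otimes>\<^sub>M \<nu>). (S n p - lim (\<lambda>n. S (r n) p))\<^sup>2) \<longlonglongrightarrow> 0"
    by (rule L2_complete[of S "\<mu> \<Otimes>\<^sub>M \<nu>"]) (use S2 cauchy in auto)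
  define F where "F p = lim (\<lambda>n. S (r n) p)" for p
  have Fm [measurable]: "F \<in> borel_measurable (\<mu> \<Otimes>\<^sub>M \<nu>)" unfolding F_def[abs_def] by measurable
  have F2: "integrable (\<mu> \<Otimes>\<^sub>M \<nu>) (\<lambda>p. (F p)\<^sup>2)" using r(2) unfolding F_def .
  have FS: "integrable (\<mu> \<Otimes>\<^sub>M \<nu>) (\<lambda>p. (S n p - F p)\<^sup>2)" for n by (intro L2_add S2 F2 Sm Fm)
  define U where "U t x = F (t, x)" for t x
  have Uper: "periodic (U t)" for t
    using per unfolding U_def F_def S_def periodic_def by simp
  \<comment> \<open>Shown directly for Lebesgue measure on the product: the partial sums are
    continuous, and \<open>lim\<close> preserves measurability even where the sequence
    diverges.\<close>
  have Umeas: "(\<lambda>(t, x). U t x) \<in> borel_measurable (lebesgue_on ({0..T} \<times> cbox 0 1))"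
  proof -
    have "S n \<in> borel_measurable (lebesgue_on ({0..T} \<times> cbox 0 1))" for n
    proof (rule continuous_imp_measurable_on_sets_lebesgue)
      show "continuous_on ({0..T} \<times> cbox 0 1) (S n)"
        unfolding S_def
        by (intro continuous_intros continuous_on_compose2[OF d] continuous_on_compose2[OF e]) auto
      show "{0..T} \<times> cbox 0 (1 :: real^'n) \<in> sets lebesgue"
        by (metis borel_closed closed_Times closed_atLeastAtMost closed_cbox sets_completionI_sets sets_lborel)
    qed
    then have "(\<lambda>p. lim (\<lambda>n. S (r n) p)) \<in> borel_measurable (lebesgue_on ({0..T} \<times> cbox 0 1))"
      by (intro borel_measurable_lim_metric)
    then show ?thesis unfolding U_def F_def by (simp add: case_prod_beta')
  qed
  \<comment> \<open>Squared distance of the slices. Its integral over time tends to zero, hence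
    along a subsequence \<open>q\<close> it tends to zero at almost every time.\<close>
  define G where "G n t = (LINT x|\<nu>. (S n (t, x) - F (t, x))\<^sup>2)" for n t
  have G_int: "integrable \<mu> (G n)" for n unfolding G_def[abs_def] by (rule P.integrable_fst'[OF FS])
  have G0: "G n t \<ge> 0" for n t unfolding G_def by simp
  have "(LINT t|\<mu>. norm (G n t)) = (LINT p|(\<mu> \<Otimes>\<^sub>M \<nu>). (S n p - F p)\<^sup>2)" for n
    using P.integral_fst'[OF FS[of n]] G0[of n] by (simp add: G_def)
  then have "(\<lambda>n. LINT t|\<mu>. norm (G n t)) \<longlonglongrightarrow> 0" using r(3) unfolding F_def by simp
  then obtain q where q: "strict_mono (q :: nat \<Rightarrow> nat)" "AE t in \<mu>. (\<lambda>n. G (q n) t) \<longlonglongrightarrow> 0"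
    using tendsto_L1_AE_subseq[of \<mu> G, OF G_int] by blast
  have "AE t in \<mu>. L2_expansion e (\<lambda>k. d k t) (U t)"
    using q(2) P.AE_integrable_fst'[OF F2] AE_space
  proof eventually_elim
    case (elim t)
    define u where "u = U t"
    define s where "s n x = (\<Sum>k<q n. d k t * e k x)" for n x
    have un: "u \<in> borel_measurable \<nu>" unfolding u_def U_def using elim(3) by measurable
    have um: "u \<in> borel_measurable torus" by (rule to_nu(1)[OF un])
    have u2: "integrable torus (\<lambda>x. (u x)\<^sup>2)"
      using elim(2) un by (subst to_nu(2)) (auto simp: u_def U_def)
    have sn [measurable]: "s n \<in> borel_measurable \<nu>" for n unfolding s_def[abs_def] by measurable
    have sm: "s n \<in> borel_measurable torus" for n by (rule to_nu(1)[OF sn])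
    have s2: "integrable torus (\<lambda>x. (s n x)\<^sup>2)" for n
      unfolding s_def by (intro torus_integrable_cont continuous_intros e)
    have su2: "integrable torus (\<lambda>x. (s n x - u x)\<^sup>2)" for n by (intro L2_add sm um s2 u2)
    have su: "(\<lambda>n. LINT x|torus. (s n x - u x)\<^sup>2) \<longlonglongrightarrow> 0"
    proof -
      have "(LINT x|torus. (s n x - u x)\<^sup>2) = G (q n) t" for n
proof -
        have m: "(\<lambda>x. (s n x - u x)\<^sup>2) \<in> borel_measurable \<nu>" using un by measurable
        show ?thesis unfolding to_nu(3)[OF m] G_def by (simp add: s_def S_def u_def U_def)
      qed
      then show ?thesis using elim(1) by simp
    qed
    have weak: "(\<lambda>n. LINT x|torus. s n x * f x) \<longlonglongrightarrow> (LINT x|torus. u x * f x)"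
      if f: "f \<in> borel_measurable torus" "integrable torus (\<lambda>x. (f x)\<^sup>2)" for f
    proof -
      have fi: "integrable torus (\<lambda>x. s n x * f x)" "integrable torus (\<lambda>x. u x * f x)" for n
        by (intro L2_mult_integrable sm um s2 u2 f)+
      have le: "((LINT x|torus. s n x * f x) - (LINT x|torus. u x * f x))\<^sup>2 \<le> (LINT x|torus. (s n x - u x)\<^sup>2) * (LINT x|torus. (f x)\<^sup>2)" for n
      proof -
        have "(LINT x|torus. s n x * f x) - (LINT x|torus. u x * f x) = (LINT x|torus. (s n x - u x) * f x)"
          using fi by (simp add: left_diff_distrib)
        then show ?thesis
          using L2_Cauchy_Schwarz[OF borel_measurable_diff[OF sm[of n] um] f(1) su2 f(2)] by simp
      qed
      have lim: "(\<lambda>n. (LINT x|torus. (s n x - u x)\<^sup>2) * (LINT x|torus. (f x)\<^sup>2)) \<longlonglongrightarrow> 0"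
        using tendsto_mult[OF su tendsto_const] by simp
      have "(\<lambda>n. ((LINT x|torus. s n x * f x) - (LINT x|torus. u x * f x))\<^sup>2) \<longlonglongrightarrow> 0"
        by (rule real_tendsto_sandwich[OF always_eventually always_eventually tendsto_const lim])
           (intro allI zero_le_power2, intro allI le)
      then have "(\<lambda>n. sqrt (((LINT x|torus. s n x * f x) - (LINT x|torus. u x * f x))\<^sup>2)) \<longlonglongrightarrow> sqrt 0"
        by (rule tendsto_real_sqrt)
      then have "(\<lambda>n. (LINT x|torus. s n x * f x) - (LINT x|torus. u x * f x)) \<longlonglongrightarrow> 0"
        by (simp only: real_sqrt_abs real_sqrt_zero tendsto_rabs_zero_iff)
      then show ?thesis by (simp add: LIM_zero_iff)
    qed
    have sf: "(LINT x|torus. s n x * f x) = (\<Sum>k<q n. d k t * (LINT x|torus. f x * e k x))"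
      if f: "f \<in> borel_measurable torus" "integrable torus (\<lambda>x. (f x)\<^sup>2)" for f n
    proof -
      have fi: "integrable torus (\<lambda>x. f x * e k x)" for k by (intro L2_mult_integrable f em e2)
      have "(LINT x|torus. s n x * f x) = (LINT x|torus. (\<Sum>k<q n. d k t * (f x * e k x)))"
        unfolding s_def sum_distrib_right by (simp add: mult_ac)
      then show ?thesis using fi by simp
    qed
    have s_norm: "(LINT x|torus. (s n x)\<^sup>2) = (\<Sum>k<q n. (d k t)\<^sup>2)" for n
      unfolding s_def by (rule Pythagoras_sum) (use em e2 on in auto)
    have lim2: "(\<lambda>n. \<Sum>k<q n. (d k t)\<^sup>2) \<longlonglongrightarrow> (LINT x|torus. (u x)\<^sup>2)"
    proof -
      have "(\<Sum>k<q n. (d k t)\<^sup>2) = (LINT x|torus. (s n x - u x)\<^sup>2) + 2 * (LINT x|torus. s n x * u x) - (LINT x|torus. (u x)\<^sup>2)" for n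
        unfolding s_norm[symmetric] using L2_mult_integrable[OF sm um s2 u2, of n] s2[of n] u2
        by (simp add: power2_diff mult.assoc)
      moreover have "(\<lambda>n. (LINT x|torus. (s n x - u x)\<^sup>2) + 2 * (LINT x|torus. s n x * u x) - (LINT x|torus. (u x)\<^sup>2)) \<longlonglongrightarrow> 0 + 2 * (LINT x|torus. u x * u x) - (LINT x|torus. (u x)\<^sup>2)"
        by (intro tendsto_intros su weak um u2)
      ultimately show ?thesis by (simp add: power2_eq_square)
    qed
    have dle: "(\<Sum>k<n. (d k t)\<^sup>2) \<le> (LINT x|torus. (u x)\<^sup>2)" for n
    proof (rule LIMSEQ_le_const[OF lim2], intro exI[of _ n] allI impI)
      fix m assume "n \<le> m"
      then have "n \<le> q m" using seq_suble[OF q(1), of m] by linarith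
      then show "(\<Sum>k<n. (d k t)\<^sup>2) \<le> (\<Sum>k<q m. (d k t)\<^sup>2)" by (intro sum_mono2) auto
    qed
    \<comment> \<open>The partial sums are known to converge only along \<open>q\<close>;
      summability, obtained from square summable coefficients, upgrades this to convergence of the
      series.\<close>
    have sums_of: "g sums l" if "summable g" "(\<lambda>n. \<Sum>k<q n. g k) \<longlonglongrightarrow> l" for g :: "nat \<Rightarrow> real" and l
    proof -
      have "(\<lambda>n. \<Sum>k<q n. g k) \<longlonglongrightarrow> suminf g"
        using LIMSEQ_subseq_LIMSEQ[OF summable_LIMSEQ[OF that(1)] q(1)] by (simp add: comp_def)
      then have "suminf g = l" using that(2) by (rule LIMSEQ_unique)
      then show ?thesis using summable_sums[OF that(1)] by simp
    qed
    have "summable (\<lambda>k. (d k t)\<^sup>2)"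
      by (rule bounded_imp_summable[where B="LINT x|torus. (u x)\<^sup>2"]) (use dle[of "Suc _"] in \<open>simp_all add: lessThan_Suc_atMost\<close>)
    then have 1: "(\<lambda>k. (d k t)\<^sup>2) sums (LINT x|torus. (u x)\<^sup>2)" by (rule sums_of[OF _ lim2])
    have 2: "(\<lambda>k. d k t * (LINT x|torus. f x * e k x)) sums (LINT x|torus. u x * f x)"
      if f: "f \<in> borel_measurable torus" "integrable torus (\<lambda>x. (f x)\<^sup>2)" for f
    proof (rule sums_of)
      show "(\<lambda>n. \<Sum>k<q n. d k t * (LINT x|torus. f x * e k x)) \<longlonglongrightarrow> (LINT x|torus. u x * f x)"
        using weak[OF f] unfolding sf[OF f] .
      have "summable (\<lambda>k. (LINT x|torus. f x * e k x) * d k t)"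
      proof (rule ell2_weak_limit(1)[where m=id and x="\<lambda>_ k. d k t"])
        show "(\<Sum>k<n. (LINT x|torus. f x * e k x)\<^sup>2) \<le> (LINT x|torus. (f x)\<^sup>2)" for n
          by (rule Bessel_inequality) (use f em e2 on in auto)
        show "(\<Sum>k<id n. (d k t)\<^sup>2) \<le> (LINT x|torus. (u x)\<^sup>2)" for n using dle by simp
      qed (auto simp: filterlim_ident id_def)
      then show "summable (\<lambda>k. d k t * (LINT x|torus. f x * e k x))" by (simp add: mult.commute)
    qed
    show ?case using um u2 1 2 unfolding u_def L2_expansion_def by blast
  qed
  then have "AE t in lebesgue_on {0..T}. L2_expansion e (\<lambda>k. d k t) (U t)"
    unfolding \<mu>_def by (subst AE_lebesgue_on_iff) auto
  then show ?thesis by (rule that[OF Uper Umeas])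
qed

section \<open>Smooth test functions\<close>

lemma C_k_cont: "C_k k f \<Longrightarrow> continuous_on UNIV f"
  by (cases k) (auto intro: differentiable_imp_continuous_on)

lemma C_k_SucI:
  assumes "\<And>z. (f has_derivative f' z) (at z)" "\<And>v. C_k k (\<lambda>z. f' z v)"
  shows "C_k (Suc k) f"
proof -
  have "frechet_derivative f (at z) = f' z" for z
    using frechet_derivative_at[OF assms(1)] by simp
  moreover have "f differentiable_on UNIV"
    unfolding differentiable_on_def differentiable_def using assms(1) by auto
  ultimately show ?thesis using assms(2) by simp
qed

lemma C_k_SucD:
  assumes "C_k (Suc k) f"
  shows "(f has_derivative frechet_derivative f (at z)) (at z)" "C_k k (\<lambda>z. frechet_derivative f (at z) v)"
  using assms by (auto simp: differentiable_on_def frechet_derivative_works)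

lemma C_k_Suc_imp: "C_k (Suc k) f \<Longrightarrow> C_k k f"
proof (induction k arbitrary: f)
  case 0
  then show ?case using C_k_cont[OF 0] by simp
next
  case (Suc k)
  show ?case by (rule C_k_SucI[OF C_k_SucD(1)[OF Suc.prems]]) (rule Suc.IH[OF C_k_SucD(2)[OF Suc.prems]])
qed

lemma C_k_const: "C_k k (\<lambda>z. c)"
proof (induction k arbitrary: c)
  case (Suc k)
  show ?case by (rule C_k_SucI[OF has_derivative_const Suc])
qed simp

lemma C_k_add: "C_k k f \<Longrightarrow> C_k k g \<Longrightarrow> C_k k (\<lambda>z. f z + g z)"
proof (induction k arbitrary: f g)
  case (Suc k)
  show ?case
    by (rule C_k_SucI[OF has_derivative_add[OF C_k_SucD(1)[OF Suc.prems(1)] C_k_SucD(1)[OF Suc.prems(2)]]])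
       (rule Suc.IH[OF C_k_SucD(2)[OF Suc.prems(1)] C_k_SucD(2)[OF Suc.prems(2)]])
qed (simp add: continuous_on_add)

lemma C_k_mult: "C_k k f \<Longrightarrow> C_k k g \<Longrightarrow> C_k k (\<lambda>z. f z * g z)"
proof (induction k arbitrary: f g)
  case (Suc k)
  show ?case
    by (rule C_k_SucI[OF has_derivative_mult[OF C_k_SucD(1)[OF Suc.prems(1)] C_k_SucD(1)[OF Suc.prems(2)]]])
       (intro C_k_add Suc.IH C_k_Suc_imp[OF Suc.prems(1)] C_k_Suc_imp[OF Suc.prems(2)] C_k_SucD(2)[OF Suc.prems(1)] C_k_SucD(2)[OF Suc.prems(2)])
qed (simp add: continuous_on_mult)

text \<open>Affine inner maps are enough for the test functions built here: these are products of
  one-variable functions composed with projections, scalings and x -> m . x.\<close>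

lemma C_k_affine:
  fixes L :: "'a::euclidean_space \<Rightarrow> 'b::euclidean_space"
  assumes L: "bounded_linear L"
  shows "C_k k f \<Longrightarrow> C_k k (\<lambda>z. f (a + L z))"
proof (induction k arbitrary: f)
  case 0
  have "continuous_on UNIV (\<lambda>z. a + L z)" by (intro continuous_intros linear_continuous_on L)
  then show ?case using 0 by (auto intro: continuous_on_compose2[of UNIV f])
next
  case (Suc k)
  show ?case
  proof (rule C_k_SucI)
    fix z
    have "((\<lambda>z. a + L z) has_derivative L) (at z)"
      using has_derivative_add[OF has_derivative_const bounded_linear_imp_has_derivative[OF L]] by simp
    then show "((\<lambda>z. f (a + L z)) has_derivative (\<lambda>v. frechet_derivative f (at (a + L z)) (L v))) (at z)"
      using C_k_SucD(1)[OF Suc.prems] by (rule has_derivative_compose)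
  next
    fix v
    show "C_k k (\<lambda>z. frechet_derivative f (at (a + L z)) (L v))"
      using Suc.IH[OF C_k_SucD(2)[OF Suc.prems, of "L v"]] .
  qed
qed

lemma C_k_real:
  fixes f f' :: "real \<Rightarrow> real"
  assumes "\<And>x. (f has_real_derivative f' x) (at x)" "C_k k f'"
  shows "C_k (Suc k) f"
proof (rule C_k_SucI)
  show "(f has_derivative (\<lambda>v. f' z * v)) (at z)" for z
    using assms(1)[of z] by (simp add: has_field_derivative_def)
  show "C_k k (\<lambda>z. f' z * v)" for v by (intro C_k_mult C_k_const assms)
qed

lemma C_k_trig: "C_k k (\<lambda>x::real. a * cos x + b * sin x)"
proof (induction k arbitrary: a b)
  case 0
  show ?case by (auto intro!: continuous_intros)
next
  case (Suc k)
  show ?case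
    by (rule C_k_real[OF _ Suc[of b "- a"]]) (auto intro!: derivative_eq_intros)
qed

section \<open>Smooth cutoffs in time\<close>

definition flat :: "nat \<Rightarrow> real \<Rightarrow> real" where
  "flat m x = (if x \<le> 0 then 0 else exp (- 1 / x) / x ^ m)"

lemma flat_tendsto_0: "(flat m \<longlongrightarrow> 0) (at 0)"
proof (rule filterlim_split_at)
  show "(flat m \<longlongrightarrow> 0) (at_left 0)"
  proof (rule tendsto_eventually)
    show "\<forall>\<^sub>F x in at_left 0. flat m x = 0"
      by (rule eventually_at_leftI[of "-1"]) (auto simp: flat_def)
  qed
  show "(flat m \<longlongrightarrow> 0) (at_right 0)"
    unfolding filterlim_at_right_to_top
  proof (rule Lim_transform_eventually)
    show "((\<lambda>x::real. x ^ m / exp x) \<longlongrightarrow> 0) at_top" by (rule tendsto_power_div_exp_0)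
    show "\<forall>\<^sub>F x in at_top. x ^ m / exp x = flat m (inverse x)"
      using eventually_gt_at_top[of 0]
      by eventually_elim (auto simp: flat_def exp_minus field_simps power_inverse)
  qed
qed

text \<open>The functions exp(-1/x) / x^m, extended by zero, are closed under differentiation up to
  linear combinations. The parameter m exists for this reason: the cutoff uses m = 0, but the
  induction on the order of smoothness visits all m.\<close>

lemma flat_deriv: "(flat m has_real_derivative flat (m + 2) x - real m * flat (Suc m) x) (at x)"
proof -
  consider "x > 0" | "x = 0" | "x < 0" by linarith
  then show ?thesis
  proof cases
    case 1
    have "((\<lambda>x. exp (- 1 / x) / x ^ m) has_real_derivative flat (m + 2) x - real m * flat (Suc m) x) (at x)"
    proof -
      have e: "((\<lambda>x. exp (- 1 / x)) has_real_derivative exp (- 1 / x) * (1 / x\<^sup>2)) (at x)"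
        using 1 by (auto intro!: derivative_eq_intros simp: power2_eq_square)
      have "x ^ m \<noteq> 0" using 1 by simp
      from DERIV_divide[OF e DERIV_pow[of m] this] show ?thesis
        by (rule DERIV_cong) (use 1 in \<open>cases m; simp add: flat_def field_simps power2_eq_square\<close>)
    qed
    then show ?thesis
      by (rule has_field_derivative_transform_within_open[of _ _ _ "{0<..}"]) (use 1 in \<open>auto simp: flat_def\<close>)
  next
    case 2
    \<comment> \<open>At zero the difference quotient of \<open>flat m\<close> is
      \<open>flat (Suc m)\<close> itself, so its limit is already known.\<close>
    have "((\<lambda>h. (flat m h - flat m 0) / (h - 0)) \<longlongrightarrow> 0) (at 0)"
    proof (rule Lim_transform_eventually[OF flat_tendsto_0[of "Suc m"]])
      show "\<forall>\<^sub>F h in at 0. flat (Suc m) h = (flat m h - flat m 0) / (h - 0)"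
        by (rule always_eventually) (auto simp: flat_def)
    qed
    then have "(flat m has_real_derivative 0) (at 0)" unfolding has_field_derivative_iff .
    then show ?thesis using 2 by (simp add: flat_def)
  next
    case 3
    have "((\<lambda>x. 0) has_real_derivative 0) (at x)" by simp
    then have "(flat m has_real_derivative 0) (at x)"
      by (rule has_field_derivative_transform_within_open[of _ _ _ "{..<0}"]) (use 3 in \<open>auto simp: flat_def\<close>)
    then show ?thesis using 3 by (simp add: flat_def)
  qed
qed

lemma C_k_flat: "C_k k (flat m)"
proof (induction k arbitrary: m)
  case 0
  show ?case by (auto intro!: DERIV_continuous_on flat_deriv)
next
  case (Suc k)
  have "C_k k (\<lambda>x. flat (m + 2) x + (- real m) * flat (Suc m) x)" by (intro C_k_add C_k_mult C_k_const Suc)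
  then have "C_k k (\<lambda>x. flat (m + 2) x - real m * flat (Suc m) x)" by simp
  then show ?case by (rule C_k_real[OF flat_deriv])
qed

text \<open>As \<open>flat 0\<close> increases to 1 at infinity, the cutoffs tend to the indicator
  of the open interval from s to t, while each of them vanishes within distance 1 / (n + 1) of both
  ends.\<close>

definition cutoff :: "real \<Rightarrow> real \<Rightarrow> nat \<Rightarrow> real \<Rightarrow> real" where
  "cutoff s t n r = flat 0 (real (Suc n) * (r - s) - 1) * flat 0 (real (Suc n) * (t - r) - 1)"

lemma flat0_bounds: "0 \<le> flat 0 x" "flat 0 x \<le> 1"
  by (auto simp: flat_def)

lemma cutoff_bounds: "0 \<le> cutoff s t n r" "cutoff s t n r \<le> 1"
  unfolding cutoff_def using flat0_bounds by (auto intro: mult_le_one)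

lemma cutoff_support: "cutoff s t n r \<noteq> 0 \<Longrightarrow> s + 1 / real (Suc n) < r \<and> r < t - 1 / real (Suc n)"
  unfolding cutoff_def flat_def by (auto split: if_splits simp: field_simps)

lemma cutoff_C_k: "C_k k (cutoff s t n)"
proof -
  have 1: "bounded_linear (\<lambda>r::real. real (Suc n) * r)" by (rule bounded_linear_mult_right)
  have 2: "bounded_linear (\<lambda>r::real. - real (Suc n) * r)" by (rule bounded_linear_mult_right)
  have "C_k k (\<lambda>r. flat 0 ((- real (Suc n) * s - 1) + real (Suc n) * r) * flat 0 ((real (Suc n) * t - 1) + - real (Suc n) * r))"
    by (intro C_k_mult C_k_affine[OF 1 C_k_flat] C_k_affine[OF 2 C_k_flat])
  moreover have "(\<lambda>r. flat 0 ((- real (Suc n) * s - 1) + real (Suc n) * r) * flat 0 ((real (Suc n) * t - 1) + - real (Suc n) * r)) = cutoff s t n"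
    by (rule ext) (simp add: cutoff_def algebra_simps)
  ultimately show ?thesis by simp
qed

lemma cutoff_tendsto: "(\<lambda>n. cutoff s t n r) \<longlonglongrightarrow> indicat_real {s<..<t} r"
proof (cases "r \<in> {s<..<t}")
  case True
  have "(\<lambda>n. flat 0 (real (Suc n) * c - 1)) \<longlonglongrightarrow> 1" if c: "c > 0" for c
  proof -
    have 1: "filterlim (\<lambda>n. real (Suc n) * c - 1) at_top sequentially" using c by real_asymp
    have "((\<lambda>x::real. exp (- 1 / x)) \<longlongrightarrow> 1) at_top" by real_asymp
    then have "(\<lambda>n. exp (- 1 / (real (Suc n) * c - 1))) \<longlonglongrightarrow> 1" by (rule filterlim_compose[OF _ 1])
    moreover have "\<forall>\<^sub>F n in sequentially. exp (- 1 / (real (Suc n) * c - 1)) = flat 0 (real (Suc n) * c - 1)"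
      using 1[unfolded filterlim_at_top_dense, rule_format, of 0] by eventually_elim (simp add: flat_def)
    ultimately show ?thesis by (rule Lim_transform_eventually)
  qed
  then have "(\<lambda>n. cutoff s t n r) \<longlonglongrightarrow> 1 * 1" unfolding cutoff_def using True by (intro tendsto_mult) auto
  then show ?thesis using True by simp
next
  case False
  have "cutoff s t n r = 0" for n
  proof (rule ccontr)
    assume "cutoff s t n r \<noteq> 0"
    moreover have "1 / real (Suc n) > 0" by simp
    ultimately have "s < r \<and> r < t" using cutoff_support[of s t n r] by linarith
    then show False using False by simp
  qed
  then show ?thesis using False by simp
qed

lemma cas_C_k: "C_k k (cas m)"
proof -
  have L: "bounded_linear (\<lambda>x. 2 * pi * (m \<bullet> x))"
    by (intro bounded_linear_const_mult bounded_linear_inner_right)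
  have "C_k k (\<lambda>x. 1 * cos (0 + 2 * pi * (m \<bullet> x)) + 1 * sin (0 + 2 * pi * (m \<bullet> x)))"
    by (rule C_k_affine[OF L C_k_trig])
  then show ?thesis unfolding cas_def[abs_def] by simp
qed

lemma cas_has_derivative: "(cas m has_derivative (\<lambda>v. 2 * pi * (m \<bullet> v) * cas (- m) x)) (at x)"
  unfolding cas_uminus unfolding cas_def[abs_def]
  by (auto intro!: derivative_eq_intros simp: algebra_simps)

lemma test_product_smooth:
  fixes m :: "real^'n"
  shows "smooth (\<lambda>z. cutoff s t n (fst z) * cas m (snd z))"
  unfolding smooth_def
proof
  fix k
  have "C_k k (\<lambda>z :: real \<times> (real^'n). cutoff s t n (0 + fst z) * cas m (0 + snd z))"
    by (intro C_k_mult C_k_affine bounded_linear_fst bounded_linear_snd cutoff_C_k cas_C_k)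
  then show "C_k k (\<lambda>z. cutoff s t n (fst z) * cas m (snd z))" by simp
qed

lemma test_product_grad:
  fixes m :: "real^'n"
  shows
  "space_grad (\<lambda>z. cutoff s t n (fst z) * cas m (snd z)) (r, x) = (cutoff s t n r * (2 * pi * cas (- m) x)) *\<^sub>R m"
proof -
  let ?f = "\<lambda>z :: real \<times> (real^'n). cutoff s t n (fst z) * cas m (snd z)"
  obtain D where D: "(cutoff s t n has_derivative D) (at r)"
    using C_k_SucD(1)[OF cutoff_C_k[of "Suc 0"]] by blast
  have 1: "((\<lambda>z. cutoff s t n (fst z)) has_derivative (\<lambda>v. D (fst v))) (at (r, x))"
    by (rule has_derivative_compose[OF bounded_linear_imp_has_derivative[OF bounded_linear_fst], where g="cutoff s t n"]) (simp add: D)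
  have 2: "((\<lambda>z. cas m (snd z)) has_derivative (\<lambda>v. 2 * pi * (m \<bullet> snd v) * cas (- m) x)) (at (r, x))"
    using has_derivative_compose[OF bounded_linear_imp_has_derivative[OF bounded_linear_snd], of "cas m" _ "(r, x)" UNIV] cas_has_derivative[of m x]
    by simp
  have "(?f has_derivative (\<lambda>v. cutoff s t n r * (2 * pi * (m \<bullet> snd v) * cas (- m) x) + D (fst v) * cas m x)) (at (r, x))"
    using has_derivative_mult[OF 1 2] by simp
  then have "frechet_derivative ?f (at (r, x)) = (\<lambda>v. cutoff s t n r * (2 * pi * (m \<bullet> snd v) * cas (- m) x) + D (fst v) * cas m x)"
    by (rule frechet_derivative_at[symmetric])
  moreover have "D 0 = 0" using has_derivative_linear[OF D] by (rule linear_0)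
  ultimately show ?thesis
    unfolding space_grad_def dir_deriv_def by (simp add: vec_eq_iff inner_axis)
qed

lemma test_product_mem:
  fixes m :: "real^'n"
  assumes "0 \<le> s" "t \<le> T" "m \<in> Zvec"
  shows "(\<lambda>z. cutoff s t n (fst z) * cas m (snd z)) \<in> test_functions {0<..<T}"
  unfolding test_functions_def
\<comment> \<open>The margin makes this interval a compact subset of the open time interval even for
  s = 0 and t = T; it may be empty.\<close>
proof (intro CollectI conjI test_product_smooth allI exI[of _ "{s + 1 / real (Suc n)..t - 1 / real (Suc n)}"] ballI)
  show "periodic (\<lambda>x. cutoff s t n (fst (r, x)) * cas m (snd (r, x)))" for r
    using cas_periodic[OF assms(3)] unfolding periodic_def by simp
  have "1 / real (Suc n) > 0" by simp
  then show "{s + 1 / real (Suc n)..t - 1 / real (Suc n)} \<subseteq> {0<..<T}" using assms by (intro subsetI) (simp only: atLeastAtMost_iff greaterThanLessThan_iff, linarith)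
  show "cutoff s t n (fst (r, x)) * cas m (snd (r, x)) = 0" if "r \<in> {0<..<T} - {s + 1 / real (Suc n)..t - 1 / real (Suc n)}" for r x
  proof -
    have "cutoff s t n r = 0"
    proof (rule ccontr)
      assume "cutoff s t n r \<noteq> 0"
      from cutoff_support[OF this] that show False unfolding Diff_iff atLeastAtMost_iff by (blast intro: less_imp_le)
    qed
    then show ?thesis by simp
  qed
qed simp

section \<open>Consequences of vanishing divergence\<close>

lemma complete_lebesgue_on:
  fixes S :: "'a::euclidean_space set"
  assumes S: "S \<in> sets lebesgue"
  shows "complete_measure (lebesgue_on S)"
proof
  fix A B :: "'a set" assume "B \<subseteq> A" "A \<in> null_sets (lebesgue_on S)"
  then have "A \<in> null_sets lebesgue" "A \<subseteq> S" using S by (auto simp: null_sets_restrict_space)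
  then have "B \<in> null_sets lebesgue" using \<open>B \<subseteq> A\<close> by (meson null_sets_completion_subset)
  then show "B \<in> sets (lebesgue_on S)"
    using \<open>B \<subseteq> A\<close> \<open>A \<subseteq> S\<close> S by (auto simp: sets_restrict_space_iff)
qed

text \<open>Completeness makes measurability insensitive to null sets of times. This matters because
  square integrability of \<open>b\<close> and of the limit in space is known only at almost every
  time.\<close>

lemma borel_measurable_AE_eq:
  assumes "complete_measure M" "g \<in> borel_measurable M" "AE x in M. f x = g x"
  shows "f \<in> borel_measurable M"
proof (rule measurableI)
  fix A :: "'b set" assume "A \<in> sets borel"
  then have "g -` A \<inter> space M \<in> sets M" using assms(2) by (rule measurable_sets[rotated])
  then show "f -` A \<inter> space M \<in> sets M"
  proof (rule complete_measure.in_sets_AE[OF assms(1), rotated])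
    show "AE x in M. x \<in> g -` A \<inter> space M \<longleftrightarrow> x \<in> f -` A \<inter> space M"
      using assms(3) by eventually_elim auto
  qed auto
qed simp

lemma torus_borel_measurable_inner:
  fixes v F :: "real^'n \<Rightarrow> real^'n"
  assumes "v \<in> borel_measurable torus" "continuous_on UNIV F"
  shows "(\<lambda>x. v x \<bullet> F x) \<in> borel_measurable torus"
  using assms(1) continuous_imp_torus_measurable[OF assms(2)] by (rule borel_measurable_inner)

text \<open>The field is measurable for the completed measure on the product, so its slices need not
  be measurable. A Borel function equal to it almost everywhere has slice integrals that depend
  measurably on time, and by Fubini they agree with those of the field at almost every time.\<close>

lemma inner_integral_measurable:
  fixes b :: "real \<Rightarrow> real^'n \<Rightarrow> real^'n" and F :: "real^'n \<Rightarrow> real^'n"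
  assumes b: "space_time_fun T b" and bt: "AE t in lebesgue_on {0..T}. b t \<in> borel_measurable torus"
    and F: "continuous_on UNIV F"
  shows "(\<lambda>t. LINT x|torus. b t x \<bullet> F x) \<in> borel_measurable (lebesgue_on {0..T})"
proof -
  let ?Q = "{0..T} \<times> cbox 0 (1 :: real^'n)"
  have Q: "?Q \<in> sets lebesgue"
    by (metis borel_closed closed_Times closed_atLeastAtMost closed_cbox sets_completionI_sets sets_lborel)
  have "(\<lambda>p. F (snd p)) \<in> borel_measurable (lebesgue_on ?Q)"
    by (rule continuous_imp_measurable_on_sets_lebesgue[OF _ Q]) (intro continuous_on_compose2[OF F] continuous_intros; auto)
  moreover have "(\<lambda>p. b (fst p) (snd p)) \<in> borel_measurable (lebesgue_on ?Q)"
    using b unfolding space_time_fun_def by (simp add: case_prod_beta')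
  ultimately have "(\<lambda>p. b (fst p) (snd p) \<bullet> F (snd p)) \<in> borel_measurable (lebesgue_on ?Q)"
    by (intro borel_measurable_inner)
  then have "(\<lambda>p. indicat_real ?Q p *\<^sub>R (b (fst p) (snd p) \<bullet> F (snd p))) \<in> borel_measurable lebesgue"
    using Q by (subst (asm) borel_measurable_restrict_space_iff) (auto simp: mult.commute)
  then obtain g where g: "g \<in> borel_measurable lborel"
    "AE p in lborel. indicat_real ?Q p *\<^sub>R (b (fst p) (snd p) \<bullet> F (snd p)) = g p"
    using completion_ex_borel_measurable_real by blast
  have gm: "g \<in> borel_measurable (lborel \<Otimes>\<^sub>M lborel)" using g(1) by (simp add: lborel_prod)
  have "AE p in lborel \<Otimes>\<^sub>M lborel. indicat_real ?Q p *\<^sub>R (b (fst p) (snd p) \<bullet> F (snd p)) = g p"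
    using g(2) by (simp only: lborel_prod)
  then have ae: "AE t in lborel. AE x in lborel. indicat_real ?Q (t, x) *\<^sub>R (b t x \<bullet> F x) = g (t, x)"
    using lborel_pair.AE_pair by fastforce
  define W where "W t = (LINT x|lborel. g (t, x))" for t
  have "W \<in> borel_measurable lborel" unfolding W_def[abs_def]
    using gm by (intro lborel.borel_measurable_lebesgue_integral) (simp add: case_prod_beta')
  then have Wm: "W \<in> borel_measurable (lebesgue_on {0..T})"
    by (intro measurable_restrict_space1 measurable_completion)
  have ae2: "AE t in lebesgue_on {0..T}. t \<in> {0..T} \<longrightarrow> (AE x in lborel. indicat_real ?Q (t, x) *\<^sub>R (b t x \<bullet> F x) = g (t, x))"
    using AE_completion[OF ae] by (subst AE_restrict_space_iff) auto
  have "AE t in lebesgue_on {0..T}. (LINT x|torus. b t x \<bullet> F x) = W t"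
    using ae2 bt AE_space
  proof eventually_elim
    case (elim t)
    then have t: "t \<in> {0..T}" by simp
    have m: "(\<lambda>x. b t x \<bullet> F x) \<in> borel_measurable torus" by (rule torus_borel_measurable_inner[OF elim(2) F])
    have hm: "(\<lambda>x. indicat_real (cbox 0 1) x *\<^sub>R (b t x \<bullet> F x)) \<in> borel_measurable lebesgue"
      using m unfolding torus_def by (subst (asm) borel_measurable_restrict_space_iff) (auto simp: mult.commute)
    have gt: "(\<lambda>x. g (t, x)) \<in> borel_measurable lborel" using gm by measurable
    have "(LINT x|torus. b t x \<bullet> F x) = (LINT x|lebesgue. indicat_real (cbox 0 1) x *\<^sub>R (b t x \<bullet> F x))"
      unfolding torus_def by (rule integral_restrict_space) simp
    also have "\<dots> = (LINT x|lebesgue. g (t, x))"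
    proof (rule integral_cong_AE[OF hm])
      show "(\<lambda>x. g (t, x)) \<in> borel_measurable lebesgue" using gt by (rule measurable_completion)
      have "AE x in lborel. indicat_real ?Q (t, x) *\<^sub>R (b t x \<bullet> F x) = g (t, x)" using elim t by simp
      then have "AE x in lebesgue. indicat_real ?Q (t, x) *\<^sub>R (b t x \<bullet> F x) = g (t, x)" by (rule AE_completion)
      then show "AE x in lebesgue. indicat_real (cbox 0 1) x *\<^sub>R (b t x \<bullet> F x) = g (t, x)"
        by eventually_elim (use t in \<open>auto simp: indicator_def\<close>)
    qed
    also have "\<dots> = W t" unfolding W_def by (rule integral_completion[OF gt])
    finally show ?case .
  qed
  then show ?thesis by (intro borel_measurable_AE_eq[OF complete_lebesgue_on Wm]) auto
qed

lemma torus_L2_norm_le: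
  fixes v :: "real^'n \<Rightarrow> 'b::euclidean_space"
  assumes v: "v \<in> torus_L2"
  shows "integrable torus (\<lambda>x. norm (v x))" "(LINT x|torus. norm (v x)) \<le> L2_torus_norm v"
proof -
  have m: "(\<lambda>x. norm (v x)) \<in> borel_measurable torus" and i: "integrable torus (\<lambda>x. (norm (v x))\<^sup>2)"
    using v unfolding torus_L2_def by auto
  have i1: "integrable torus (\<lambda>x::real^'n. (1::real)\<^sup>2)" by simp
  show "integrable torus (\<lambda>x. norm (v x))"
    using L2_mult_integrable[OF m borel_measurable_const i i1] by simp
  have "(LINT x|torus. norm (v x))\<^sup>2 \<le> (LINT x|torus. (norm (v x))\<^sup>2)"
    using L2_Cauchy_Schwarz[OF m borel_measurable_const i i1] by simp
  then show "(LINT x|torus. norm (v x)) \<le> L2_torus_norm v"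
    unfolding L2_torus_norm_def by (rule real_le_rsqrt)
qed

lemma torus_L2_inner_bound:
  fixes v F :: "real^'n \<Rightarrow> real^'n"
  assumes v: "v \<in> torus_L2" and F: "continuous_on UNIV F" "\<And>x. x \<in> cbox 0 1 \<Longrightarrow> norm (F x) \<le> C"
  shows "integrable torus (\<lambda>x. v x \<bullet> F x)" "\<bar>LINT x|torus. v x \<bullet> F x\<bar> \<le> C * L2_torus_norm v"
proof -
  have "norm (F 0) \<le> C" by (rule F(2)) (auto simp: mem_box_cart)
  then have C: "C \<ge> 0" using norm_ge_zero[of "F 0"] by linarith
  have b: "\<bar>v x \<bullet> F x\<bar> \<le> C * norm (v x)" if "x \<in> cbox 0 1" for x
  proof -
    have "\<bar>v x \<bullet> F x\<bar> \<le> norm (v x) * norm (F x)" by (rule Cauchy_Schwarz_ineq2)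
    also have "\<dots> \<le> norm (v x) * C" using F(2)[OF that] by (intro mult_left_mono) auto
    finally show ?thesis by (simp add: mult.commute)
  qed
  have i: "integrable torus (\<lambda>x. C * norm (v x))" using torus_L2_norm_le(1)[OF v] by simp
  have m: "(\<lambda>x. v x \<bullet> F x) \<in> borel_measurable torus"
    using v F unfolding torus_L2_def by (intro torus_borel_measurable_inner) auto
  show i2: "integrable torus (\<lambda>x. v x \<bullet> F x)"
    by (rule Bochner_Integration.integrable_bound[OF i m]) (use b in \<open>auto intro!: AE_I2 simp: C\<close>)
  have "\<bar>LINT x|torus. v x \<bullet> F x\<bar> \<le> (LINT x|torus. \<bar>v x \<bullet> F x\<bar>)" by (rule integral_abs_bound)
  also have "\<dots> \<le> (LINT x|torus. C * norm (v x))"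
    using b i2 i by (intro integral_mono) auto
  also have "\<dots> \<le> C * L2_torus_norm v" using torus_L2_norm_le(2)[OF v] C by (simp add: mult_left_mono)
  finally show "\<bar>LINT x|torus. v x \<bullet> F x\<bar> \<le> C * L2_torus_norm v" .
qed

lemma drift_integrable:
  fixes b :: "real \<Rightarrow> real^'n \<Rightarrow> real^'n"
  assumes b: "b \<in> bochner_Lp 1 T torus_L2 L2_torus_norm" and F: "continuous_on UNIV F"
  shows "integrable (lebesgue_on {0..T}) (\<lambda>t. LINT x|torus. b t x \<bullet> F x)"
proof -
  obtain C where C: "C \<ge> 0" "\<And>x. x \<in> cbox 0 1 \<Longrightarrow> norm (F x) \<le> C" using torus_bounded[OF F] by blast
  have L2: "AE t in lebesgue_on {0..T}. b t \<in> torus_L2" and st: "space_time_fun T b"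
    and i: "integrable (lebesgue_on {0..T}) (\<lambda>t. L2_torus_norm (b t))"
    using b unfolding bochner_Lp_def by auto
  show ?thesis
  proof (rule Bochner_Integration.integrable_bound)
    show "integrable (lebesgue_on {0..T}) (\<lambda>t. C * L2_torus_norm (b t))" using i by simp
    have "AE t in lebesgue_on {0..T}. b t \<in> borel_measurable torus"
      using L2 by eventually_elim (simp add: torus_L2_def)
    then show "(\<lambda>t. LINT x|torus. b t x \<bullet> F x) \<in> borel_measurable (lebesgue_on {0..T})"
      by (rule inner_integral_measurable[OF st _ F])
    show "AE t in lebesgue_on {0..T}. norm (LINT x|torus. b t x \<bullet> F x) \<le> norm (C * L2_torus_norm (b t))"
      using L2
    proof eventually_elim
      case (elim t)
      then show ?case using torus_L2_inner_bound(2)[OF elim F C(2)] by simp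
    qed
  qed
qed

text \<open>Testing with a cutoff in time multiplied by a mode in space, and letting the cutoff tend
  to an indicator, localises the divergence condition to an arbitrary time interval. This is the
  form on which the antisymmetry of the cell integrals depends.\<close>

lemma divergence_free_interval:
  fixes b :: "real \<Rightarrow> real^'n \<Rightarrow> real^'n"
  assumes b: "b \<in> bochner_Lp 1 T torus_L2 L2_torus_norm" and div: "divergence_free T b"
    and m: "m \<in> Zvec" and st: "0 \<le> s" "s \<le> t" "t \<le> T"
  shows "intv T s t (\<lambda>r. LINT x|torus. b r x \<bullet> ((2 * pi * cas (- m) x) *\<^sub>R m)) = 0"
proof -
  define W where "W r = (LINT x|torus. b r x \<bullet> ((2 * pi * cas (- m) x) *\<^sub>R m))" for r
  have W: "integrable (lebesgue_on {0..T}) W"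
    unfolding W_def[abs_def] by (intro drift_integrable[OF b] continuous_intros)
  have zero: "(LINT r|lebesgue_on {0..T}. cutoff s t n r * W r) = 0" for n
  proof -
    have "(LINT r|lebesgue_on {0..T}. LINT x|torus. b r x \<bullet> space_grad (\<lambda>z. cutoff s t n (fst z) * cas m (snd z)) (r, x)) = 0"
      using div test_product_mem[OF st(1,3) m] unfolding divergence_free_def by blast
    then show ?thesis unfolding test_product_grad W_def
      by (simp add: integral_mult_right_zero[symmetric] mult.assoc del: integral_mult_right_zero)
  qed
  have cm: "cutoff s t n \<in> borel_measurable (lebesgue_on {0..T})" for n
  proof -
    have "continuous_on UNIV (cutoff s t n)" using cutoff_C_k[of 0] by simp
    then have "continuous_on {0..T} (cutoff s t n)" by (rule continuous_on_subset) simp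
    then show ?thesis by (rule continuous_imp_measurable_on_sets_lebesgue) simp
  qed
  have "(\<lambda>n. LINT r|lebesgue_on {0..T}. cutoff s t n r * W r) \<longlonglongrightarrow> (LINT r|lebesgue_on {0..T}. indicat_real {s<..<t} r * W r)"
  proof (rule integral_dominated_convergence[where w="\<lambda>r. \<bar>W r\<bar>"])
    show "AE r in lebesgue_on {0..T}. (\<lambda>n. cutoff s t n r * W r) \<longlonglongrightarrow> indicat_real {s<..<t} r * W r"
      by (intro AE_I2 tendsto_intros cutoff_tendsto)
    show "AE r in lebesgue_on {0..T}. norm (cutoff s t n r * W r) \<le> \<bar>W r\<bar>" for n
      using cutoff_bounds[of s t n] by (intro AE_I2) (simp add: abs_mult mult_left_le_one_le)
    show "(\<lambda>r. cutoff s t n r * W r) \<in> borel_measurable (lebesgue_on {0..T})" for n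
      using W cm by (intro borel_measurable_times) auto
    have "(\<lambda>r. indicat_real {s<..<t} r) \<in> borel_measurable (lebesgue_on {0..T})"
      by (intro measurable_restrict_space1 measurable_completion) simp
    then show "(\<lambda>r. indicat_real {s<..<t} r * W r) \<in> borel_measurable (lebesgue_on {0..T})"
      using W by (intro borel_measurable_times) auto
    show "integrable (lebesgue_on {0..T}) (\<lambda>r. \<bar>W r\<bar>)" using W by simp
  qed
  then have 0: "(LINT r|lebesgue_on {0..T}. indicat_real {s<..<t} r * W r) = 0" unfolding zero by (simp add: LIMSEQ_const_iff)
  have "intv T s t W = (LINT r|lebesgue_on {0..T}. indicat_real {s<..<t} r * W r)"
  proof (rule integral_cong_AE)
    show "(\<lambda>r. indicat_real {s<..t} r * W r) \<in> borel_measurable (lebesgue_on {0..T})"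
      using integrable_Ioc[OF W] by blast
    have "(\<lambda>r. indicat_real {s<..<t} r) \<in> borel_measurable (lebesgue_on {0..T})"
      by (intro measurable_restrict_space1 measurable_completion) simp
    then show "(\<lambda>r. indicat_real {s<..<t} r * W r) \<in> borel_measurable (lebesgue_on {0..T})"
      using W by (intro borel_measurable_times) auto
    have "AE r in lebesgue. r \<noteq> t" by (intro AE_completion AE_lborel_singleton)
    then have "AE r in lebesgue_on {0..T}. r \<noteq> t" by (subst AE_restrict_space_iff) auto
    then show "AE r in lebesgue_on {0..T}. indicat_real {s<..t} r * W r = indicat_real {s<..<t} r * W r"
      by eventually_elim (auto simp: indicator_def)
  qed
  then show ?thesis using 0 unfolding W_def by simp
qed

section \<open>Fourier coefficients of test functions\<close>

text \<open>As \<open>c\<close> is only an indefinite integral, the product rule is replaced by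
  Fubini on the triangle \<open>0 < s \<le> t \<le> T\<close>. The condition
  \<open>\<theta> T = 0\<close> removes the terminal term, so only the initial value
  remains.\<close>

lemma time_integration_by_parts:
  fixes H \<theta> \<theta>' c :: "real \<Rightarrow> real"
  assumes T: "T > 0" and H: "integrable (lebesgue_on {0..T}) H"
    and \<theta>: "\<And>t. (\<theta> has_real_derivative \<theta>' t) (at t)" and \<theta>': "continuous_on UNIV \<theta>'" and \<theta>T: "\<theta> T = 0"
    and c: "\<And>t. t \<in> {0..T} \<Longrightarrow> c t = a + intv T 0 t H"
  shows "integrable (lebesgue_on {0..T}) (\<lambda>t. \<theta>' t * c t + \<theta> t * H t)"
    "(LINT t|lebesgue_on {0..T}. \<theta>' t * c t + \<theta> t * H t) = - \<theta> 0 * a"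
proof -
  let ?L = "lebesgue_on {0..T}"
  have fin: "finite_measure ?L" by (intro finite_measure_lebesgue_on) auto
  have P: "pair_sigma_finite ?L ?L"
    unfolding pair_sigma_finite_def using finite_measure.axioms(1)[OF fin] by blast
  have \<theta>c: "continuous_on S \<theta>" for S by (rule DERIV_continuous_on) (rule has_field_derivative_at_within[OF \<theta>])
  have mc: "f \<in> borel_measurable ?L" if "continuous_on UNIV f" for f :: "real \<Rightarrow> real"
    by (rule continuous_imp_measurable_on_sets_lebesgue[OF continuous_on_subset[OF that]]) auto
  have \<theta>m: "\<theta> \<in> borel_measurable ?L" "\<theta>' \<in> borel_measurable ?L" using \<theta>c \<theta>' by (auto intro: mc)
  have bdd: "\<exists>C\<ge>0. \<forall>t\<in>{0..T}. \<bar>f t\<bar> \<le> C" if "continuous_on UNIV f" for f :: "real \<Rightarrow> real"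
  proof -
    have "bounded (f ` {0..T})"
      by (intro compact_imp_bounded compact_continuous_image continuous_on_subset[OF that]) auto
    then obtain C where "\<forall>y\<in>f ` {0..T}. norm y \<le> C" unfolding bounded_iff by blast
    then show ?thesis by (intro exI[of _ "max 0 C"]) (auto simp: le_max_iff_disj)
  qed
  obtain C where C: "C \<ge> 0" "\<And>t. t \<in> {0..T} \<Longrightarrow> \<bar>\<theta> t\<bar> \<le> C" using bdd[OF \<theta>c] by blast
  obtain C' where C': "C' \<ge> 0" "\<And>t. t \<in> {0..T} \<Longrightarrow> \<bar>\<theta>' t\<bar> \<le> C'" using bdd[OF \<theta>'] by blast
  have i\<theta>H: "integrable ?L (\<lambda>t. \<theta> t * H t)"
    using integrable_bounded_mult[OF H \<theta>m(1), of C] C by (simp add: mult.commute)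
  define I where "I t = intv T 0 t H" for t
  have Ic: "continuous_on {0..T} I" unfolding I_def[abs_def] by (rule continuous_on_integral_Ioc[OF H])
  have Im: "I \<in> borel_measurable ?L" by (rule continuous_imp_measurable_on_sets_lebesgue[OF Ic]) simp
  have "integrable ?L (\<lambda>t. 1 * \<theta>' t)" by (rule integrable_bounded_mult[OF _ \<theta>m(2), of _ C']) (use C' in auto)
  then have i\<theta>': "integrable ?L \<theta>'" by simp
  have "bounded (I ` {0..T})" by (intro compact_imp_bounded compact_continuous_image Ic) auto
  then obtain CI where CI: "\<And>t. t \<in> {0..T} \<Longrightarrow> \<bar>I t\<bar> \<le> CI" unfolding bounded_iff real_norm_def by blast
  have i\<theta>'I: "integrable ?L (\<lambda>t. \<theta>' t * I t)" by (rule integrable_bounded_mult[OF i\<theta>' Im, of CI]) (use CI in auto)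
  have eq: "\<theta>' t * c t + \<theta> t * H t = a * \<theta>' t + \<theta>' t * I t + \<theta> t * H t" if "t \<in> {0..T}" for t
    using c[OF that] unfolding I_def by (simp add: algebra_simps)
  have "integrable ?L (\<lambda>t. a * \<theta>' t + \<theta>' t * I t + \<theta> t * H t)" using i\<theta>H i\<theta>' i\<theta>'I by simp
  then show int: "integrable ?L (\<lambda>t. \<theta>' t * c t + \<theta> t * H t)"
    by (rule iffD1[OF Bochner_Integration.integrable_cong, rotated 2]) (use eq in auto)
  have FTC: "integral {s..T} \<theta>' = - \<theta> s" if "s \<le> T" for s
  proof -
    have "(\<theta>' has_integral (\<theta> T - \<theta> s)) {s..T}"
      by (rule fundamental_theorem_of_calculus[OF that])
         (rule has_field_derivative_at_within[OF \<theta>, unfolded has_real_derivative_iff_has_vector_derivative])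
    then show ?thesis using \<theta>T by (simp add: integral_unique)
  qed
  have I\<theta>': "(LINT t|?L. \<theta>' t) = - \<theta> 0"
    using FTC[of 0] T by (subst lebesgue_integral_eq_integral[OF i\<theta>']) auto
  \<comment> \<open>The indicator describes the triangle: integrating over s gives the increment of
    \<open>c\<close> up to t, and integrating over t is the fundamental theorem of calculus for
    \<theta> between s and T.\<close>
  define f where "f t s = \<theta>' t * (indicat_real {0<..t} s * H s)" for t s
  have fm: "case_prod f \<in> borel_measurable (?L \<Otimes>\<^sub>M ?L)"
  proof -
    have id: "(\<lambda>x. x) \<in> ?L \<rightarrow>\<^sub>M borel" by (rule mc) (rule continuous_on_id)
    have m1: "fst \<in> ?L \<Otimes>\<^sub>M ?L \<rightarrow>\<^sub>M borel" using measurable_compose[OF measurable_fst id] .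
    have m2: "snd \<in> ?L \<Otimes>\<^sub>M ?L \<rightarrow>\<^sub>M borel" using measurable_compose[OF measurable_snd id] .
    have Hm: "H \<in> borel_measurable ?L" using H by blast
    note m3 = measurable_compose[OF measurable_fst \<theta>m(2), of ?L] measurable_compose[OF measurable_snd Hm, of ?L]
    have "(\<lambda>p. \<theta>' (fst p) * ((if 0 < snd p \<and> snd p \<le> fst p then 1 else 0) * H (snd p))) \<in> borel_measurable (?L \<Otimes>\<^sub>M ?L)"
      using m1 m2 m3 by measurable
    then show ?thesis unfolding f_def by (simp add: case_prod_beta' indicator_def of_bool_def)
  qed
  have fi: "integrable (?L \<Otimes>\<^sub>M ?L) (case_prod f)"
  proof (rule pair_sigma_finite.Fubini_integrable[OF P fm])
    show "AE x in ?L. integrable ?L (\<lambda>y. case (x, y) of (x, y) \<Rightarrow> f x y)"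
      unfolding f_def using integrable_Ioc[OF H] by (intro AE_I2) simp
    have nH: "integrable ?L (\<lambda>s. \<bar>H s\<bar>)" using H by simp
    have *: "(\<lambda>t. LINT y|?L. norm (case (t, y) of (x, y) \<Rightarrow> f x y)) = (\<lambda>t. \<bar>\<theta>' t\<bar> * intv T 0 t (\<lambda>s. \<bar>H s\<bar>))"
      unfolding f_def by (rule ext) (simp add: abs_mult)
    have cI: "continuous_on {0..T} (\<lambda>t. intv T 0 t (\<lambda>s. \<bar>H s\<bar>))" by (rule continuous_on_integral_Ioc[OF nH])
    have "continuous_on {0..T} (\<lambda>t. \<bar>\<theta>' t\<bar> * intv T 0 t (\<lambda>s. \<bar>H s\<bar>))"
      by (intro continuous_on_mult cI continuous_on_rabs continuous_on_subset[OF \<theta>']) auto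
    then have "integrable ?L (\<lambda>t. \<bar>\<theta>' t\<bar> * intv T 0 t (\<lambda>s. \<bar>H s\<bar>))"
      by (rule continuous_imp_integrable_real)
    then show "integrable ?L (\<lambda>t. LINT y|?L. norm (case (t, y) of (x, y) \<Rightarrow> f x y))" unfolding * .
  qed
  have "(LINT t|?L. \<theta>' t * I t) = (LINT t|?L. LINT s|?L. f t s)"
    unfolding f_def I_def by simp
  also have "\<dots> = (LINT s|?L. LINT t|?L. f t s)" by (rule pair_sigma_finite.Fubini_integral[OF P fi, symmetric])
  also have "\<dots> = (LINT s|?L. - (\<theta> s * H s))"
  proof (rule integral_cong_AE)
    show "(\<lambda>s. LINT t|?L. f t s) \<in> borel_measurable ?L"
      using pair_sigma_finite.integrable_snd[OF P fi] by blast
    show "(\<lambda>s. - (\<theta> s * H s)) \<in> borel_measurable ?L" using i\<theta>H by auto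
    have "AE s in lebesgue. s \<noteq> (0::real)" by (intro AE_completion AE_lborel_singleton)
    then have "AE s in ?L. s \<noteq> 0" by (subst AE_restrict_space_iff) auto
    then show "AE s in ?L. (LINT t|?L. f t s) = - (\<theta> s * H s)"
      using AE_space
    proof eventually_elim
      case (elim s)
      then have s: "0 < s" "s \<le> T" by auto
      have m: "{s..T} \<in> sets ?L" using s by (auto simp: sets_restrict_space)
      have i: "integrable ?L (\<lambda>t. indicat_real {s..T} t *\<^sub>R \<theta>' t)" by (rule integrable_mult_indicator[OF m i\<theta>'])
      have "(LINT t|?L. f t s) = (LINT t|?L. H s * (indicat_real {s..T} t *\<^sub>R \<theta>' t))"
        unfolding f_def using s by (intro Bochner_Integration.integral_cong) (auto simp: indicator_def)
      also have "\<dots> = H s * (LINT t|?L. indicat_real {s..T} t *\<^sub>R \<theta>' t)" by simp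
      also have "(LINT t|?L. indicat_real {s..T} t *\<^sub>R \<theta>' t) = integral {0..T} (\<lambda>t. if t \<in> {s..T} then \<theta>' t else 0)"
        by (subst lebesgue_integral_eq_integral[OF i]) (auto intro!: Henstock_Kurzweil_Integration.integral_cong simp: indicator_def)
      also have "\<dots> = integral ({s..T} \<inter> {0..T}) \<theta>'"
        by (rule Henstock_Kurzweil_Integration.integral_restrict_Int)
      also have "{s..T} \<inter> {0..T} = {s..T}" using s by auto
      also have "integral {s..T} \<theta>' = - \<theta> s" by (rule FTC[OF s(2)])
      finally show ?case by simp
    qed
  qed
  finally have I2: "(LINT t|?L. \<theta>' t * I t) = - (LINT t|?L. \<theta> t * H t)" by simp
  have "(LINT t|?L. \<theta>' t * c t + \<theta> t * H t) = (LINT t|?L. a * \<theta>' t + \<theta>' t * I t + \<theta> t * H t)"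
    using eq by (intro Bochner_Integration.integral_cong) auto
  also have "\<dots> = a * (LINT t|?L. \<theta>' t) + (LINT t|?L. \<theta>' t * I t) + (LINT t|?L. \<theta> t * H t)"
    using i\<theta>H i\<theta>' i\<theta>'I by simp
  finally show "(LINT t|?L. \<theta>' t * c t + \<theta> t * H t) = - \<theta> 0 * a" unfolding I\<theta>' I2 by simp
qed

section \<open>Spatial and temporal derivatives of Fourier coefficients\<close>

lemma smooth_cont: "smooth f \<Longrightarrow> continuous_on S f"
  using C_k_cont[of 0 f] continuous_on_subset unfolding smooth_def by blast

lemma smooth_dir_deriv: "smooth f \<Longrightarrow> smooth (dir_deriv v f)"
  unfolding smooth_def dir_deriv_def[abs_def] using C_k_SucD(2) by blast

lemma smooth_line_deriv:
  assumes "smooth f"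
  shows "((\<lambda>s. f (s *\<^sub>R v + z)) has_real_derivative dir_deriv v f (s *\<^sub>R v + z)) (at s)"
proof -
  have D: "(f has_derivative frechet_derivative f (at (s *\<^sub>R v + z))) (at (s *\<^sub>R v + z))"
    using assms C_k_SucD(1) unfolding smooth_def by blast
  have "((\<lambda>s. s *\<^sub>R v + z) has_derivative (\<lambda>h. h *\<^sub>R v)) (at s)"
    by (auto intro!: derivative_eq_intros)
  from has_derivative_compose[OF this D]
  have "((\<lambda>s. f (s *\<^sub>R v + z)) has_derivative (\<lambda>h. frechet_derivative f (at (s *\<^sub>R v + z)) (h *\<^sub>R v))) (at s)" .
  moreover have "frechet_derivative f (at (s *\<^sub>R v + z)) (h *\<^sub>R v) = dir_deriv v f (s *\<^sub>R v + z) * h" for h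
    unfolding dir_deriv_def using linear_scale[OF has_derivative_linear[OF D], of h v] by simp
  ultimately show ?thesis by (simp add: has_field_derivative_def)
qed

text \<open>The restrictions of \<phi> to two lines that differ by a period coincide, also for
  directions with a time component, since periodicity holds at every time. Uniqueness of the
  derivative does the rest.\<close>

lemma dir_deriv_periodic:
  fixes \<phi> :: "real \<times> (real^'n) \<Rightarrow> real"
  assumes s: "smooth \<phi>" and per: "\<And>t. periodic (\<lambda>x. \<phi> (t, x))"
  shows "periodic (\<lambda>x. dir_deriv v \<phi> (t, x))"
  unfolding periodic_def
proof (intro allI impI)
  fix k x :: "real^'n" assume k: "\<forall>i. k $ i \<in> \<int>"
  have "\<phi> (s *\<^sub>R v + (t, x + k)) = \<phi> (s *\<^sub>R v + (t, x))" for s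
  proof -
    have "\<phi> (fst (s *\<^sub>R v) + t, (snd (s *\<^sub>R v) + x) + k) = \<phi> (fst (s *\<^sub>R v) + t, snd (s *\<^sub>R v) + x)"
      using per[of "fst (s *\<^sub>R v) + t"] k unfolding periodic_def by blast
    then show ?thesis by (cases v) (simp add: add.assoc)
  qed
  then have "((\<lambda>s. \<phi> (s *\<^sub>R v + (t, x))) has_real_derivative dir_deriv v \<phi> (t, x + k)) (at 0)"
    using smooth_line_deriv[OF s, of v "(t, x + k)" 0] by simp
  from DERIV_unique[OF this] show "dir_deriv v \<phi> (t, x + k) = dir_deriv v \<phi> (t, x)"
    using smooth_line_deriv[OF s, of v "(t, x)" 0] by simp
qed

lemma slice_cont:
  fixes f :: "real \<times> (real^'n) \<Rightarrow> 'b::topological_space"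
  assumes "continuous_on UNIV f"
  shows "continuous_on UNIV (\<lambda>x. f (t, x))"
  by (rule continuous_on_compose2[OF assms]) (auto intro!: continuous_intros)

lemma torus_integral_HK:
  fixes f :: "real^'n \<Rightarrow> real"
  assumes "continuous_on UNIV f"
  shows "(LINT x|torus. f x) = integral (cbox 0 1) f"
  using torus_integrable_cont[OF assms] unfolding torus_def by (intro lebesgue_integral_eq_integral) auto

text \<open>Leibniz's rule on the compact cube. It is carried out for the gauge integral, which
  agrees with the integral over the torus for continuous integrands.\<close>

lemma coefficient_deriv:
  fixes \<phi> :: "real \<times> (real^'n) \<Rightarrow> real"
  assumes s: "smooth \<phi>"
  shows "((\<lambda>t. LINT x|torus. \<phi> (t, x) * cas m x) has_real_derivative (LINT x|torus. time_deriv \<phi> (t, x) * cas m x)) (at t)"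
    and "continuous_on UNIV (\<lambda>t. LINT x|torus. time_deriv \<phi> (t, x) * cas m x)"
proof -
  have st: "smooth (time_deriv \<phi>)" unfolding time_deriv_def by (rule smooth_dir_deriv[OF s])
  have c1: "continuous_on UNIV (\<lambda>x. \<phi> (t, x) * cas m x)" for t
    by (intro continuous_on_mult slice_cont smooth_cont[OF s] cas_cont)
  have c2: "continuous_on UNIV (\<lambda>x. time_deriv \<phi> (t, x) * cas m x)" for t
    by (intro continuous_on_mult slice_cont smooth_cont[OF st] cas_cont)
  have c3: "continuous_on (UNIV \<times> cbox 0 1) (\<lambda>(t, x). time_deriv \<phi> (t, x) * cas m x)"
    unfolding case_prod_beta'
    by (intro continuous_on_mult continuous_on_compose2[OF cas_cont[of UNIV]] continuous_on_compose2[OF smooth_cont[OF st, of UNIV]] continuous_intros) auto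
  have d: "((\<lambda>t. \<phi> (t, x) * cas m x) has_field_derivative time_deriv \<phi> (t, x) * cas m x) (at t within UNIV)" for t x
  proof -
    have "((\<lambda>t. \<phi> (t *\<^sub>R (1, 0) + (0, x))) has_real_derivative dir_deriv (1, 0) \<phi> (t *\<^sub>R (1, 0) + (0, x))) (at t)"
      by (rule smooth_line_deriv[OF s])
    then have "((\<lambda>t. \<phi> (t, x)) has_real_derivative time_deriv \<phi> (t, x)) (at t)" unfolding time_deriv_def by simp
    then show ?thesis by (rule DERIV_cmult_right)
  qed
  have "((\<lambda>t. integral (cbox 0 1) (\<lambda>x. \<phi> (t, x) * cas m x)) has_field_derivative integral (cbox 0 1) (\<lambda>x. time_deriv \<phi> (t, x) * cas m x)) (at t within UNIV)"
    by (rule leibniz_rule_field_derivative[OF d _ c3]) (auto intro!: integrable_continuous continuous_on_subset[OF c1])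
  then show "((\<lambda>t. LINT x|torus. \<phi> (t, x) * cas m x) has_real_derivative (LINT x|torus. time_deriv \<phi> (t, x) * cas m x)) (at t)"
    unfolding torus_integral_HK[OF c1] torus_integral_HK[OF c2] by simp
  have "continuous_on UNIV (\<lambda>t. integral (cbox 0 1) (\<lambda>x. time_deriv \<phi> (t, x) * cas m x))"
    by (rule integral_continuous_on_param[OF c3])
  then show "continuous_on UNIV (\<lambda>t. LINT x|torus. time_deriv \<phi> (t, x) * cas m x)"
    unfolding torus_integral_HK[OF c2] .
qed

lemma coefficient_space_deriv:
  fixes \<phi> :: "real \<times> (real^'n) \<Rightarrow> real"
  assumes s: "smooth \<phi>" and per: "\<And>t. periodic (\<lambda>x. \<phi> (t, x))" and m: "m \<in> Zvec"
  shows "(LINT x|torus. dir_deriv (0, axis i 1) \<phi> (t, x) * cas m x) = - (2 * pi * m $ i) * (LINT x|torus. \<phi> (t, x) * cas (- m) x)"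
proof (rule torus_ibp_cas[OF m per])
  show "continuous_on UNIV (\<lambda>x. \<phi> (t, x))" by (intro slice_cont smooth_cont s)
  show "continuous_on UNIV (\<lambda>x. dir_deriv (0, axis i 1) \<phi> (t, x))" by (intro slice_cont smooth_cont smooth_dir_deriv s)
  show "((\<lambda>s. \<phi> (t, s *\<^sub>R axis i 1 + x)) has_real_derivative dir_deriv (0, axis i 1) \<phi> (t, s *\<^sub>R axis i 1 + x)) (at s)" for x s
    using smooth_line_deriv[OF s, of "(0, axis i 1)" "(t, x)" s] by simp
qed

text \<open>Two first derivatives lead from m to -m and back; the changed sign of the frequency in
  the second step makes the eigenvalue negative.\<close>

lemma coefficient_laplacian:
  fixes \<phi> :: "real \<times> (real^'n) \<Rightarrow> real"
  assumes s: "smooth \<phi>" and per: "\<And>t. periodic (\<lambda>x. \<phi> (t, x))" and m: "m \<in> Zvec"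
  shows "(LINT x|torus. space_laplacian \<phi> (t, x) * cas m x) = - (4 * pi\<^sup>2 * (m \<bullet> m)) * (LINT x|torus. \<phi> (t, x) * cas m x)"
proof -
  let ?D = "\<lambda>i. dir_deriv (0, axis i 1) \<phi>"
  have i: "integrable torus (\<lambda>x. dir_deriv (0, axis i 1) (?D i) (t, x) * cas m x)" for i
    by (intro torus_integrable_cont continuous_on_mult slice_cont smooth_cont smooth_dir_deriv s cas_cont)
  have "(LINT x|torus. space_laplacian \<phi> (t, x) * cas m x) = (\<Sum>i\<in>UNIV. LINT x|torus. dir_deriv (0, axis i 1) (?D i) (t, x) * cas m x)"
    unfolding space_laplacian_def sum_distrib_right using i by simp
  also have "\<dots> = (\<Sum>i\<in>UNIV. - (2 * pi * m $ i) * (- (2 * pi * (- m) $ i) * (LINT x|torus. \<phi> (t, x) * cas (- (- m)) x)))"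
  proof (rule sum.cong[OF refl])
    fix i
    have "(LINT x|torus. dir_deriv (0, axis i 1) (?D i) (t, x) * cas m x) = - (2 * pi * m $ i) * (LINT x|torus. ?D i (t, x) * cas (- m) x)"
      by (rule coefficient_space_deriv[OF smooth_dir_deriv[OF s] dir_deriv_periodic[OF s per] m])
    also have "(LINT x|torus. ?D i (t, x) * cas (- m) x) = - (2 * pi * (- m) $ i) * (LINT x|torus. \<phi> (t, x) * cas (- (- m)) x)"
      by (rule coefficient_space_deriv[OF s per]) (use m in simp)
    finally show "(LINT x|torus. dir_deriv (0, axis i 1) (?D i) (t, x) * cas m x) = - (2 * pi * m $ i) * (- (2 * pi * (- m) $ i) * (LINT x|torus. \<phi> (t, x) * cas (- (- m)) x))" .
  qed
  also have "\<dots> = - (4 * pi\<^sup>2 * (m \<bullet> m)) * (LINT x|torus. \<phi> (t, x) * cas m x)"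
    unfolding inner_vec_def by (simp add: sum_distrib_left sum_distrib_right sum_negf power2_eq_square mult_ac)
  finally show ?thesis .
qed

section \<open>The Galerkin system of the advection-diffusion equation\<close>

lemma integrable_AE_eq:
  fixes f g :: "'a \<Rightarrow> real"
  assumes "complete_measure M" "integrable M g" "AE x in M. f x = g x"
  shows "integrable M f" "(LINT x|M. f x) = (LINT x|M. g x)"
proof -
  have g: "g \<in> borel_measurable M" using assms(2) by blast
  have f: "f \<in> borel_measurable M" by (rule borel_measurable_AE_eq[OF assms(1) g assms(3)])
  show "integrable M f" using integrable_cong_AE[OF f g assms(3)] assms(2) by simp
  show "(LINT x|M. f x) = (LINT x|M. g x)" by (rule integral_cong_AE[OF f g assms(3)])
qed

text \<open>For a bijection with \<open>nat\<close> the lattice has to be infinite as well as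
  countable; the vectors with equal integer entries show this, the index type being
  nonempty.\<close>

lemma Zvec_enumeration: obtains \<kappa> :: "nat \<Rightarrow> real^'n" where "bij_betw \<kappa> UNIV Zvec"
proof -
  have "Zvec \<subseteq> range (\<lambda>k :: int^'n. \<chi> i. real_of_int (k $ i))"
  proof
    fix x :: "real^'n" assume "x \<in> Zvec"
    then have "x = (\<chi> i. real_of_int ((\<chi> i. \<lfloor>x $ i\<rfloor>) $ i))"
      unfolding Zvec_def by (auto simp: vec_eq_iff elim!: Ints_cases)
    then show "x \<in> range (\<lambda>k :: int^'n. \<chi> i. real_of_int (k $ i))" by blast
  qed
  then have c: "countable (Zvec :: (real^'n) set)" by (rule countable_subset) (rule countableI_type[THEN countable_image])
  have "inj (\<lambda>n :: nat. (\<chi> i. real n) :: real^'n)" by (auto intro!: injI simp: vec_eq_iff)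
  then have "infinite (range (\<lambda>n :: nat. (\<chi> i. real n) :: real^'n))" by (rule range_inj_infinite)
  moreover have "range (\<lambda>n :: nat. (\<chi> i. real n) :: real^'n) \<subseteq> Zvec" unfolding Zvec_def by auto
  ultimately have "infinite (Zvec :: (real^'n) set)" using finite_subset by blast
  from bij_betw_from_nat_into[OF c this] show ?thesis by (rule that)
qed

definition cas_grad :: "real^'n \<Rightarrow> real^'n \<Rightarrow> real^'n" where
  "cas_grad m x = (2 * pi * cas (- m) x) *\<^sub>R m"

lemma cas_grad_cont: "continuous_on S (cas_grad m)"
  unfolding cas_grad_def[abs_def] by (intro continuous_intros)

lemma cas_grad_norm: "norm (cas_grad m x) \<le> 4 * pi * norm m"
proof -
  have "norm (cas_grad m x) = 2 * pi * \<bar>cas (- m) x\<bar> * norm m" unfolding cas_grad_def by (simp add: abs_mult)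
  also have "\<dots> \<le> 2 * pi * 2 * norm m" using cas_bound[of "- m" x] by (intro mult_right_mono mult_left_mono) auto
  finally show ?thesis by simp
qed

text \<open>The left side is the gradient of the product of two modes. The product formula writes
  this product as a combination of four modes, so a divergence condition known for single modes
  extends to products.\<close>

lemma cas_grad_product:
  "cas l x *\<^sub>R cas_grad k x + cas k x *\<^sub>R cas_grad l x =
    (1/2) *\<^sub>R (cas_grad (k - l) x + cas_grad (l - k) x + cas_grad (k + l) x - cas_grad (- k - l) x)"
proof -
  define P Q R S where "P = cas (k - l) x" and "Q = cas (l - k) x" and "R = cas (k + l) x" and "S = cas (- k - l) x"
  have P': "cas (k - l) x = P" "cas (l - k) x = Q" "cas (k + l) x = R" "cas (- k - l) x = S"
    "cas (l + k) x = R" "cas (- l - k) x = S"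
  proof -
    have e: "l + k = k + l" "- l - k = - k - l" by (simp_all add: algebra_simps)
    show "cas (k - l) x = P" "cas (l - k) x = Q" "cas (k + l) x = R" "cas (- k - l) x = S"
      "cas (l + k) x = R" "cas (- l - k) x = S"
      unfolding e P_def Q_def R_def S_def by (rule refl)+
  qed
  have 1: "- (k - l) = l - k" "- (l - k) = k - l" "- (k + l) = - k - l" "- (- k - l) = k + l" by simp_all
  have lk: "2 * pi * ((l - k) \<bullet> x) = - (2 * pi * ((k - l) \<bullet> x))" "2 * pi * ((- k - l) \<bullet> x) = - (2 * pi * ((k + l) \<bullet> x))"
    by (simp_all add: inner_diff_left inner_add_left algebra_simps)
  have cosR: "cos (2 * pi * ((k + l) \<bullet> x)) = (R + S) / 2" and sinQ: "sin (2 * pi * ((l - k) \<bullet> x)) = (Q - P) / 2"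
    and sinP: "sin (2 * pi * ((k - l) \<bullet> x)) = (P - Q) / 2"
    unfolding P_def Q_def R_def S_def cas_def lk by simp_all
  have a: "cas l x * cas (- k) x = (R + S) / 2 + (Q - P) / 2"
  proof -
    have e: "l - - k = k + l" "l + - k = l - k" by simp_all
    show ?thesis unfolding cas_mult e cosR sinQ by (rule refl)
  qed
  have b: "cas k x * cas (- l) x = (R + S) / 2 + (P - Q) / 2"
  proof -
    have e: "k - - l = k + l" "k + - l = k - l" by simp_all
    show ?thesis unfolding cas_mult e cosR sinP by (rule refl)
  qed
  have "cas l x *\<^sub>R cas_grad k x + cas k x *\<^sub>R cas_grad l x =
     (2 * pi * (cas l x * cas (- k) x)) *\<^sub>R k + (2 * pi * (cas k x * cas (- l) x)) *\<^sub>R l"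
    unfolding cas_grad_def by (simp add: mult_ac)
  also have "\<dots> = (1/2) *\<^sub>R (cas_grad (k - l) x + cas_grad (l - k) x + cas_grad (k + l) x - cas_grad (- k - l) x)"
    unfolding a b cas_grad_def 1 P' by (simp add: vec_eq_iff field_simps)
  finally show ?thesis .
qed

lemma torus_L2_inner_square:
  fixes v F :: "real^'n \<Rightarrow> real^'n"
  assumes v: "v \<in> torus_L2" and F: "continuous_on UNIV F" "\<And>x. x \<in> cbox 0 1 \<Longrightarrow> norm (F x) \<le> C"
  shows "(\<lambda>x. v x \<bullet> F x) \<in> borel_measurable torus" "integrable torus (\<lambda>x. (v x \<bullet> F x)\<^sup>2)"
    "(LINT x|torus. (v x \<bullet> F x)\<^sup>2) \<le> (C * L2_torus_norm v)\<^sup>2"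
proof -
  show m: "(\<lambda>x. v x \<bullet> F x) \<in> borel_measurable torus"
    using v F unfolding torus_L2_def by (intro torus_borel_measurable_inner) auto
  have i: "integrable torus (\<lambda>x. (norm (v x))\<^sup>2)" using v unfolding torus_L2_def by auto
  have le: "(v x \<bullet> F x)\<^sup>2 \<le> C\<^sup>2 * (norm (v x))\<^sup>2" if "x \<in> cbox 0 1" for x
  proof -
    have "\<bar>v x \<bullet> F x\<bar> \<le> norm (v x) * norm (F x)" by (rule Cauchy_Schwarz_ineq2)
    also have "\<dots> \<le> norm (v x) * C" using F(2)[OF that] by (intro mult_left_mono) auto
    finally have "(\<bar>v x \<bullet> F x\<bar>)\<^sup>2 \<le> (norm (v x) * C)\<^sup>2" by (rule power_mono) simp
    then show ?thesis by (simp add: power_mult_distrib mult.commute)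
  qed
  show i2: "integrable torus (\<lambda>x. (v x \<bullet> F x)\<^sup>2)"
  proof (rule Bochner_Integration.integrable_bound)
    show "integrable torus (\<lambda>x. C\<^sup>2 * (norm (v x))\<^sup>2)" using i by simp
    show "AE x in torus. norm ((v x \<bullet> F x)\<^sup>2) \<le> norm (C\<^sup>2 * (norm (v x))\<^sup>2)"
      using le by (intro AE_I2) simp
  qed (use m in measurable)
  have "(LINT x|torus. (v x \<bullet> F x)\<^sup>2) \<le> (LINT x|torus. C\<^sup>2 * (norm (v x))\<^sup>2)"
    using le i i2 by (intro integral_mono) auto
  also have "\<dots> = (C * L2_torus_norm v)\<^sup>2" unfolding L2_torus_norm_def by (simp add: power_mult_distrib)
  finally show "(LINT x|torus. (v x \<bullet> F x)\<^sup>2) \<le> (C * L2_torus_norm v)\<^sup>2" .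
qed

locale advection_diffusion =
  fixes T :: real and b :: "real \<Rightarrow> real^'n \<Rightarrow> real^'n" and u0 :: "real^'n \<Rightarrow> real" and \<kappa> :: "nat \<Rightarrow> real^'n"
  assumes T: "T > 0" and b: "b \<in> bochner_Lp 1 T torus_L2 L2_torus_norm" and div: "divergence_free T b"
    and u0: "u0 \<in> torus_L2" and \<kappa>: "bij_betw \<kappa> UNIV Zvec"
begin

text \<open>The value 0 at times where \<open>b r\<close> is not square integrable makes the Bessel
  bound true at every time, as the locale \<open>galerkin\<close> demands. Integrals in time are
  unaffected, since such times form a null set.\<close>

definition drift :: "nat \<Rightarrow> nat \<Rightarrow> real \<Rightarrow> real" where
  "drift j l r = (if b r \<in> torus_L2 then LINT x|torus. b r x \<bullet> (cas (\<kappa> l) x *\<^sub>R cas_grad (\<kappa> j) x) else 0)"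

definition S0 :: real where "S0 = (LINT x|torus. (u0 x)\<^sup>2)"

lemma \<kappa>_Zvec [simp]: "\<kappa> j \<in> Zvec"
  using \<kappa> by (auto simp: bij_betw_def)

lemma \<kappa>_eq_iff [simp]: "\<kappa> i = \<kappa> j \<longleftrightarrow> i = j"
  using \<kappa> by (auto simp: bij_betw_def inj_on_def)

lemma b_L2: "AE t in lebesgue_on {0..T}. b t \<in> torus_L2"
  using b unfolding bochner_Lp_def by auto

lemma complete_L: "complete_measure (lebesgue_on {0..T})"
  by (rule complete_lebesgue_on) simp

lemma cas_L2: "cas k \<in> borel_measurable torus" "integrable torus (\<lambda>x. (cas k x)\<^sup>2)"
  by (rule continuous_imp_torus_measurable[OF cas_cont]) (intro torus_integrable_cont continuous_intros)

lemma u0_L2: "u0 \<in> borel_measurable torus" "integrable torus (\<lambda>x. (u0 x)\<^sup>2)"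
  using u0 unfolding torus_L2_def by auto

lemma cas_orth: "(LINT x|torus. cas (\<kappa> i) x * cas (\<kappa> j) x) = (if i = j then 1 else 0)"
  by (simp add: cas_orthonormal)

lemma drift_int: "integrable (lebesgue_on {0..T}) (drift j l)"
  and drift_AE: "AE r in lebesgue_on {0..T}. drift j l r = (LINT x|torus. b r x \<bullet> (cas (\<kappa> l) x *\<^sub>R cas_grad (\<kappa> j) x))"
proof -
  have c: "continuous_on UNIV (\<lambda>x. cas (\<kappa> l) x *\<^sub>R cas_grad (\<kappa> j) x)" by (intro continuous_intros cas_grad_cont)
  show ae: "AE r in lebesgue_on {0..T}. drift j l r = (LINT x|torus. b r x \<bullet> (cas (\<kappa> l) x *\<^sub>R cas_grad (\<kappa> j) x))"
    using b_L2 by eventually_elim (simp add: drift_def)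
  show "integrable (lebesgue_on {0..T}) (drift j l)"
    by (rule integrable_AE_eq(1)[OF complete_L drift_integrable[OF b c] ae])
qed

text \<open>The sum of the two entries pairs \<open>b\<close> with the gradient of a product of
  modes; \<open>cas_grad_product\<close> reduces it to single frequencies, for which
  \<open>divergence_free_interval\<close> applies.\<close>

lemma drift_antisym:
  assumes "0 \<le> s" "s \<le> t" "t \<le> T"
  shows "intv T s t (drift j l) = - intv T s t (drift l j)"
proof -
  define W where "W m r = (LINT x|torus. b r x \<bullet> cas_grad m x)" for m r
  have Wi: "integrable (lebesgue_on {0..T}) (W m)" for m
    unfolding W_def[abs_def] by (rule drift_integrable[OF b cas_grad_cont])
  have W0: "intv T s t (W m) = 0" if "m \<in> Zvec" for m
    unfolding W_def cas_grad_def by (rule divergence_free_interval[OF b div that assms])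
  let ?k = "\<kappa> j" and ?l = "\<kappa> l"
  let ?R = "\<lambda>r. (1/2) * (W (?k - ?l) r + W (?l - ?k) r + W (?k + ?l) r - W (- ?k - ?l) r)"
  have "intv T s t (\<lambda>r. drift j l r + drift l j r) = intv T s t ?R"
  proof (rule integral_cong_AE)
    show "(\<lambda>r. indicat_real {s<..t} r * (drift j l r + drift l j r)) \<in> borel_measurable (lebesgue_on {0..T})"
      using integrable_Ioc[of T "\<lambda>r. drift j l r + drift l j r" s t] drift_int by auto
    show "(\<lambda>r. indicat_real {s<..t} r * ?R r) \<in> borel_measurable (lebesgue_on {0..T})"
      using integrable_Ioc[of T ?R s t] Wi by auto
    show "AE r in lebesgue_on {0..T}. indicat_real {s<..t} r * (drift j l r + drift l j r) = indicat_real {s<..t} r * ?R r"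
      using b_L2
    proof eventually_elim
      case (elim r)
      have i: "integrable torus (\<lambda>x. b r x \<bullet> F x)" if F: "continuous_on UNIV F" for F
      proof -
        obtain C where "C \<ge> 0" "\<And>x. x \<in> cbox 0 1 \<Longrightarrow> norm (F x) \<le> C" using torus_bounded[OF F] by blast
        then show ?thesis by (intro torus_L2_inner_bound(1)[OF elim F])
      qed
      have i1: "integrable torus (\<lambda>x. b r x \<bullet> (cas k x *\<^sub>R cas_grad l x))" for k l
        by (intro i continuous_intros cas_grad_cont)
      have i2: "integrable torus (\<lambda>x. b r x \<bullet> cas_grad m x)" for m by (rule i[OF cas_grad_cont])
      have "drift j l r + drift l j r = (LINT x|torus. b r x \<bullet> (cas ?l x *\<^sub>R cas_grad ?k x) + b r x \<bullet> (cas ?k x *\<^sub>R cas_grad ?l x))"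
        unfolding drift_def using elim i1 by (simp del: inner_scaleR_right)
      also have "\<dots> = (LINT x|torus. (1/2) * (b r x \<bullet> cas_grad (?k - ?l) x + b r x \<bullet> cas_grad (?l - ?k) x + b r x \<bullet> cas_grad (?k + ?l) x - b r x \<bullet> cas_grad (- ?k - ?l) x))"
        unfolding inner_add_right[symmetric] inner_diff_right[symmetric] inner_scaleR_right[symmetric] cas_grad_product
        by simp
      also have "\<dots> = ?R r" unfolding W_def using i2 by simp
      finally show ?case by simp
    qed
  qed
  also have "intv T s t ?R = (1/2) * intv T s t (\<lambda>r. W (?k - ?l) r + W (?l - ?k) r + W (?k + ?l) r - W (- ?k - ?l) r)"
    by (rule intv_mult_left)
  also have "\<dots> = 0"
    using Wi W0 by (subst intv_diff, simp, simp, subst intv_add, simp, simp, subst intv_add, simp_all)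
  finally have "intv T s t (drift j l) + intv T s t (drift l j) = 0"
    by (subst (asm) intv_add) (use drift_int in auto)
  then show ?thesis by linarith
qed

text \<open>For fixed j the entries are the Hartley coefficients of the scalar function b . grad
  e_j, so Bessel's inequality bounds the row by the L^2 norm of that function.\<close>

lemma drift_bessel:
  "(\<Sum>l<n. (drift j l r)\<^sup>2) \<le> (4 * pi * norm (\<kappa> j) * (if b r \<in> torus_L2 then L2_torus_norm (b r) else 0))\<^sup>2"
proof (cases "b r \<in> torus_L2")
  case True
  note f = torus_L2_inner_square[OF True cas_grad_cont[of UNIV "\<kappa> j"] cas_grad_norm]
  have "(\<Sum>l<n. (drift j l r)\<^sup>2) = (\<Sum>l<n. (LINT x|torus. (b r x \<bullet> cas_grad (\<kappa> j) x) * cas (\<kappa> l) x)\<^sup>2)"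
    unfolding drift_def using True by (simp add: mult.commute)
  also have "\<dots> \<le> (LINT x|torus. (b r x \<bullet> cas_grad (\<kappa> j) x)\<^sup>2)"
    by (rule Bessel_inequality) (use f cas_L2 cas_orth in auto)
  also have "\<dots> \<le> (4 * pi * norm (\<kappa> j) * L2_torus_norm (b r))\<^sup>2" by (rule f(3))
  finally show ?thesis using True by simp
qed (simp add: drift_def)

text \<open>The factor 4 pi |k| bounds the gradient of a mode, the bound 2 for \<open>cas\<close>
  accounting for half of the 4; 4 pi^2 |k|^2 is the eigenvalue of minus the Laplacian, and
  \<open>S0\<close> is the initial energy by Bessel's inequality.\<close>

lemma galerkin_instance:
  "galerkin T drift (\<lambda>j. 4 * pi\<^sup>2 * (\<kappa> j \<bullet> \<kappa> j)) (\<lambda>j. 4 * pi * norm (\<kappa> j))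
    (\<lambda>r. if b r \<in> torus_L2 then L2_torus_norm (b r) else 0) (\<lambda>j. LINT x|torus. u0 x * cas (\<kappa> j) x) S0"
proof
  show "T > 0" by (rule T)
  show "integrable (lebesgue_on {0..T}) (drift j l)" for j l by (rule drift_int)
  show "intv T s t (drift j l) = - intv T s t (drift l j)" if "0 \<le> s" "s \<le> t" "t \<le> T" for j l s t
    by (rule drift_antisym[OF that])
  show "(\<Sum>l<n. (drift j l s)\<^sup>2) \<le> (4 * pi * norm (\<kappa> j) * (if b s \<in> torus_L2 then L2_torus_norm (b s) else 0))\<^sup>2" for j s n
    by (rule drift_bessel)
  show "0 \<le> 4 * pi * norm (\<kappa> j)" "0 \<le> 4 * pi\<^sup>2 * (\<kappa> j \<bullet> \<kappa> j)" for j by auto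
  show "0 \<le> (if b s \<in> torus_L2 then L2_torus_norm (b s) else 0)" for s by (simp add: L2_torus_norm_def)
  have "integrable (lebesgue_on {0..T}) (\<lambda>t. L2_torus_norm (b t))" using b unfolding bochner_Lp_def by simp
  moreover have "AE r in lebesgue_on {0..T}. (if b r \<in> torus_L2 then L2_torus_norm (b r) else 0) = L2_torus_norm (b r)"
    using b_L2 by eventually_elim simp
  ultimately show "integrable (lebesgue_on {0..T}) (\<lambda>r. if b r \<in> torus_L2 then L2_torus_norm (b r) else 0)"
    by (rule integrable_AE_eq(1)[OF complete_L])
  show "(\<Sum>j<n. (LINT x|torus. u0 x * cas (\<kappa> j) x)\<^sup>2) \<le> S0" for n
    unfolding S0_def by (rule Bessel_inequality) (use u0_L2 cas_L2 cas_orth in auto)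
qed

end

section \<open>The limit and its weak gradient\<close>

lemma torus_L2_realI:
  fixes f :: "real^'n \<Rightarrow> real"
  assumes "periodic f" "f \<in> borel_measurable torus" "integrable torus (\<lambda>x. (f x)\<^sup>2)"
  shows "f \<in> torus_L2"
  using assms unfolding torus_L2_def by simp

lemma norm_vec_square: "(norm (x :: real^'n))\<^sup>2 = (\<Sum>i\<in>UNIV. (x $ i)\<^sup>2)"
  unfolding power2_norm_eq_inner inner_vec_def by (simp add: power2_eq_square)

lemma vec_measurable:
  fixes g :: "'n::finite \<Rightarrow> 'a \<Rightarrow> real"
  assumes "\<And>i. g i \<in> borel_measurable M"
  shows "(\<lambda>x. \<chi> i. g i x) \<in> borel_measurable M"
proof -
  have "(\<lambda>x. \<Sum>i\<in>UNIV. g i x *\<^sub>R axis i (1::real)) \<in> borel_measurable M"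
    using assms by (intro borel_measurable_sum borel_measurable_scaleR borel_measurable_const)
  moreover have "(\<Sum>i\<in>UNIV. g i x *\<^sub>R axis i (1::real)) = (\<chi> i. g i x)" for x
    by (simp add: vec_eq_iff axis_def if_distrib[of "\<lambda>z. _ * z"] cong: if_cong)
  ultimately show ?thesis by simp
qed

lemma torus_L2_vecI:
  fixes g :: "'n \<Rightarrow> real^'n \<Rightarrow> real"
  assumes "\<And>i. periodic (g i)" "\<And>i. g i \<in> borel_measurable torus" "\<And>i. integrable torus (\<lambda>x. (g i x)\<^sup>2)"
  shows "(\<lambda>x. \<chi> i. g i x) \<in> torus_L2" "(L2_torus_norm (\<lambda>x. \<chi> i. g i x))\<^sup>2 = (\<Sum>i\<in>UNIV. LINT x|torus. (g i x)\<^sup>2)"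
proof -
  show "(\<lambda>x. \<chi> i. g i x) \<in> torus_L2"
    unfolding torus_L2_def norm_vec_square using assms vec_measurable[OF assms(2)] by (auto simp: periodic_def)
  have "(LINT x|torus. (\<Sum>i\<in>UNIV. (g i x)\<^sup>2)) = (\<Sum>i\<in>UNIV. LINT x|torus. (g i x)\<^sup>2)"
    using assms by simp
  then show "(L2_torus_norm (\<lambda>x. \<chi> i. g i x))\<^sup>2 = (\<Sum>i\<in>UNIV. LINT x|torus. (g i x)\<^sup>2)"
    unfolding L2_torus_norm_def norm_vec_square by (simp add: sum_nonneg)
qed

lemma torus_L2_component:
  fixes g :: "real^'n \<Rightarrow> real^'n"
  assumes "g \<in> torus_L2"
  shows "(\<lambda>x. g x $ i) \<in> borel_measurable torus" "integrable torus (\<lambda>x. (g x $ i)\<^sup>2)" "integrable torus (\<lambda>x. g x $ i)"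
proof -
  have g: "g \<in> borel_measurable torus" "integrable torus (\<lambda>x. (norm (g x))\<^sup>2)" using assms unfolding torus_L2_def by auto
  have "(\<lambda>x. g x \<bullet> axis i 1) \<in> borel_measurable torus" using g(1) by (intro borel_measurable_inner) auto
  then show m: "(\<lambda>x. g x $ i) \<in> borel_measurable torus" by (simp add: inner_axis)
  show i: "integrable torus (\<lambda>x. (g x $ i)\<^sup>2)"
  proof (rule Bochner_Integration.integrable_bound[OF g(2)])
    have "(g x $ i)\<^sup>2 \<le> (norm (g x))\<^sup>2" for x
      using component_le_norm_cart[of "g x" i] by (simp add: abs_le_square_iff[symmetric])
    then show "AE x in torus. norm ((g x $ i)\<^sup>2) \<le> norm ((norm (g x))\<^sup>2)" by (intro AE_I2) simp
  qed (use m in measurable)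
  show "integrable torus (\<lambda>x. g x $ i)"
    by (rule finite_measure.square_integrable_imp_integrable[OF torus_finite m i])
qed

lemma cas_smooth: "smooth (cas m)"
  unfolding smooth_def using cas_C_k by blast

text \<open>Norms are compared because \<open>H1_torus_norm\<close> sees the chosen gradient through
  its norm alone. Each component of the difference is orthogonal to all modes and hence zero almost
  everywhere.\<close>

lemma weak_gradient_unique:
  assumes g: "has_weak_gradient f g" and g': "has_weak_gradient f g'"
  shows "L2_torus_norm g = L2_torus_norm g'"
proof -
  have L2: "g \<in> torus_L2" "g' \<in> torus_L2" using g g' unfolding has_weak_gradient_def by auto
  have "AE x in torus. g x $ i - g' x $ i = 0" for i
  proof (rule torus_orthogonal_zero)
    show i: "integrable torus (\<lambda>x. g x $ i - g' x $ i)"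
      using torus_L2_component(3)[OF L2(1)] torus_L2_component(3)[OF L2(2)] by simp
    fix m :: "real^'a" assume m: "m \<in> Zvec"
    have "(LINT x|torus. g x $ i * cas m x) = (LINT x|torus. g' x $ i * cas m x)"
    proof -
      have "(LINT x|torus. f x * dir_deriv (axis i 1) (cas m) x) = - (LINT x|torus. g x $ i * cas m x)"
        "(LINT x|torus. f x * dir_deriv (axis i 1) (cas m) x) = - (LINT x|torus. g' x $ i * cas m x)"
        using g g' cas_smooth cas_periodic[OF m] unfolding has_weak_gradient_def by blast+
      then show ?thesis by simp
    qed
    moreover have "integrable torus (\<lambda>x. g x $ i * cas m x)" "integrable torus (\<lambda>x. g' x $ i * cas m x)"
      by (intro torus_integrable_mult_cont cas_cont torus_L2_component(3)[OF L2(1)] torus_L2_component(3)[OF L2(2)])+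
    ultimately show "(LINT x|torus. (g x $ i - g' x $ i) * cas m x) = 0" by (simp add: left_diff_distrib)
  qed
  then have "AE x in torus. \<forall>i. g x $ i - g' x $ i = 0" by (simp add: AE_all_countable)
  then have "AE x in torus. (norm (g x))\<^sup>2 = (norm (g' x))\<^sup>2"
  proof eventually_elim
    case (elim x)
    then have "g x = g' x" by (simp add: vec_eq_iff)
    then show ?case by simp
  qed
  then have "(LINT x|torus. (norm (g x))\<^sup>2) = (LINT x|torus. (norm (g' x))\<^sup>2)"
    using L2 unfolding torus_L2_def by (intro integral_cong_AE) auto
  then show ?thesis unfolding L2_torus_norm_def by simp
qed

text \<open>Monotone convergence of the partial sums. Membership in the Bochner space of H^1
  includes integrability in time of the squared norm, which is available only as such a sum at
  almost every time.\<close>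

lemma series_integrable:
  fixes d :: "nat \<Rightarrow> real \<Rightarrow> real"
  assumes cm: "complete_measure M" and d: "\<And>k. integrable M (\<lambda>t. (d k t)\<^sup>2)"
    and bd: "\<And>n. (LINT t|M. (\<Sum>k<n. (d k t)\<^sup>2)) \<le> B" and f: "AE t in M. (\<lambda>k. (d k t)\<^sup>2) sums f t"
  shows "integrable M f"
proof -
  define S where "S n t = (\<Sum>k<n. (d k t)\<^sup>2)" for n t
  have Si: "integrable M (S n)" for n unfolding S_def[abs_def] using d by simp
  have Sm: "S n \<in> borel_measurable M" for n using Si by blast
  have lim: "AE t in M. (\<lambda>n. S n t) \<longlonglongrightarrow> f t" using f unfolding S_def sums_def .
  have "AE t in M. f t = lim (\<lambda>n. S n t)" using lim by eventually_elim (simp add: limI)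
  then have fm: "f \<in> borel_measurable M"
    by (rule borel_measurable_AE_eq[OF cm borel_measurable_lim_metric[OF Sm]])
  have mono: "S m t \<le> S n t" if "m \<le> n" for m n t unfolding S_def using that by (intro sum_mono2) auto
  have inc: "incseq (\<lambda>n. LINT t|M. S n t)"
    using mono Si by (intro monoI integral_mono) auto
  have "\<forall>n. (LINT t|M. S n t) \<le> B" using bd unfolding S_def by blast
  then obtain l where "(\<lambda>n. LINT t|M. S n t) \<longlonglongrightarrow> l" using incseq_convergent[OF inc] by blast
  then show ?thesis
    using mono by (intro integrable_monotone_convergence[OF Si _ lim _ fm]) (auto simp: mono_def)
qed

definition tconv :: "(real^'n \<Rightarrow> real) \<Rightarrow> (real^'n \<Rightarrow> real) \<Rightarrow> real^'n \<Rightarrow> real" where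
  "tconv K f x = (LINT y|torus. K (x - y) * f y)"

definition vconv :: "(real^'n \<Rightarrow> real) \<Rightarrow> (real^'n \<Rightarrow> real^'n) \<Rightarrow> real^'n \<Rightarrow> real^'n" where
  "vconv K f x = (\<chi> i. tconv K (\<lambda>y. f y $ i) x)"

text \<open>Collects what the construction delivers, so that the verification refers to coefficients
  only. The derivative \<open>Gd i\<close> is expanded in \<open>cas (- \<kappa> k)\<close>, because
  differentiating \<open>cas (\<kappa> k)\<close> in direction i produces that function with the
  factor \<open>2 * pi * \<kappa> k $ i\<close>.\<close>

locale galerkin_limit = advection_diffusion T b u0 \<kappa>
  for T :: real and b :: "real \<Rightarrow> real^'n \<Rightarrow> real^'n" and u0 :: "real^'n \<Rightarrow> real" and \<kappa> :: "nat \<Rightarrow> real^'n" +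
  fixes c :: "nat \<Rightarrow> real \<Rightarrow> real" and U :: "real \<Rightarrow> real^'n \<Rightarrow> real" and Gd :: "'n \<Rightarrow> real \<Rightarrow> real^'n \<Rightarrow> real"
  assumes c_cont: "\<And>j. continuous_on {0..T} (c j)"
    and c_bound: "\<And>n t. t \<in> {0..T} \<Longrightarrow> (\<Sum>j<n. (c j t)\<^sup>2) \<le> 3 * S0"
    and c_lam: "\<And>i n. (LINT t|lebesgue_on {0..T}. (\<Sum>j<n. (2 * pi * \<kappa> j $ i * c j t)\<^sup>2)) \<le> 3 * S0"
    and H_int: "\<And>j. integrable (lebesgue_on {0..T}) (\<lambda>s. (\<Sum>l. drift j l s * c l s) - 4 * pi\<^sup>2 * (\<kappa> j \<bullet> \<kappa> j) * c j s)"
    and c_eq: "\<And>j t. t \<in> {0..T} \<Longrightarrow> c j t = (LINT x|torus. u0 x * cas (\<kappa> j) x) +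
        intv T 0 t (\<lambda>s. (\<Sum>l. drift j l s * c l s) - 4 * pi\<^sup>2 * (\<kappa> j \<bullet> \<kappa> j) * c j s)"
    and U_per: "\<And>t. periodic (U t)"
    and U_meas: "(\<lambda>(t, x). U t x) \<in> borel_measurable (lebesgue_on ({0..T} \<times> cbox 0 1))"
    and U_exp: "AE t in lebesgue_on {0..T}. L2_expansion (\<lambda>k. cas (\<kappa> k)) (\<lambda>k. c k t) (U t)"
    and Gd_per: "\<And>i t. periodic (Gd i t)"
    and Gd_exp: "\<And>i. AE t in lebesgue_on {0..T}. L2_expansion (\<lambda>k. cas (- \<kappa> k)) (\<lambda>k. 2 * pi * \<kappa> k $ i * c k t) (Gd i t)"
begin

lemma U_L2: "AE t in lebesgue_on {0..T}. U t \<in> torus_L2 \<and> L2_torus_norm (U t) \<le> sqrt (3 * S0)"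
  using U_exp[unfolded L2_expansion_def] AE_space
proof eventually_elim
  case (elim t)
  then have U: "U t \<in> torus_L2" by (intro torus_L2_realI U_per) auto
  have "(\<lambda>k. (c k t)\<^sup>2) sums (LINT x|torus. (U t x)\<^sup>2)" using elim by blast
  then have "(LINT x|torus. (U t x)\<^sup>2) \<le> 3 * S0"
    unfolding sums_def by (rule LIMSEQ_le_const2) (use c_bound elim in auto)
  then have "L2_torus_norm (U t) \<le> sqrt (3 * S0)" unfolding L2_torus_norm_def by simp
  then show ?case using U by simp
qed

lemma U_Linf: "U \<in> bochner_Linf T torus_L2 L2_torus_norm"
proof -
  have "AE t in lebesgue_on {0..T}. U t \<in> torus_L2" using U_L2 by eventually_elim simp
  moreover have "AE t in lebesgue_on {0..T}. L2_torus_norm (U t) \<le> sqrt (3 * S0)" using U_L2 by eventually_elim simp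
  ultimately show ?thesis unfolding bochner_Linf_def space_time_fun_def using U_per U_meas by blast
qed

text \<open>Integration by parts on each mode matches the two series term by term. At almost every
  time the expansions hold for all square integrable functions, so the exceptional times do not
  depend on the test function.\<close>

lemma U_weak_gradient:
  "AE t in lebesgue_on {0..T}. has_weak_gradient (U t) (\<lambda>x. \<chi> i. Gd i t x) \<and>
     (L2_torus_norm (\<lambda>x. \<chi> i. Gd i t x))\<^sup>2 = (\<Sum>i\<in>UNIV. LINT x|torus. (Gd i t x)\<^sup>2)"
proof -
  have "AE t in lebesgue_on {0..T}. \<forall>i. Gd i t \<in> borel_measurable torus \<and> integrable torus (\<lambda>x. (Gd i t x)\<^sup>2) \<and>
       (\<forall>f. f \<in> borel_measurable torus \<longrightarrow> integrable torus (\<lambda>x. (f x)\<^sup>2) \<longrightarrow>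
         (\<lambda>k. (2 * pi * \<kappa> k $ i * c k t) * (LINT x|torus. f x * cas (- \<kappa> k) x)) sums (LINT x|torus. Gd i t x * f x))"
    unfolding AE_all_countable
  proof
    fix i
    show "AE t in lebesgue_on {0..T}. Gd i t \<in> borel_measurable torus \<and> integrable torus (\<lambda>x. (Gd i t x)\<^sup>2) \<and>
       (\<forall>f. f \<in> borel_measurable torus \<longrightarrow> integrable torus (\<lambda>x. (f x)\<^sup>2) \<longrightarrow>
         (\<lambda>k. (2 * pi * \<kappa> k $ i * c k t) * (LINT x|torus. f x * cas (- \<kappa> k) x)) sums (LINT x|torus. Gd i t x * f x))"
      using Gd_exp[of i, unfolded L2_expansion_def] by eventually_elim blast
  qed
  then show ?thesis
    using U_exp[unfolded L2_expansion_def]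
  proof eventually_elim
    case (elim t)
    have G: "\<And>i. Gd i t \<in> borel_measurable torus" "\<And>i. integrable torus (\<lambda>x. (Gd i t x)\<^sup>2)"
      "\<And>i f. f \<in> borel_measurable torus \<Longrightarrow> integrable torus (\<lambda>x. (f x)\<^sup>2) \<Longrightarrow>
         (\<lambda>k. (2 * pi * \<kappa> k $ i * c k t) * (LINT x|torus. f x * cas (- \<kappa> k) x)) sums (LINT x|torus. Gd i t x * f x)"
      using elim(1) by blast+
    have U: "\<And>f. f \<in> borel_measurable torus \<Longrightarrow> integrable torus (\<lambda>x. (f x)\<^sup>2) \<Longrightarrow>
         (\<lambda>k. c k t * (LINT x|torus. f x * cas (\<kappa> k) x)) sums (LINT x|torus. U t x * f x)"
      using elim(2) by blast
    note L2 = torus_L2_vecI[OF Gd_per G(1,2)]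
    have "(LINT x|torus. U t x * dir_deriv (axis i 1) \<psi> x) = - (LINT x|torus. Gd i t x * \<psi> x)"
      if \<psi>: "smooth \<psi>" "periodic \<psi>" for \<psi> i
    proof -
      have c1: "continuous_on UNIV \<psi>" "continuous_on UNIV (dir_deriv (axis i 1) \<psi>)"
        by (intro smooth_cont smooth_dir_deriv \<psi>)+
      have sq: "f \<in> borel_measurable torus \<and> integrable torus (\<lambda>x. (f x)\<^sup>2)" if "continuous_on UNIV f" for f :: "real^'n \<Rightarrow> real"
        using that by (auto intro!: continuous_imp_torus_measurable torus_integrable_cont continuous_intros)
      have "(\<lambda>k. c k t * (LINT x|torus. dir_deriv (axis i 1) \<psi> x * cas (\<kappa> k) x)) sums (LINT x|torus. U t x * dir_deriv (axis i 1) \<psi> x)"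
        using sq[OF c1(2)] by (intro U) auto
      moreover have "c k t * (LINT x|torus. dir_deriv (axis i 1) \<psi> x * cas (\<kappa> k) x) = - ((2 * pi * \<kappa> k $ i * c k t) * (LINT x|torus. \<psi> x * cas (- \<kappa> k) x))" for k
        by (subst torus_ibp_cas[OF \<kappa>_Zvec \<psi>(2) c1 smooth_line_deriv[OF \<psi>(1)]]) simp
      moreover have "(\<lambda>k. - ((2 * pi * \<kappa> k $ i * c k t) * (LINT x|torus. \<psi> x * cas (- \<kappa> k) x))) sums - (LINT x|torus. Gd i t x * \<psi> x)"
        using sq[OF c1(1)] by (intro sums_minus G(3)) auto
      ultimately show ?thesis using sums_unique2 by auto
    qed
    then show ?case unfolding has_weak_gradient_def using L2 by simp
  qed
qed

lemma U_L2H1: "U \<in> bochner_Lp 2 T torus_H1 H1_torus_norm"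
proof -
  let ?L = "lebesgue_on {0..T}"
  have mem: "AE t in ?L. U t \<in> torus_H1"
    using U_L2 U_weak_gradient by eventually_elim (auto simp: torus_H1_def)
  have csq: "integrable ?L (\<lambda>t. (c k t)\<^sup>2)" "integrable ?L (\<lambda>t. (2 * pi * \<kappa> k $ i * c k t)\<^sup>2)" for k i
    by (intro continuous_imp_integrable_real continuous_intros c_cont)+
  have i1: "integrable ?L (\<lambda>t. LINT x|torus. (U t x)\<^sup>2)"
  proof (rule series_integrable[OF complete_L csq(1), where B="3 * S0 * T"])
    show "AE t in ?L. (\<lambda>k. (c k t)\<^sup>2) sums (LINT x|torus. (U t x)\<^sup>2)" using U_exp[unfolded L2_expansion_def] by eventually_elim blast
    show "(LINT t|?L. (\<Sum>k<n. (c k t)\<^sup>2)) \<le> 3 * S0 * T" for n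
    proof -
      have "(LINT t|?L. (\<Sum>k<n. (c k t)\<^sup>2)) \<le> (LINT t|?L. 3 * S0)"
        using csq(1) c_bound by (intro integral_mono) auto
      also have "\<dots> = 3 * S0 * T" using T by (simp add: measure_restrict_space)
      finally show ?thesis .
    qed
  qed
  have i2: "integrable ?L (\<lambda>t. LINT x|torus. (Gd i t x)\<^sup>2)" for i
  proof (rule series_integrable[OF complete_L csq(2)[of _ i], where B="3 * S0"])
    show "AE t in ?L. (\<lambda>k. (2 * pi * \<kappa> k $ i * c k t)\<^sup>2) sums (LINT x|torus. (Gd i t x)\<^sup>2)"
      using Gd_exp[of i, unfolded L2_expansion_def] by eventually_elim blast
  qed (rule c_lam)
  have "integrable ?L (\<lambda>t. (LINT x|torus. (U t x)\<^sup>2) + (\<Sum>i\<in>UNIV. LINT x|torus. (Gd i t x)\<^sup>2))" using i1 i2 by simp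
  moreover have "AE t in ?L. H1_torus_norm (U t) ^ 2 = (LINT x|torus. (U t x)\<^sup>2) + (\<Sum>i\<in>UNIV. LINT x|torus. (Gd i t x)\<^sup>2)"
    using U_weak_gradient
  proof eventually_elim
    case (elim t)
    \<comment> \<open>The gradient chosen by \<open>weak_gradient\<close> may be any version; by
      uniqueness its norm is that of \<open>Gd\<close>, which is a series in the
      coefficients.\<close>
    have "has_weak_gradient (U t) (weak_gradient (U t))"
      unfolding weak_gradient_def by (rule someI[of "has_weak_gradient (U t)", OF conjunct1[OF elim]])
    then have "L2_torus_norm (weak_gradient (U t)) = L2_torus_norm (\<lambda>x. \<chi> i. Gd i t x)"
      by (rule weak_gradient_unique[OF _ conjunct1[OF elim]])
    then have "H1_torus_norm (U t) ^ 2 = (L2_torus_norm (U t))\<^sup>2 + (\<Sum>i\<in>UNIV. LINT x|torus. (Gd i t x)\<^sup>2)"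
      unfolding H1_torus_norm_def using elim by (simp add: add_nonneg_nonneg sum_nonneg)
    then show ?case unfolding L2_torus_norm_def by simp
  qed
  ultimately have "integrable ?L (\<lambda>t. H1_torus_norm (U t) ^ 2)" by (rule integrable_AE_eq(1)[OF complete_L])
  then show ?thesis unfolding bochner_Lp_def space_time_fun_def using U_per U_meas mem by blast
qed

end

section \<open>The distributional equation\<close>

lemma conv_square_integrable:
  fixes f :: "real^'n \<Rightarrow> real"
  assumes "continuous_on UNIV f"
  shows "f \<in> borel_measurable torus" "integrable torus (\<lambda>x. (f x)\<^sup>2)"
  by (rule continuous_imp_torus_measurable[OF assms]) (intro torus_integrable_cont continuous_intros assms)

lemma tconv_cont:
  assumes "cospoly K" "continuous_on UNIV f"
  shows "continuous_on UNIV (tconv K f)"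
  using conv_cont[OF assms] unfolding tconv_def[abs_def] .

lemma vconv_cont:
  assumes "cospoly K" "continuous_on UNIV f"
  shows "continuous_on UNIV (vconv K f)"
  unfolding vconv_def[abs_def]
  by (intro continuous_on_vec_lambda tconv_cont assms continuous_on_component)

lemma tconv_base:
  fixes f :: "real^'n \<Rightarrow> real"
  assumes "continuous_on UNIV f"
  shows "tconv (\<lambda>z. a * cos (2 * pi * (m \<bullet> z))) f x =
    a / 2 * (cas m x * (LINT y|torus. f y * cas m y) + cas (- m) x * (LINT y|torus. f y * cas (- m) y))"
  unfolding tconv_def by (rule conv_base[OF assms])

lemma tconv_add:
  assumes "continuous_on UNIV f" "cospoly K" "cospoly K'"
  shows "tconv (\<lambda>z. K z + K' z) f x = tconv K f x + tconv K' f x"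
  unfolding tconv_def by (rule conv_add[OF assms])

context galerkin_limit
begin

text \<open>Spatial part of the weak formulation, with A in the place of time derivative plus
  Laplacian and V in that of the gradient. As independent arguments they can also be convolved
  derivatives.\<close>

definition pairing :: "real \<Rightarrow> (real^'n \<Rightarrow> real) \<Rightarrow> (real^'n \<Rightarrow> real^'n) \<Rightarrow> real" where
  "pairing t A V = (LINT x|torus. U t x * (A x + b t x \<bullet> V x))"

text \<open>Gathers the facts that hold at almost every time. The series clause covers every f at
  once, in particular the product of \<open>b t\<close> with a gradient, which itself depends on
  t.\<close>

definition good :: "real \<Rightarrow> bool" where
  "good t \<longleftrightarrow> t \<in> {0..T} \<and> b t \<in> torus_L2 \<and> U t \<in> torus_L2 \<and> L2_torus_norm (U t) \<le> sqrt (3 * S0) \<and>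
     (\<forall>f. f \<in> borel_measurable torus \<longrightarrow> integrable torus (\<lambda>x. (f x)\<^sup>2) \<longrightarrow>
         (\<lambda>k. c k t * (LINT x|torus. f x * cas (\<kappa> k) x)) sums (LINT x|torus. U t x * f x))"

lemma AE_good: "AE t in lebesgue_on {0..T}. good t"
  using b_L2 U_L2 U_exp[unfolded L2_expansion_def] AE_space
proof eventually_elim
  case (elim t)
  then show ?case unfolding good_def by simp
qed

lemma good_U: "good t \<Longrightarrow> U t \<in> borel_measurable torus" "good t \<Longrightarrow> integrable torus (\<lambda>x. (U t x)\<^sup>2)"
  unfolding good_def torus_L2_def by auto

lemma good_drift_L2:
  assumes t: "good t" and V: "continuous_on UNIV V"
  shows "(\<lambda>x. b t x \<bullet> V x) \<in> borel_measurable torus" "integrable torus (\<lambda>x. (b t x \<bullet> V x)\<^sup>2)"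
proof -
  obtain C where C: "C \<ge> 0" "\<And>x. x \<in> cbox 0 1 \<Longrightarrow> norm (V x) \<le> C" using torus_bounded[OF V] by blast
  have "b t \<in> torus_L2" using t unfolding good_def by simp
  from torus_L2_inner_square(1,2)[OF this V C(2)]
  show "(\<lambda>x. b t x \<bullet> V x) \<in> borel_measurable torus" "integrable torus (\<lambda>x. (b t x \<bullet> V x)\<^sup>2)" by auto
qed

lemma pairing_integrable:
  assumes t: "good t" and A: "continuous_on UNIV A" and V: "continuous_on UNIV V"
  shows "integrable torus (\<lambda>x. U t x * A x)" "integrable torus (\<lambda>x. U t x * (b t x \<bullet> V x))"
  by (rule L2_mult_integrable[OF good_U(1)[OF t] conv_square_integrable(1)[OF A] good_U(2)[OF t] conv_square_integrable(2)[OF A]])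
     (rule L2_mult_integrable[OF good_U(1)[OF t] good_drift_L2(1)[OF t V] good_U(2)[OF t] good_drift_L2(2)[OF t V]])

lemma pairing_split:
  assumes t: "good t" and A: "continuous_on UNIV A" and V: "continuous_on UNIV V"
  shows "pairing t A V = (LINT x|torus. U t x * A x) + (LINT x|torus. U t x * (b t x \<bullet> V x))"
  unfolding pairing_def distrib_left
  by (rule Bochner_Integration.integral_add[OF pairing_integrable[OF t A V]])

lemma pairing_add:
  assumes t: "good t" and A: "continuous_on UNIV A" "continuous_on UNIV A'" and V: "continuous_on UNIV V" "continuous_on UNIV V'"
  shows "pairing t (\<lambda>x. A x + A' x) (\<lambda>x. V x + V' x) = pairing t A V + pairing t A' V'"
proof -
  have "pairing t (\<lambda>x. A x + A' x) (\<lambda>x. V x + V' x) = (LINT x|torus. (U t x * A x + U t x * (b t x \<bullet> V x)) + (U t x * A' x + U t x * (b t x \<bullet> V' x)))"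
    unfolding pairing_def by (simp add: distrib_left inner_add_right add_ac)
  also have "\<dots> = pairing t A V + pairing t A' V'"
    using pairing_integrable[OF t A(1) V(1)] pairing_integrable[OF t A(2) V(2)]
    unfolding pairing_split[OF t A(1) V(1)] pairing_split[OF t A(2) V(2)] by simp
  finally show ?thesis .
qed

text \<open>Orthonormality isolates \<open>c j t\<close>, and the expansion tested with b . grad e_j
  produces the drift series. Thus pairing with a mode reproduces the terms of the coefficient
  equation.\<close>

lemma pairing_mode:
  assumes t: "good t"
  shows "pairing t (\<lambda>x. \<alpha> * cas (\<kappa> j) x) (\<lambda>x. \<beta> *\<^sub>R cas_grad (\<kappa> j) x) = \<alpha> * c j t + \<beta> * (\<Sum>l. drift j l t * c l t)"
proof -
  have exp: "(\<lambda>k. c k t * (LINT x|torus. f x * cas (\<kappa> k) x)) sums (LINT x|torus. U t x * f x)"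
    if "f \<in> borel_measurable torus" "integrable torus (\<lambda>x. (f x)\<^sup>2)" for f
    using t that unfolding good_def by blast
  have "(\<lambda>k. c k t * (if j = k then 1 else 0)) sums (LINT x|torus. U t x * cas (\<kappa> j) x)"
    using exp[OF cas_L2, of "\<kappa> j"] unfolding cas_orth .
  moreover have "(\<lambda>k. c k t * (if j = k then 1 else 0)) = (\<lambda>k. if k = j then c k t else 0)" by auto
  ultimately have 1: "(LINT x|torus. U t x * cas (\<kappa> j) x) = c j t"
    using sums_single[of j "\<lambda>k. c k t"] sums_unique2 by metis
  have "(\<lambda>k. c k t * (LINT x|torus. (b t x \<bullet> cas_grad (\<kappa> j) x) * cas (\<kappa> k) x)) sums (LINT x|torus. U t x * (b t x \<bullet> cas_grad (\<kappa> j) x))"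
    by (rule exp[OF good_drift_L2[OF t cas_grad_cont]])
  moreover have "(LINT x|torus. (b t x \<bullet> cas_grad (\<kappa> j) x) * cas (\<kappa> k) x) = drift j k t" for k
    unfolding drift_def using t by (simp add: good_def mult.commute)
  ultimately have 2: "(LINT x|torus. U t x * (b t x \<bullet> cas_grad (\<kappa> j) x)) = (\<Sum>l. drift j l t * c l t)"
    by (simp add: sums_iff mult.commute)
  have "pairing t (\<lambda>x. \<alpha> * cas (\<kappa> j) x) (\<lambda>x. \<beta> *\<^sub>R cas_grad (\<kappa> j) x) =
     (LINT x|torus. U t x * (\<alpha> * cas (\<kappa> j) x)) + (LINT x|torus. U t x * (b t x \<bullet> (\<beta> *\<^sub>R cas_grad (\<kappa> j) x)))"
    by (intro pairing_split t continuous_intros cas_grad_cont)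
  also have "(LINT x|torus. U t x * (\<alpha> * cas (\<kappa> j) x)) = \<alpha> * (LINT x|torus. U t x * cas (\<kappa> j) x)"
    by (subst integral_mult_right_zero[symmetric]) (simp add: mult_ac)
  also have "(LINT x|torus. U t x * (b t x \<bullet> (\<beta> *\<^sub>R cas_grad (\<kappa> j) x))) = \<beta> * (LINT x|torus. U t x * (b t x \<bullet> cas_grad (\<kappa> j) x))"
    by (subst integral_mult_right_zero[symmetric]) (simp add: mult_ac)
  finally show ?thesis unfolding 1 2 .
qed

text \<open>Majorants for both limit passages: the first two parts serve the integral over space at
  a good time, the last one the integral over time, where it is integrable because the L^2 norm of
  \<open>b\<close> is.\<close>

lemma pairing_bound:
  assumes t: "good t" and A: "continuous_on UNIV A" "\<And>x. x \<in> cbox 0 1 \<Longrightarrow> \<bar>A x\<bar> \<le> C"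
    and V: "continuous_on UNIV V" "\<And>x. x \<in> cbox 0 1 \<Longrightarrow> norm (V x) \<le> D"
  shows "integrable torus (\<lambda>x. \<bar>U t x\<bar> * (C + D * norm (b t x)))"
    "\<And>x. x \<in> cbox 0 1 \<Longrightarrow> \<bar>U t x * (A x + b t x \<bullet> V x)\<bar> \<le> \<bar>U t x\<bar> * (C + D * norm (b t x))"
    "\<bar>pairing t A V\<bar> \<le> sqrt (3 * S0) * (C + D * L2_torus_norm (b t))"
proof -
  have "\<bar>A 0\<bar> \<le> C" "norm (V 0) \<le> D" by (intro A(2) V(2); auto simp: mem_box_cart)+
  then have CD: "C \<ge> 0" "D \<ge> 0" using norm_ge_zero[of "V 0"] by linarith+
  have bt: "b t \<in> torus_L2" and Ut: "U t \<in> torus_L2" and Un: "L2_torus_norm (U t) \<le> sqrt (3 * S0)"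
    using t unfolding good_def by auto
  have Um: "(\<lambda>x. \<bar>U t x\<bar>) \<in> borel_measurable torus" "integrable torus (\<lambda>x. \<bar>U t x\<bar>\<^sup>2)"
    using good_U[OF t] by auto
  have bm: "(\<lambda>x. norm (b t x)) \<in> borel_measurable torus" "integrable torus (\<lambda>x. (norm (b t x))\<^sup>2)"
    using bt unfolding torus_L2_def by auto
  have i1: "integrable torus (\<lambda>x. \<bar>U t x\<bar>)" using torus_L2_norm_le(1)[OF Ut] by simp
  have i2: "integrable torus (\<lambda>x. \<bar>U t x\<bar> * norm (b t x))"
    by (rule L2_mult_integrable[OF Um(1) bm(1) Um(2) bm(2)])
  show i3: "integrable torus (\<lambda>x. \<bar>U t x\<bar> * (C + D * norm (b t x)))"
    using i1 i2 by (simp add: distrib_left mult.left_commute)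
  show le: "\<bar>U t x * (A x + b t x \<bullet> V x)\<bar> \<le> \<bar>U t x\<bar> * (C + D * norm (b t x))" if "x \<in> cbox 0 1" for x
  proof -
    have "\<bar>b t x \<bullet> V x\<bar> \<le> norm (b t x) * norm (V x)" by (rule Cauchy_Schwarz_ineq2)
    also have "\<dots> \<le> norm (b t x) * D" using V(2)[OF that] by (intro mult_left_mono) auto
    finally have "\<bar>A x + b t x \<bullet> V x\<bar> \<le> C + D * norm (b t x)" using A(2)[OF that] by (simp add: mult.commute)
    then show ?thesis unfolding abs_mult by (rule mult_left_mono) simp
  qed
  have ip: "integrable torus (\<lambda>x. U t x * (A x + b t x \<bullet> V x))"
    unfolding distrib_left using pairing_integrable[OF t A(1) V(1)] by simp
  have "\<bar>pairing t A V\<bar> \<le> (LINT x|torus. \<bar>U t x * (A x + b t x \<bullet> V x)\<bar>)"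
    unfolding pairing_def by (rule integral_abs_bound)
  also have "\<dots> \<le> (LINT x|torus. \<bar>U t x\<bar> * (C + D * norm (b t x)))"
    using le ip i3 by (intro integral_mono) auto
  also have "\<dots> = C * (LINT x|torus. \<bar>U t x\<bar>) + D * (LINT x|torus. \<bar>U t x\<bar> * norm (b t x))"
  proof -
    have "(LINT x|torus. \<bar>U t x\<bar> * (C + D * norm (b t x))) = (LINT x|torus. C * \<bar>U t x\<bar> + D * (\<bar>U t x\<bar> * norm (b t x)))"
      by (simp add: algebra_simps)
    then show ?thesis using i1 i2 by simp
  qed
  also have "\<dots> \<le> C * sqrt (3 * S0) + D * (sqrt (3 * S0) * L2_torus_norm (b t))"
  proof (intro add_mono mult_left_mono CD)
    show "(LINT x|torus. \<bar>U t x\<bar>) \<le> sqrt (3 * S0)" using torus_L2_norm_le(2)[OF Ut] Un by simp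
    have "(LINT x|torus. \<bar>U t x\<bar> * norm (b t x))\<^sup>2 \<le> (L2_torus_norm (U t) * L2_torus_norm (b t))\<^sup>2"
      using L2_Cauchy_Schwarz[OF Um(1) bm(1) Um(2) bm(2)] unfolding L2_torus_norm_def by (simp add: power_mult_distrib)
    then have "(LINT x|torus. \<bar>U t x\<bar> * norm (b t x)) \<le> L2_torus_norm (U t) * L2_torus_norm (b t)"
      by (rule power2_le_imp_le) (simp add: L2_torus_norm_def)
    also have "\<dots> \<le> sqrt (3 * S0) * L2_torus_norm (b t)" using Un by (rule mult_right_mono) (simp add: L2_torus_norm_def)
    finally show "(LINT x|torus. \<bar>U t x\<bar> * norm (b t x)) \<le> sqrt (3 * S0) * L2_torus_norm (b t)" .
  qed
  finally show "\<bar>pairing t A V\<bar> \<le> sqrt (3 * S0) * (C + D * L2_torus_norm (b t))" by (simp add: algebra_simps)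
qed

text \<open>The derivatives of \<phi> are convolved, instead of differentiating a convolution. Then
  each of them converges to its own limit directly by the approximation property of the
  kernels.\<close>

definition test_pairing :: "(real \<times> (real^'n) \<Rightarrow> real) \<Rightarrow> (real^'n \<Rightarrow> real) \<Rightarrow> real \<Rightarrow> real" where
  "test_pairing \<phi> K t = pairing t
     (\<lambda>x. tconv K (\<lambda>y. time_deriv \<phi> (t, y)) x + tconv K (\<lambda>y. space_laplacian \<phi> (t, y)) x)
     (vconv K (\<lambda>y. space_grad \<phi> (t, y)))"

text \<open>Induction over the kernel. For one frequency only the modes m and -m occur, and the
  claim combines two coefficient equations integrated by parts in time. Integrability belongs to the
  claim so that the sum case may add integrals.\<close>

lemma conv_equation:
  fixes \<phi> :: "real \<times> (real^'n) \<Rightarrow> real"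
  assumes s: "smooth \<phi>" and per: "\<And>t. periodic (\<lambda>x. \<phi> (t, x))" and end0: "\<And>x. \<phi> (T, x) = 0" and K: "cospoly K"
  shows "integrable (lebesgue_on {0..T}) (test_pairing \<phi> K) \<and>
    (LINT t|lebesgue_on {0..T}. test_pairing \<phi> K t) + (LINT x|torus. u0 x * tconv K (\<lambda>y. \<phi> (0, y)) x) = 0"
proof -
  have cT: "continuous_on UNIV (\<lambda>y. time_deriv \<phi> (t, y))" for t
    unfolding time_deriv_def by (intro slice_cont smooth_cont smooth_dir_deriv s)
  have cL: "continuous_on UNIV (\<lambda>y. space_laplacian \<phi> (t, y))" for t
    unfolding space_laplacian_def by (intro continuous_on_sum slice_cont smooth_cont smooth_dir_deriv s)
  have cD: "continuous_on UNIV (\<lambda>y. dir_deriv (0, axis i 1) \<phi> (t, y))" for t i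
    by (intro slice_cont smooth_cont smooth_dir_deriv s)
  have cG: "continuous_on UNIV (\<lambda>y. space_grad \<phi> (t, y))" for t
    unfolding space_grad_def by (intro continuous_on_vec_lambda cD)
  have cP: "continuous_on UNIV (\<lambda>y. \<phi> (t, y))" for t by (intro slice_cont smooth_cont s)
  have cA: "continuous_on UNIV (\<lambda>x. tconv K (\<lambda>y. time_deriv \<phi> (t, y)) x + tconv K (\<lambda>y. space_laplacian \<phi> (t, y)) x)" if "cospoly K" for K t
    by (intro continuous_on_add tconv_cont that cT cL)
  define \<theta> where "\<theta> m t = (LINT x|torus. \<phi> (t, x) * cas m x)" for m t
  define \<theta>' where "\<theta>' m t = (LINT x|torus. time_deriv \<phi> (t, x) * cas m x)" for m t
  have d\<theta>: "(\<theta> m has_real_derivative \<theta>' m t) (at t)" for m t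
    unfolding \<theta>_def[abs_def] \<theta>'_def by (rule coefficient_deriv(1)[OF s])
  have c\<theta>: "continuous_on UNIV (\<theta>' m)" for m unfolding \<theta>'_def[abs_def] by (rule coefficient_deriv(2)[OF s])
  have \<theta>T: "\<theta> m T = 0" for m unfolding \<theta>_def end0 by simp
  define H where "H j t = (\<Sum>l. drift j l t * c l t) - 4 * pi\<^sup>2 * (\<kappa> j \<bullet> \<kappa> j) * c j t" for j t
  \<comment> \<open>Integrand that arises when the j-th coefficient equation is tested with the j-th
    coefficient of \<phi>, a smooth function of time vanishing at T.\<close>
  define E where "E j t = \<theta>' (\<kappa> j) t * c j t + \<theta> (\<kappa> j) t * H j t" for j t
  have E: "integrable (lebesgue_on {0..T}) (E j)"
    "(LINT t|lebesgue_on {0..T}. E j t) = - \<theta> (\<kappa> j) 0 * (LINT x|torus. u0 x * cas (\<kappa> j) x)" for j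
  proof -
    have Hi: "integrable (lebesgue_on {0..T}) (H j)" unfolding H_def[abs_def] by (rule H_int)
    have ceq: "c j t = (LINT x|torus. u0 x * cas (\<kappa> j) x) + intv T 0 t (H j)" if "t \<in> {0..T}" for t
      unfolding H_def by (rule c_eq[OF that])
    show "integrable (lebesgue_on {0..T}) (E j)"
      "(LINT t|lebesgue_on {0..T}. E j t) = - \<theta> (\<kappa> j) 0 * (LINT x|torus. u0 x * cas (\<kappa> j) x)"
      unfolding E_def[abs_def] by (rule time_integration_by_parts[OF T Hi d\<theta> c\<theta> \<theta>T ceq]; assumption)+
  qed
  have u0i: "integrable torus (\<lambda>x. u0 x * f x)" if "continuous_on UNIV f" for f
    by (rule L2_mult_integrable[OF u0_L2(1) conv_square_integrable(1)[OF that] u0_L2(2) conv_square_integrable(2)[OF that]])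
  show ?thesis using K
  proof induction
    case (base m a)
    let ?K = "\<lambda>z. a * cos (2 * pi * (m \<bullet> z))"
    \<comment> \<open>Both m and -m occur in the enumeration. For m = 0 the two indices coincide,
      and the same mode is counted twice with weight a / 2.\<close>
    obtain j where j: "\<kappa> j = m" using base \<kappa> by (metis bij_betw_imp_surj_on imageE)
    have "- m \<in> Zvec" using base by simp
    then obtain j' where j': "\<kappa> j' = - m" using \<kappa> by (metis bij_betw_imp_surj_on imageE)
    have ae: "AE t in lebesgue_on {0..T}. test_pairing \<phi> ?K t = a / 2 * (E j t + E j' t)"
      using AE_good
    proof eventually_elim
      case (elim t)
      define l where "l = 4 * pi\<^sup>2 * (m \<bullet> m)"
      have 1: "tconv ?K (\<lambda>y. time_deriv \<phi> (t, y)) x = a / 2 * (cas m x * \<theta>' m t + cas (- m) x * \<theta>' (- m) t)" for x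
        unfolding tconv_base[OF cT] \<theta>'_def ..
      have 2: "tconv ?K (\<lambda>y. space_laplacian \<phi> (t, y)) x = a / 2 * (cas m x * (- l * \<theta> m t) + cas (- m) x * (- l * \<theta> (- m) t))" for x
        unfolding tconv_base[OF cL] coefficient_laplacian[OF s per base] coefficient_laplacian[OF s per \<open>- m \<in> Zvec\<close>] \<theta>_def l_def
        by simp
      have 3: "vconv ?K (\<lambda>y. space_grad \<phi> (t, y)) x = (a / 2 * \<theta> m t) *\<^sub>R cas_grad m x + (a / 2 * \<theta> (- m) t) *\<^sub>R cas_grad (- m) x" for x
      proof -
        have "tconv ?K (\<lambda>y. space_grad \<phi> (t, y) $ i) x =
          a / 2 * (cas m x * (- (2 * pi * m $ i) * \<theta> (- m) t) + cas (- m) x * ((2 * pi * m $ i) * \<theta> m t))" for i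
          unfolding space_grad_def vec_lambda_beta tconv_base[OF cD] coefficient_space_deriv[OF s per base]
            coefficient_space_deriv[OF s per \<open>- m \<in> Zvec\<close>] \<theta>_def by simp
        then show ?thesis unfolding vconv_def cas_grad_def by (simp add: vec_eq_iff algebra_simps)
      qed
      have "test_pairing \<phi> ?K t = pairing t (\<lambda>x. (a / 2 * (\<theta>' m t - l * \<theta> m t)) * cas m x + (a / 2 * (\<theta>' (- m) t - l * \<theta> (- m) t)) * cas (- m) x)
         (\<lambda>x. (a / 2 * \<theta> m t) *\<^sub>R cas_grad m x + (a / 2 * \<theta> (- m) t) *\<^sub>R cas_grad (- m) x)"
        unfolding test_pairing_def 1 2 pairing_def 3 by (intro Bochner_Integration.integral_cong) (auto simp: algebra_simps)
      also have "\<dots> = pairing t (\<lambda>x. (a / 2 * (\<theta>' m t - l * \<theta> m t)) * cas m x) (\<lambda>x. (a / 2 * \<theta> m t) *\<^sub>R cas_grad m x)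
         + pairing t (\<lambda>x. (a / 2 * (\<theta>' (- m) t - l * \<theta> (- m) t)) * cas (- m) x) (\<lambda>x. (a / 2 * \<theta> (- m) t) *\<^sub>R cas_grad (- m) x)"
        by (intro pairing_add[OF elim] continuous_intros cas_grad_cont)
      also have "\<dots> = a / 2 * (E j t + E j' t)"
      proof -
        have "l = 4 * pi\<^sup>2 * (\<kappa> j \<bullet> \<kappa> j)" "l = 4 * pi\<^sup>2 * (\<kappa> j' \<bullet> \<kappa> j')" unfolding l_def j j' by simp_all
        then have H: "H j t = (\<Sum>l. drift j l t * c l t) - l * c j t" "H j' t = (\<Sum>l. drift j' l t * c l t) - l * c j' t"
          unfolding H_def by simp_all
        show ?thesis
          using pairing_mode[OF elim, of "a / 2 * (\<theta>' m t - l * \<theta> m t)" j "a / 2 * \<theta> m t"]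
            pairing_mode[OF elim, of "a / 2 * (\<theta>' (- m) t - l * \<theta> (- m) t)" j' "a / 2 * \<theta> (- m) t"]
          unfolding j j' E_def H by (simp add: algebra_simps)
      qed
      finally show ?case .
    qed
    have i: "integrable (lebesgue_on {0..T}) (\<lambda>t. a / 2 * (E j t + E j' t))" using E(1) by simp
    note res = integrable_AE_eq[OF complete_L i ae]
    have "(LINT x|torus. u0 x * tconv ?K (\<lambda>y. \<phi> (0, y)) x) = (LINT x|torus. (a / 2 * \<theta> m 0) * (u0 x * cas m x) + (a / 2 * \<theta> (- m) 0) * (u0 x * cas (- m) x))"
      unfolding tconv_base[OF cP] \<theta>_def by (intro Bochner_Integration.integral_cong) (auto simp: algebra_simps)
    also have "\<dots> = (a / 2 * \<theta> m 0) * (LINT x|torus. u0 x * cas m x) + (a / 2 * \<theta> (- m) 0) * (LINT x|torus. u0 x * cas (- m) x)"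
      using u0i[OF cas_cont, of m] u0i[OF cas_cont, of "- m"] by simp
    finally have "(LINT t|lebesgue_on {0..T}. test_pairing \<phi> ?K t) + (LINT x|torus. u0 x * tconv ?K (\<lambda>y. \<phi> (0, y)) x) = 0"
      unfolding res(2) using E j j' by (simp add: algebra_simps)
    then show ?case using res(1) by blast
  next
    case (add f g)
    have ae: "AE t in lebesgue_on {0..T}. test_pairing \<phi> (\<lambda>z. f z + g z) t = test_pairing \<phi> f t + test_pairing \<phi> g t"
      using AE_good
    proof eventually_elim
      case (elim t)
      have v: "vconv (\<lambda>z. f z + g z) (\<lambda>y. space_grad \<phi> (t, y)) x = vconv f (\<lambda>y. space_grad \<phi> (t, y)) x + vconv g (\<lambda>y. space_grad \<phi> (t, y)) x" for x
        unfolding vconv_def using tconv_add[OF continuous_on_component[OF cG] add(1,2)] by (simp add: vec_eq_iff)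
      have "test_pairing \<phi> (\<lambda>z. f z + g z) t = pairing t
         (\<lambda>x. (tconv f (\<lambda>y. time_deriv \<phi> (t, y)) x + tconv f (\<lambda>y. space_laplacian \<phi> (t, y)) x) + (tconv g (\<lambda>y. time_deriv \<phi> (t, y)) x + tconv g (\<lambda>y. space_laplacian \<phi> (t, y)) x))
         (\<lambda>x. vconv f (\<lambda>y. space_grad \<phi> (t, y)) x + vconv g (\<lambda>y. space_grad \<phi> (t, y)) x)"
        unfolding test_pairing_def pairing_def v tconv_add[OF cT add(1,2)] tconv_add[OF cL add(1,2)] by (simp add: add_ac)
      also have "\<dots> = test_pairing \<phi> f t + test_pairing \<phi> g t"
        unfolding test_pairing_def by (intro pairing_add[OF elim] cA vconv_cont cG add)
      finally show ?case .
    qed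
    have i: "integrable (lebesgue_on {0..T}) (\<lambda>t. test_pairing \<phi> f t + test_pairing \<phi> g t)" using add by simp
    note res = integrable_AE_eq[OF complete_L i ae]
    have "(LINT x|torus. u0 x * tconv (\<lambda>z. f z + g z) (\<lambda>y. \<phi> (0, y)) x) =
       (LINT x|torus. u0 x * tconv f (\<lambda>y. \<phi> (0, y)) x) + (LINT x|torus. u0 x * tconv g (\<lambda>y. \<phi> (0, y)) x)"
      unfolding tconv_add[OF cP add(1,2)] distrib_left
      by (intro Bochner_Integration.integral_add u0i tconv_cont cP add)
    then have "(LINT t|lebesgue_on {0..T}. test_pairing \<phi> (\<lambda>z. f z + g z) t) + (LINT x|torus. u0 x * tconv (\<lambda>z. f z + g z) (\<lambda>y. \<phi> (0, y)) x) = 0"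
      unfolding res(2) using add by simp
    then show ?case using res(1) by blast
  qed
qed

text \<open>With the kernels of \<open>fejer_kernel\<close> the limit is taken twice by dominated
  convergence, over space at each good time and then over time. The nonnegativity of the kernels
  makes both majorants independent of n.\<close>

lemma U_distributional: "distributional_solution T b u0 U"
  unfolding distributional_solution_def
proof
  fix \<phi> :: "real \<times> (real^'n) \<Rightarrow> real" assume "\<phi> \<in> test_functions {0..<T}"
  then obtain Kc where s: "smooth \<phi>" and per: "\<And>t. periodic (\<lambda>x. \<phi> (t, x))"
    and Kc: "compact Kc" "Kc \<subseteq> {0..<T}" "\<And>t x. t \<in> {0..<T} - Kc \<Longrightarrow> \<phi> (t, x) = 0"
    unfolding test_functions_def by blast
  let ?L = "lebesgue_on {0..T}"
  have sT: "smooth (time_deriv \<phi>)" unfolding time_deriv_def by (rule smooth_dir_deriv[OF s])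
  have cTT: "continuous_on UNIV (time_deriv \<phi>)" by (rule smooth_cont[OF sT])
  have cLL: "continuous_on UNIV (space_laplacian \<phi>)"
    unfolding space_laplacian_def[abs_def] by (intro continuous_on_sum smooth_cont smooth_dir_deriv s)
  have cGG: "continuous_on UNIV (space_grad \<phi>)"
    unfolding space_grad_def[abs_def] by (intro continuous_on_vec_lambda smooth_cont smooth_dir_deriv s)
  note cT = slice_cont[OF cTT] and cL = slice_cont[OF cLL] and cG = slice_cont[OF cGG] and cP = slice_cont[OF smooth_cont[OF s]]
  \<comment> \<open>The support condition constrains \<phi> only at times in the half-open interval;
    a compact subset of it stays away from T, so the value at T follows by continuity from the
    left.\<close>
  have end0: "\<phi> (T, x) = 0" for x
  proof -
    have "\<exists>r<T. \<forall>t. r < t \<and> t < T \<and> 0 \<le> t \<longrightarrow> t \<notin> Kc"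
    proof (cases "Kc = {}")
      case True
      then show ?thesis using T by (intro exI[of _ 0]) auto
    next
      case False
      obtain r where "r \<in> Kc" "\<And>t. t \<in> Kc \<Longrightarrow> t \<le> r" using compact_attains_sup[OF Kc(1) False] by blast
      then show ?thesis using Kc(2) by (intro exI[of _ r]) force
    qed
    then obtain r where r: "r < T" "\<And>t. r < t \<Longrightarrow> t < T \<Longrightarrow> 0 \<le> t \<Longrightarrow> t \<notin> Kc" by blast
    have "continuous_on UNIV (\<lambda>t. \<phi> (t, x))"
      by (rule continuous_on_compose2[OF smooth_cont[OF s]]) (auto intro!: continuous_intros)
    then have "((\<lambda>t. \<phi> (t, x)) \<longlongrightarrow> \<phi> (T, x)) (at_left T)"
      by (auto simp: continuous_on_def intro: tendsto_within_subset)
    moreover have "((\<lambda>t. \<phi> (t, x)) \<longlongrightarrow> 0) (at_left T)"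
    proof (rule tendsto_eventually)
      show "\<forall>\<^sub>F t in at_left T. \<phi> (t, x) = 0"
        by (rule eventually_at_leftI[of "max 0 r"]) (use r T Kc(3) in auto)
    qed
    ultimately show ?thesis using tendsto_unique trivial_limit_at_left_real by blast
  qed
  obtain K :: "nat \<Rightarrow> real^'n \<Rightarrow> real" where K: "\<And>n. cospoly (K n)" "\<And>n z. K n z \<ge> 0"
    "\<And>n x. (LINT y|torus. K n (x - y)) = 1"
    "\<And>f x. continuous_on UNIV f \<Longrightarrow> periodic f \<Longrightarrow> (\<lambda>n. LINT y|torus. K n (x - y) * f y) \<longlonglongrightarrow> f x"
    using fejer_kernel by blast
  note eq = conv_equation[OF s per end0 K(1)]
  have bound: "\<exists>C\<ge>0. \<forall>t\<in>{0..T}. \<forall>x\<in>cbox 0 1. \<bar>f (t, x)\<bar> \<le> C" if "continuous_on UNIV f" for f :: "real \<times> (real^'n) \<Rightarrow> real"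
  proof -
    have "bounded (f ` ({0..T} \<times> cbox 0 1))"
      by (intro compact_imp_bounded compact_continuous_image continuous_on_subset[OF that] compact_Times) auto
    then obtain C where "\<forall>y\<in>f ` ({0..T} \<times> cbox 0 1). norm y \<le> C" unfolding bounded_iff by blast
    then show ?thesis by (intro exI[of _ "max 0 C"]) (auto simp: le_max_iff_disj)
  qed
  obtain C1 where C1: "C1 \<ge> 0" "\<And>t x. t \<in> {0..T} \<Longrightarrow> x \<in> cbox 0 1 \<Longrightarrow> \<bar>time_deriv \<phi> (t, x)\<bar> \<le> C1" using bound[OF cTT] by blast
  obtain C2 where C2: "C2 \<ge> 0" "\<And>t x. t \<in> {0..T} \<Longrightarrow> x \<in> cbox 0 1 \<Longrightarrow> \<bar>space_laplacian \<phi> (t, x)\<bar> \<le> C2" using bound[OF cLL] by blast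
  have "\<exists>C\<ge>0. \<forall>t\<in>{0..T}. \<forall>x\<in>cbox 0 1. \<bar>space_grad \<phi> (t, x) $ i\<bar> \<le> C" for i
    by (rule bound) (intro continuous_on_component cGG)
  then obtain D where D: "\<And>i. D i \<ge> 0" "\<And>i t x. t \<in> {0..T} \<Longrightarrow> x \<in> cbox 0 1 \<Longrightarrow> \<bar>space_grad \<phi> (t, x) $ i\<bar> \<le> D i" by metis
  have b1: "\<bar>tconv (K n) (\<lambda>y. time_deriv \<phi> (t, y)) x + tconv (K n) (\<lambda>y. space_laplacian \<phi> (t, y)) x\<bar> \<le> C1 + C2"
    if "t \<in> {0..T}" for n t x
    unfolding tconv_def
    by (intro order_trans[OF abs_triangle_ineq] add_mono conv_bound K cT cL) (use that C1 C2 in auto)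
  have b2: "norm (vconv (K n) (\<lambda>y. space_grad \<phi> (t, y)) x) \<le> (\<Sum>i\<in>UNIV. D i)" if "t \<in> {0..T}" for n t x
  proof -
    have "norm (vconv (K n) (\<lambda>y. space_grad \<phi> (t, y)) x) \<le> (\<Sum>i\<in>UNIV. \<bar>vconv (K n) (\<lambda>y. space_grad \<phi> (t, y)) x $ i\<bar>)" by (rule norm_le_l1_cart)
    also have "\<dots> \<le> (\<Sum>i\<in>UNIV. D i)"
      unfolding vconv_def tconv_def vec_lambda_beta
      by (intro sum_mono conv_bound K continuous_on_component cG) (use that D in auto)
    finally show ?thesis .
  qed
  have cA: "continuous_on UNIV (\<lambda>x. tconv (K n) (\<lambda>y. time_deriv \<phi> (t, y)) x + tconv (K n) (\<lambda>y. space_laplacian \<phi> (t, y)) x)" for n t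
    by (intro continuous_on_add tconv_cont K cT cL)
  have cV: "continuous_on UNIV (vconv (K n) (\<lambda>y. space_grad \<phi> (t, y)))" for n t by (intro vconv_cont K cG)
  have pT: "periodic (\<lambda>y. time_deriv \<phi> (t, y))" for t unfolding time_deriv_def by (rule dir_deriv_periodic[OF s per])
  have pG: "periodic (\<lambda>y. space_grad \<phi> (t, y) $ i)" for t i
    unfolding space_grad_def using dir_deriv_periodic[OF s per] by simp
  have pL: "periodic (\<lambda>y. space_laplacian \<phi> (t, y))" for t
    using dir_deriv_periodic[OF smooth_dir_deriv[OF s] dir_deriv_periodic[OF s per]]
    unfolding space_laplacian_def periodic_def by simp
  define \<Phi> where "\<Phi> t = (LINT x|torus. U t x * (time_deriv \<phi> (t, x) + b t x \<bullet> space_grad \<phi> (t, x) + space_laplacian \<phi> (t, x)))" for t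
  have lim: "(\<lambda>n. test_pairing \<phi> (K n) t) \<longlonglongrightarrow> \<Phi> t" if t: "good t" for t
  proof -
    have tT: "t \<in> {0..T}" using t unfolding good_def by simp
    define F where "F n x = U t x * ((tconv (K n) (\<lambda>y. time_deriv \<phi> (t, y)) x + tconv (K n) (\<lambda>y. space_laplacian \<phi> (t, y)) x) + b t x \<bullet> vconv (K n) (\<lambda>y. space_grad \<phi> (t, y)) x)" for n x
    define F' where "F' x = U t x * ((time_deriv \<phi> (t, x) + space_laplacian \<phi> (t, x)) + b t x \<bullet> space_grad \<phi> (t, x))" for x
    have "(\<lambda>n. LINT x|torus. F n x) \<longlonglongrightarrow> (LINT x|torus. F' x)"
    proof (rule integral_dominated_convergence[where w="\<lambda>x. \<bar>U t x\<bar> * ((C1 + C2) + (\<Sum>i\<in>UNIV. D i) * norm (b t x))"])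
      show "integrable torus (\<lambda>x. \<bar>U t x\<bar> * ((C1 + C2) + (\<Sum>i\<in>UNIV. D i) * norm (b t x)))"
        by (rule pairing_bound(1)[OF t cA b1[OF tT] cV b2[OF tT]])
      show "AE x in torus. norm (F n x) \<le> \<bar>U t x\<bar> * ((C1 + C2) + (\<Sum>i\<in>UNIV. D i) * norm (b t x))" for n
        unfolding F_def real_norm_def
        by (intro AE_I2 pairing_bound(2)[OF t cA b1[OF tT] cV b2[OF tT]]) simp
      show "F n \<in> borel_measurable torus" for n
        unfolding F_def[abs_def]
        by (intro borel_measurable_times borel_measurable_add good_U(1)[OF t] continuous_imp_torus_measurable[OF tconv_cont[OF K(1) cT]] continuous_imp_torus_measurable[OF tconv_cont[OF K(1) cL]] good_drift_L2(1)[OF t cV])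
      show "F' \<in> borel_measurable torus"
        unfolding F'_def[abs_def]
        by (intro borel_measurable_times borel_measurable_add good_U(1)[OF t] continuous_imp_torus_measurable[OF cT] continuous_imp_torus_measurable[OF cL] good_drift_L2(1)[OF t cG])
      show "AE x in torus. (\<lambda>n. F n x) \<longlonglongrightarrow> F' x"
      proof (rule AE_I2)
        fix x :: "real^'n"
        have "(\<lambda>n. vconv (K n) (\<lambda>y. space_grad \<phi> (t, y)) x) \<longlonglongrightarrow> (\<chi> i. space_grad \<phi> (t, x) $ i)"
          unfolding vconv_def tconv_def by (intro tendsto_vec_lambda K(4) continuous_on_component cG pG)
        then have v: "(\<lambda>n. vconv (K n) (\<lambda>y. space_grad \<phi> (t, y)) x) \<longlonglongrightarrow> space_grad \<phi> (t, x)" by simp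
        show "(\<lambda>n. F n x) \<longlonglongrightarrow> F' x"
          unfolding F_def F'_def tconv_def
          by (intro tendsto_mult tendsto_add tendsto_inner tendsto_const v K(4) cT cL pT pL)
      qed
    qed
    moreover have "(LINT x|torus. F' x) = \<Phi> t" unfolding F'_def \<Phi>_def by (simp add: add_ac)
    moreover have "(LINT x|torus. F n x) = test_pairing \<phi> (K n) t" for n unfolding F_def test_pairing_def pairing_def ..
    ultimately show ?thesis by simp
  qed
  have pm: "test_pairing \<phi> (K n) \<in> borel_measurable ?L" for n using eq[of n] by blast
  \<comment> \<open>Measurability of \<Phi> in time comes from the approximations: it is an almost
    everywhere limit of integrable functions.\<close>
  have "AE t in ?L. \<Phi> t = lim (\<lambda>n. test_pairing \<phi> (K n) t)" using AE_good by eventually_elim (simp add: limI[OF lim])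
  then have \<Phi>m: "\<Phi> \<in> borel_measurable ?L" by (rule borel_measurable_AE_eq[OF complete_L borel_measurable_lim_metric[OF pm]])
  have "(\<lambda>n. LINT t|?L. test_pairing \<phi> (K n) t) \<longlonglongrightarrow> (LINT t|?L. \<Phi> t)"
  proof (rule integral_dominated_convergence[where w="\<lambda>t. sqrt (3 * S0) * ((C1 + C2) + (\<Sum>i\<in>UNIV. D i) * L2_torus_norm (b t))"])
    have "integrable ?L (\<lambda>t. L2_torus_norm (b t))" using b unfolding bochner_Lp_def by simp
    then show "integrable ?L (\<lambda>t. sqrt (3 * S0) * ((C1 + C2) + (\<Sum>i\<in>UNIV. D i) * L2_torus_norm (b t)))" by simp
    show "AE t in ?L. (\<lambda>n. test_pairing \<phi> (K n) t) \<longlonglongrightarrow> \<Phi> t" using AE_good by eventually_elim (rule lim)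
    show "AE t in ?L. norm (test_pairing \<phi> (K n) t) \<le> sqrt (3 * S0) * ((C1 + C2) + (\<Sum>i\<in>UNIV. D i) * L2_torus_norm (b t))" for n
      using AE_good
    proof eventually_elim
      case (elim t)
      then have tT: "t \<in> {0..T}" unfolding good_def by simp
      show ?case unfolding test_pairing_def real_norm_def by (rule pairing_bound(3)[OF elim cA b1[OF tT] cV b2[OF tT]])
    qed
  qed (use \<Phi>m pm in auto)
  moreover have "(\<lambda>n. LINT x|torus. u0 x * tconv (K n) (\<lambda>y. \<phi> (0, y)) x) \<longlonglongrightarrow> (LINT x|torus. u0 x * \<phi> (0, x))"
  proof -
    obtain C where C: "C \<ge> 0" "\<And>x. x \<in> cbox 0 1 \<Longrightarrow> norm (\<phi> (0, x)) \<le> C" using torus_bounded[OF cP] by blast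
    have u0i: "integrable torus (\<lambda>x. u0 x * f x)" if "continuous_on UNIV f" for f
      by (rule L2_mult_integrable[OF u0_L2(1) conv_square_integrable(1)[OF that] u0_L2(2) conv_square_integrable(2)[OF that]])
    show ?thesis
    proof (rule integral_dominated_convergence[where w="\<lambda>x. \<bar>u0 x\<bar> * C"])
      show "AE x in torus. (\<lambda>n. u0 x * tconv (K n) (\<lambda>y. \<phi> (0, y)) x) \<longlonglongrightarrow> u0 x * \<phi> (0, x)"
        unfolding tconv_def by (intro AE_I2 tendsto_mult tendsto_const K(4) cP per)
      show "AE x in torus. norm (u0 x * tconv (K n) (\<lambda>y. \<phi> (0, y)) x) \<le> \<bar>u0 x\<bar> * C" for n
      proof (rule AE_I2)
        fix x
        have "\<bar>tconv (K n) (\<lambda>y. \<phi> (0, y)) x\<bar> \<le> C" unfolding tconv_def using C(2) by (intro conv_bound K cP) auto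
        then show "norm (u0 x * tconv (K n) (\<lambda>y. \<phi> (0, y)) x) \<le> \<bar>u0 x\<bar> * C" by (simp add: abs_mult mult_left_mono)
      qed
      show "integrable torus (\<lambda>x. \<bar>u0 x\<bar> * C)" using torus_L2_norm_le(1)[OF u0] by simp
      show "(\<lambda>x. u0 x * \<phi> (0, x)) \<in> borel_measurable torus" using u0i[OF cP] by blast
      show "(\<lambda>x. u0 x * tconv (K n) (\<lambda>y. \<phi> (0, y)) x) \<in> borel_measurable torus" for n
        using u0i[OF tconv_cont[OF K(1) cP]] by blast
    qed
  qed
  ultimately have "(\<lambda>n. (LINT t|?L. test_pairing \<phi> (K n) t) + (LINT x|torus. u0 x * tconv (K n) (\<lambda>y. \<phi> (0, y)) x)) \<longlonglongrightarrow> (LINT t|?L. \<Phi> t) + (LINT x|torus. u0 x * \<phi> (0, x))"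
    by (rule tendsto_add)
  moreover have "(LINT t|?L. test_pairing \<phi> (K n) t) + (LINT x|torus. u0 x * tconv (K n) (\<lambda>y. \<phi> (0, y)) x) = 0" for n
    using eq[of n] by blast
  ultimately have "(LINT t|?L. \<Phi> t) + (LINT x|torus. u0 x * \<phi> (0, x)) = 0" by (simp add: LIMSEQ_const_iff)
  then show "(LINT t|?L. LINT x|torus. U t x * (time_deriv \<phi> (t, x) + b t x \<bullet> space_grad \<phi> (t, x) + space_laplacian \<phi> (t, x)))
     + (LINT x|torus. u0 x * \<phi> (0, x)) = 0" unfolding \<Phi>_def .
qed

lemma U_parabolic: "parabolic_solution T b u0 U"
  unfolding parabolic_solution_def using U_Linf U_L2H1 U_distributional by blast

end

theorem proposition2p4:
  fixes T :: real
    and b :: "real \<Rightarrow> real ^ 'n \<Rightarrow> real ^ 'n"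
    and u\<^sub>0 :: "real ^ 'n \<Rightarrow> real"
  assumes "T > 0"
    and "b \<in> bochner_Lp 1 T torus_L2 L2_torus_norm"
    and "divergence_free T b"
    and "u\<^sub>0 \<in> torus_L2"
  shows "\<exists>u. parabolic_solution T b u\<^sub>0 u"
proof -
  obtain \<kappa> :: "nat \<Rightarrow> real^'n" where \<kappa>: "bij_betw \<kappa> UNIV Zvec" by (rule Zvec_enumeration)
  interpret advection_diffusion T b u\<^sub>0 \<kappa> using assms \<kappa> by unfold_locales
  let ?L = "lebesgue_on {0..T}"
  obtain c where c: "\<And>j. continuous_on {0..T} (c j)"
    "\<And>n t. t \<in> {0..T} \<Longrightarrow> (\<Sum>j<n. (c j t)\<^sup>2) \<le> 3 * S0"
    "\<And>n. (LINT t|?L. (\<Sum>j<n. 4 * pi\<^sup>2 * (\<kappa> j \<bullet> \<kappa> j) * (c j t)\<^sup>2)) \<le> 3 * S0"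
    "\<And>j. integrable ?L (\<lambda>s. (\<Sum>l. drift j l s * c l s) - 4 * pi\<^sup>2 * (\<kappa> j \<bullet> \<kappa> j) * c j s)"
    "\<And>j t. t \<in> {0..T} \<Longrightarrow> c j t = (LINT x|torus. u\<^sub>0 x * cas (\<kappa> j) x) + intv T 0 t (\<lambda>s. (\<Sum>l. drift j l s * c l s) - 4 * pi\<^sup>2 * (\<kappa> j \<bullet> \<kappa> j) * c j s)"
    by (rule galerkin.galerkin_coefficients[OF galerkin_instance]) blast
  have csq: "integrable ?L (\<lambda>t. (c k t)\<^sup>2)" for k by (intro continuous_imp_integrable_real continuous_intros c)
  have c2: "(LINT t|?L. (\<Sum>k<n. (c k t)\<^sup>2)) \<le> 3 * S0 * T" for n
  proof -
    have "(LINT t|?L. (\<Sum>k<n. (c k t)\<^sup>2)) \<le> (LINT t|?L. 3 * S0)" using csq c(2) by (intro integral_mono) auto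
    also have "\<dots> = 3 * S0 * T" using assms(1) by (simp add: measure_restrict_space)
    finally show ?thesis .
  qed
  \<comment> \<open>The square of one component of \<kappa> is at most the squared norm, so the
    dissipation bound controls each partial derivative separately.\<close>
  have clam: "(LINT t|?L. (\<Sum>j<n. (2 * pi * \<kappa> j $ i * c j t)\<^sup>2)) \<le> 3 * S0" for i n
  proof -
    have "(LINT t|?L. (\<Sum>j<n. (2 * pi * \<kappa> j $ i * c j t)\<^sup>2)) \<le> (LINT t|?L. (\<Sum>j<n. 4 * pi\<^sup>2 * (\<kappa> j \<bullet> \<kappa> j) * (c j t)\<^sup>2))"
    proof (rule integral_mono)
      show "integrable ?L (\<lambda>t. \<Sum>j<n. (2 * pi * \<kappa> j $ i * c j t)\<^sup>2)"
        "integrable ?L (\<lambda>t. \<Sum>j<n. 4 * pi\<^sup>2 * (\<kappa> j \<bullet> \<kappa> j) * (c j t)\<^sup>2)"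
        by (intro continuous_imp_integrable_real continuous_intros c)+
      show "(\<Sum>j<n. (2 * pi * \<kappa> j $ i * c j t)\<^sup>2) \<le> (\<Sum>j<n. 4 * pi\<^sup>2 * (\<kappa> j \<bullet> \<kappa> j) * (c j t)\<^sup>2)" for t
      proof (rule sum_mono)
        fix j
        have "(\<kappa> j $ i)\<^sup>2 \<le> \<kappa> j \<bullet> \<kappa> j"
          using component_le_norm_cart[of "\<kappa> j" i] by (simp add: power2_norm_eq_inner[symmetric] abs_le_square_iff[symmetric])
        then have "4 * pi\<^sup>2 * (\<kappa> j $ i)\<^sup>2 * (c j t)\<^sup>2 \<le> 4 * pi\<^sup>2 * (\<kappa> j \<bullet> \<kappa> j) * (c j t)\<^sup>2"
          by (intro mult_right_mono mult_left_mono) auto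
        then show "(2 * pi * \<kappa> j $ i * c j t)\<^sup>2 \<le> 4 * pi\<^sup>2 * (\<kappa> j \<bullet> \<kappa> j) * (c j t)\<^sup>2"
          by (simp add: power_mult_distrib)
      qed
    qed
    also have "\<dots> \<le> 3 * S0" by (rule c(3))
    finally show ?thesis .
  qed
  obtain U :: "real \<Rightarrow> real^'n \<Rightarrow> real" where U: "\<And>t. periodic (U t)"
    "(\<lambda>(t, x). U t x) \<in> borel_measurable (lebesgue_on ({0..T} \<times> cbox 0 1))"
    "AE t in ?L. L2_expansion (\<lambda>k. cas (\<kappa> k)) (\<lambda>k. c k t) (U t)"
    by (rule coefficient_expansion[OF c(1) cas_cont cas_periodic[OF \<kappa>_Zvec] cas_orth c2]) blast
  \<comment> \<open>Negation permutes the lattice, so \<open>cas (- \<kappa> k)\<close> is the same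
    orthonormal system in another order and the expansion applies to the coefficients of each
    partial derivative, with the dissipation bound.\<close>
  have "\<forall>i. \<exists>g :: real \<Rightarrow> real^'n \<Rightarrow> real. (\<forall>t. periodic (g t)) \<and>
     (AE t in ?L. L2_expansion (\<lambda>k. cas (- \<kappa> k)) (\<lambda>k. 2 * pi * \<kappa> k $ i * c k t) (g t))"
    (is "\<forall>i. \<exists>g. ?P i g")
  proof
    fix i
    show "\<exists>g. ?P i g"
    proof (rule coefficient_expansion[of T "\<lambda>k t. 2 * pi * \<kappa> k $ i * c k t" "\<lambda>k. cas (- \<kappa> k)", OF _ cas_cont cas_periodic _ clam])
      show "continuous_on {0..T} (\<lambda>t. 2 * pi * \<kappa> k $ i * c k t)" for k by (intro continuous_intros c)
      show "- \<kappa> k \<in> Zvec" for k by simp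
      show "(LINT x|torus. cas (- \<kappa> i) x * cas (- \<kappa> j) x) = (if i = j then 1 else 0)" for i j
        by (simp add: cas_orthonormal)
    qed blast
  qed
  from choice[OF this] obtain Gd :: "'n \<Rightarrow> real \<Rightarrow> real^'n \<Rightarrow> real" where Gd: "\<forall>i. (\<forall>t. periodic (Gd i t)) \<and>
     (AE t in ?L. L2_expansion (\<lambda>k. cas (- \<kappa> k)) (\<lambda>k. 2 * pi * \<kappa> k $ i * c k t) (Gd i t))"
    by blast
  have "galerkin_limit T b u\<^sub>0 \<kappa> c U Gd"
  proof (unfold_locales)
  qed (use c clam U Gd in blast)+
  then show ?thesis using galerkin_limit.U_parabolic by blast
qed

end
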